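(* Let $I\subset\mathbb R$ be an interval and let $(\gamma_h,\gamma_h^d):I\to\Delta_1$ be a spacelike Legendre curve with curvature $(m_h,n_h)$ such that $\{t\in I:n_h(t)\neq0\}$ is dense in $I$. Suppose there exist smooth functions $f,\varphi:I\to\mathbb R$ such that $m_h(t)+f(t)n_h(t)=0$ and $m_h(t)\cosh\varphi(t)+n_h(t)\sinh\varphi(t)=0$ for all $t\in I$. Then $f(t)=\tanh\varphi(t)$ for all $t\in I$. Let $\mathcal{HE}^\pm$ be the hyperbolic horocyclic evolutes and $HE$ the hyperbolic evolute of $(\gamma_h,\gamma_h^d)$. For any $t_0\in I$ and each choice of sign $\pm$ the following hold. (1) Suppose that $m_h(t_0)=0$. Then $t_0$ is a singular point of $\mathcal{HE}^\pm$ if and only if $t_0$ is a singular point of $HE$. Moreover: (i) $t_0$ is a $(2,3)$-cusp of $\mathcal{HE}^\pm$ if and only if $t_0$ is a $(2,3)$-cusp of $HE$; (ii) $t_0$ is a $(3,4)$-cusp of $\mathcal{HE}^\pm$ if and only if $t_0$ is a $(3,4)$-cusp of $HE$. (2) Suppose that $m_h(t_0)\neq0$. Then: (i) if $t_0$ is a singular point of $\mathcal{HE}^\pm$, then $t_0$ is a regular point of $HE$; (ii) if $t_0$ is a singular point of $HE$, then $t_0$ is a regular point of $\mathcal{HE}^\pm$. (3) Suppose that $\dot m_h(t_0)=0$. Then: (i) $t_0$ is a $(2,5)$-cusp of $\mathcal{HE}^\pm$ if and only if $t_0$ is a $(2,5)$-cusp of $HE$; (ii) $t_0$ is a $(3,5)$-cusp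 of $\mathcal{HE}^\pm$ if and only if $t_0$ is a $(3,5)$-cusp of $HE$.
   Context: All maps are $C^\infty$. $\mathbb R^3_1$ is $\mathbb R^3$ with $\langle x,y\rangle=-x_1y_1+x_2y_2+x_3y_3$ and $x\wedge y=(-(x_2y_3-x_3y_2),\,x_3y_1-x_1y_3,\,x_1y_2-x_2y_1)$. $H^2=\{x:\langle x,x\rangle=-1\}$, $S^2_1=\{x:\langle x,x\rangle=1\}$, $\Delta_1=\{(v,w)\in H^2\times S_1^2:\langle v,w\rangle=0\}$. A spacelike Legendre curve in $\Delta_1$ is a smooth map $(\gamma_h,\gamma_h^d):I\to\Delta_1$ with $\langle\dot\gamma_h,\gamma_h^d\rangle=0$ on $I$. Put $\gamma_h^s=\gamma_h\wedge\gamma_h^d\in S_1^2$. Its curvature $(m_h,n_h)$ is defined by $\dot\gamma_h=m_h\gamma_h^s$, $\dot\gamma_h^d=n_h\gamma_h^s$, $\dot\gamma_h^s=m_h\gamma_h-n_h\gamma_h^d$. Hyperbolic horocyclic evolutes: $\mathcal{HE}^\pm=\gamma_h+f\gamma_h^d+\frac{f^2}{2}(\gamma_h\pm\gamma_h^s):I\to H^2$. Hyperbolic evolute: $HE=\cosh\varphi\,\gamma_h+\sinh\varphi\,\gamma_h^d:I\to H^2$. A point $t_0$ is a singular (regular) point of a smooth curve if its derivative vanishes (does not vanish) at $t_0$. For $(i,j)\in\{(2,3),(2,5),(3,4),(3,5)\}$, a smooth curve in $H^2$ has an $(i,j)$-cusp at $t_0$ (and $t_0$ is called an $(i,j)$-cusp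 of it) if its germ at $t_0$ is $\mathcal A$-equivalent (equivalent under local diffeomorphisms of source and target) to the germ $t\mapsto(t^i,t^j)$ at the origin. *)

theory Defs
  imports "HOL-Analysis.Analysis"
begin

primrec ck_on :: "nat \<Rightarrow> 'a::euclidean_space set \<Rightarrow> ('a \<Rightarrow> 'b::euclidean_space) \<Rightarrow> bool" where
  "ck_on 0 U f \<longleftrightarrow> continuous_on U f"
| "ck_on (Suc k) U f \<longleftrightarrow>
     (\<forall>x\<in>U. f differentiable (at x)) \<and>
     (\<forall>v. ck_on k U (\<lambda>x. frechet_derivative f (at x) v))"

text \<open>A map on an arbitrary subset S of a Euclidean space is smooth if locally it extends to a
  smooth map on an open set. This covers intervals with or without
  endpoints, open sets, and open pieces of the hyperbolic plane.\<close>

definition smooth_on :: "'a::euclidean_space set \<Rightarrow> ('a \<Rightarrow> 'b::euclidean_space) \<Rightarrow> bool" where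
  "smooth_on S f \<longleftrightarrow>
     (\<forall>x\<in>S. \<exists>U F. open U \<and> x \<in> U \<and> (\<forall>k. ck_on k U F) \<and> (\<forall>y\<in>U \<inter> S. F y = f y))"

definition diffeo :: "'a::euclidean_space set \<Rightarrow> 'b::euclidean_space set \<Rightarrow> ('a \<Rightarrow> 'b) \<Rightarrow> bool" where
  "diffeo S T h \<longleftrightarrow> (\<exists>g. homeomorphism S T h g \<and> smooth_on S h \<and> smooth_on T g)"

text \<open>Equivalence, up to local diffeomorphisms of source and target, of the germ of f : X \<rightarrow> M at p
  and the germ of g : Y \<rightarrow> N at q.\<close>

definition germs_A_equivalent ::
  "'a::euclidean_space set \<Rightarrow> 'b::euclidean_space set \<Rightarrow> ('a \<Rightarrow> 'b) \<Rightarrow> 'a \<Rightarrow>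
   'c::euclidean_space set \<Rightarrow> 'd::euclidean_space set \<Rightarrow> ('c \<Rightarrow> 'd) \<Rightarrow> 'c \<Rightarrow> bool" where
  "germs_A_equivalent X M f p Y N g q \<longleftrightarrow>
     (\<exists>U U' V V' h k.
        openin (top_of_set X) U \<and> p \<in> U \<and> openin (top_of_set Y) U' \<and> q \<in> U' \<and>
        openin (top_of_set M) V \<and> f ` U \<subseteq> V \<and> openin (top_of_set N) V' \<and> g ` U' \<subseteq> V' \<and>
        diffeo U U' h \<and> h p = q \<and> diffeo V V' k \<and>
        (\<forall>t\<in>U. k (f t) = g (h t)))"

definition mink :: "real^3 \<Rightarrow> real^3 \<Rightarrow> real" where
  "mink x y = - (x$1 * y$1) + x$2 * y$2 + x$3 * y$3"

definition wedge :: "real^3 \<Rightarrow> real^3 \<Rightarrow> real^3" where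
  "wedge x y = vector [- (x$2 * y$3 - x$3 * y$2), x$3 * y$1 - x$1 * y$3, x$1 * y$2 - x$2 * y$1]"

definition H2 :: "(real^3) set" where
  "H2 = {x. mink x x = -1}"

definition S21 :: "(real^3) set" where
  "S21 = {x. mink x x = 1}"

definition Delta1 :: "((real^3) \<times> (real^3)) set" where
  "Delta1 = {(v, w). v \<in> H2 \<and> w \<in> S21 \<and> mink v w = 0}"

definition spacelike_legendre_curve ::
  "real set \<Rightarrow> (real \<Rightarrow> real^3) \<Rightarrow> (real \<Rightarrow> real^3) \<Rightarrow> bool" where
  "spacelike_legendre_curve I \<gamma> \<gamma>d \<longleftrightarrow>
     smooth_on I \<gamma> \<and> smooth_on I \<gamma>d \<and> (\<forall>t\<in>I. (\<gamma> t, \<gamma>d t) \<in> Delta1) \<and>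
     (\<forall>t\<in>I. mink (vector_derivative \<gamma> (at t within I)) (\<gamma>d t) = 0)"

definition gamma_s :: "(real \<Rightarrow> real^3) \<Rightarrow> (real \<Rightarrow> real^3) \<Rightarrow> real \<Rightarrow> real^3" where
  "gamma_s \<gamma> \<gamma>d t = wedge (\<gamma> t) (\<gamma>d t)"

definition is_curvature ::
  "real set \<Rightarrow> (real \<Rightarrow> real^3) \<Rightarrow> (real \<Rightarrow> real^3) \<Rightarrow> (real \<Rightarrow> real) \<Rightarrow> (real \<Rightarrow> real) \<Rightarrow> bool" where
  "is_curvature I \<gamma> \<gamma>d m n \<longleftrightarrow>
     (\<forall>t\<in>I.
        (\<gamma> has_vector_derivative m t *\<^sub>R gamma_s \<gamma> \<gamma>d t) (at t within I) \<and>
        (\<gamma>d has_vector_derivative n t *\<^sub>R gamma_s \<gamma> \<gamma>d t) (at t within I) \<and>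
        (gamma_s \<gamma> \<gamma>d has_vector_derivative m t *\<^sub>R \<gamma> t - n t *\<^sub>R \<gamma>d t) (at t within I))"

text \<open>The sign \<epsilon> is 1 or -1.\<close>

definition horocyclic_evolute ::
  "real \<Rightarrow> (real \<Rightarrow> real^3) \<Rightarrow> (real \<Rightarrow> real^3) \<Rightarrow> (real \<Rightarrow> real) \<Rightarrow> real \<Rightarrow> real^3" where
  "horocyclic_evolute \<epsilon> \<gamma> \<gamma>d f t =
     \<gamma> t + f t *\<^sub>R \<gamma>d t + ((f t)\<^sup>2 / 2) *\<^sub>R (\<gamma> t + \<epsilon> *\<^sub>R gamma_s \<gamma> \<gamma>d t)"

definition hyperbolic_evolute ::
  "(real \<Rightarrow> real^3) \<Rightarrow> (real \<Rightarrow> real^3) \<Rightarrow> (real \<Rightarrow> real) \<Rightarrow> real \<Rightarrow> real^3" where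
  "hyperbolic_evolute \<gamma> \<gamma>d \<phi> t = cosh (\<phi> t) *\<^sub>R \<gamma> t + sinh (\<phi> t) *\<^sub>R \<gamma>d t"

text \<open>At an endpoint of I the derivative is one-sided.\<close>

definition singular_point :: "real set \<Rightarrow> (real \<Rightarrow> real^3) \<Rightarrow> real \<Rightarrow> bool" where
  "singular_point I c t0 \<longleftrightarrow> vector_derivative c (at t0 within I) = 0"

definition regular_point :: "real set \<Rightarrow> (real \<Rightarrow> real^3) \<Rightarrow> real \<Rightarrow> bool" where
  "regular_point I c t0 \<longleftrightarrow> vector_derivative c (at t0 within I) \<noteq> 0"

text \<open>The source of the model germ is the whole line, so an endpoint of I is never a cusp.\<close>

definition is_cusp :: "nat \<Rightarrow> nat \<Rightarrow> real set \<Rightarrow> (real \<Rightarrow> real^3) \<Rightarrow> real \<Rightarrow> bool" where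
  "is_cusp i j I c t0 \<longleftrightarrow>
     germs_A_equivalent I H2 c t0 (UNIV :: real set) (UNIV :: (real \<times> real) set)
       (\<lambda>t. (t ^ i, t ^ j)) 0"

end

theory Submission
  imports Defs "HOL-Computational_Algebra.Formal_Power_Series"
begin

text \<open>The derivatives factor as \<open>HE' = \<phi>' e\<close> and \<open>HE\<^sup>\<plusminus>' = (f' \<mp> f\<^sup>2 n / 2) w\<close>, where \<open>e\<close> and \<open>w\<close> are unit
  spacelike directions and, \<open>a\<close> being the respective scalar factor, the derivative of the direction has
  the form \<open>a u + n z\<close>. In the chart \<open>(x\<^sub>2, x\<^sub>3)\<close> of the hyperbolic plane both evolutes are plane
  frontals of this shape, and for such frontals each type of cusp amounts to conditions on finitely many
  Taylor coefficients of \<open>a\<close> and \<open>n\<close>. Since \<open>f = tanh \<phi>\<close> gives \<open>f' = (1 - f\<^sup>2) \<phi>'\<close>, the two factors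
  satisfy the same conditions once \<open>f n = - m\<close>, respectively its derivative, vanishes.

  The recognition of cusps rests on the fact that, for \<open>i \<le> 3\<close>, a smooth germ is a smooth function of
  \<open>(t ^ i, t ^ j)\<close> as soon as its Taylor coefficients vanish outside the semigroup generated by
  \<open>i\<close> and \<open>j\<close>. By Borel's lemma this reduces to flat germs, which remain smooth after composition with
  an \<open>i\<close>-th root. Borel's lemma also realises every formal change of parameter, so that the whole
  criterion becomes a statement on formal power series.\<close>

section \<open>Smooth maps\<close>

text \<open>Equality of jets does not yield \<open>is_cusp\<close>: the equivalence is one of smooth
  germs, so flat remainders must be absorbed into the target diffeomorphism as well. The restriction
  \<open>i \<le> 3\<close> makes this elementary: for \<open>i = 2\<close> even and odd parts
  separate the residues, and for \<open>i = 3\<close> the cube root is defined on the whole line.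

  The two factors are compared through
  \<open>(1 - f\<^sup>2) \<phi>' - \<epsilon> f\<^sup>2 n / 2\<close>, where
  \<open>f\<^sup>2 < 1\<close>, so only the last term can make a difference. Cusps of type (2,3) and
  (3,4) require \<open>n \<noteq> 0\<close> at the point; then \<open>m = 0\<close> forces
  \<open>f = 0\<close>, and the term does not reach the coefficients that are tested. Cusps of type
  (2,5) and (3,5) require \<open>n = 0\<close>, where \<open>f\<close> may be nonzero; the vanishing
  derivative of \<open>m\<close> then gives \<open>f n' = 0\<close>, and this relation removes what
  is left of the term, a multiple of \<open>f\<^sup>2 n''\<close>.\<close>

lemma ck_on_cong:
  assumes "open U" "\<And>x. x \<in> U \<Longrightarrow> f x = g x" "ck_on k U f"
  shows "ck_on k U g"
  using assms(2,3)
proof (induction k arbitrary: f g)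
  case 0
  then show ?case using continuous_on_cong by auto
next
  case (Suc k)
  have d: "g differentiable (at x)"
    and e: "frechet_derivative f (at x) = frechet_derivative g (at x)" if "x \<in> U" for x
  proof -
    have "f differentiable (at x)" using Suc.prems that by auto
    then show "frechet_derivative f (at x) = frechet_derivative g (at x)"
      using frechet_derivative_transform_within_open[OF _ assms(1) that] Suc.prems(1) by blast
    from \<open>f differentiable (at x)\<close> show "g differentiable (at x)"
      using has_derivative_transform_within_open[OF _ assms(1) that] Suc.prems(1)
      unfolding differentiable_def by blast
  qed
  show ?case
    unfolding ck_on.simps
  proof (intro conjI ballI allI)
    fix v
    have "ck_on k U (\<lambda>x. frechet_derivative f (at x) v)" using Suc.prems by auto
    then show "ck_on k U (\<lambda>x. frechet_derivative g (at x) v)"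
      by (rule Suc.IH[rotated]) (simp add: e)
  qed (use d in auto)
qed

lemma ck_on_SucI:
  assumes "open U" "\<And>x. x \<in> U \<Longrightarrow> (f has_derivative f' x) (at x)"
    "\<And>v. ck_on k U (\<lambda>x. f' x v)"
  shows "ck_on (Suc k) U f"
  unfolding ck_on.simps
proof (intro conjI ballI allI)
  show "f differentiable at x" if "x \<in> U" for x
    using assms(2)[OF that] differentiable_def by blast
  show "ck_on k U (\<lambda>x. frechet_derivative f (at x) v)" for v
    by (rule ck_on_cong[OF assms(1) _ assms(3)]) (simp add: frechet_derivative_at[OF assms(2), symmetric])
qed

lemma ck_on_has_derivative:
  "ck_on (Suc k) U f \<Longrightarrow> x \<in> U \<Longrightarrow> (f has_derivative frechet_derivative f (at x)) (at x)"
  by (simp add: frechet_derivative_works[symmetric])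

lemma ck_on_frechet:
  "ck_on (Suc k) U f \<Longrightarrow> ck_on k U (\<lambda>x. frechet_derivative f (at x) v)"
  by auto

lemma ck_on_Suc_imp: "ck_on (Suc k) U f \<Longrightarrow> ck_on k U f"
proof (induction k arbitrary: f)
  case 0
  then show ?case
    by (auto intro!: continuous_at_imp_continuous_on differentiable_imp_continuous_within)
next
  case (Suc k)
  show ?case
    unfolding ck_on.simps
  proof (intro conjI ballI allI)
    show "f differentiable at x" if "x \<in> U" for x
      using Suc.prems that by simp
    show "ck_on k U (\<lambda>x. frechet_derivative f (at x) v)" for v
      by (rule Suc.IH[OF ck_on_frechet[OF Suc.prems]])
  qed
qed

lemma ck_on_imp_continuous_on: "ck_on k U f \<Longrightarrow> continuous_on U f"
proof (induction k)
  case (Suc k)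
  then show ?case using ck_on_Suc_imp by blast
qed simp

lemma ck_on_subset: "ck_on k U f \<Longrightarrow> V \<subseteq> U \<Longrightarrow> ck_on k V f"
proof (induction k arbitrary: f)
  case 0
  then show ?case using continuous_on_subset by auto
next
  case (Suc k)
  show ?case
    unfolding ck_on.simps
  proof (intro conjI ballI allI)
    show "f differentiable at x" if "x \<in> V" for x
      using Suc.prems that by auto
    show "ck_on k V (\<lambda>x. frechet_derivative f (at x) v)" for v
      by (rule Suc.IH[OF ck_on_frechet[OF Suc.prems(1)] Suc.prems(2)])
  qed
qed

lemma ck_on_local:
  assumes "\<And>x. x \<in> U \<Longrightarrow> \<exists>V. open V \<and> x \<in> V \<and> ck_on k V f"
  shows "ck_on k U f"
  using assms
proof (induction k arbitrary: f)
  case 0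
  then show ?case
    by (metis ck_on.simps(1) continuous_at_imp_continuous_on continuous_on_eq_continuous_at)
next
  case (Suc k)
  show ?case
    unfolding ck_on.simps
  proof (intro conjI ballI allI)
    show "f differentiable at x" if "x \<in> U" for x
      using Suc.prems[OF that] by auto
    show "ck_on k U (\<lambda>x. frechet_derivative f (at x) v)" for v
      by (rule Suc.IH) (use Suc.prems in fastforce)
  qed
qed

lemma ck_on_const: "open U \<Longrightarrow> ck_on k U (\<lambda>x. c)"
  by (induction k arbitrary: c) (auto intro!: ck_on_SucI[where f'="\<lambda>x v. 0"] simp del: ck_on.simps(2))

lemma ck_on_linear:
  assumes "bounded_linear f" "open U"
  shows "ck_on k U f"
proof (cases k)
  case 0
  then show ?thesis by (simp add: assms linear_continuous_on)
next
  case (Suc n)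
  then show ?thesis
    using assms by (auto intro!: ck_on_SucI[where f'="\<lambda>x v. f v"] ck_on_const
        bounded_linear_imp_has_derivative simp del: ck_on.simps)
qed

lemma ck_on_add:
  assumes "open U" "ck_on k U f" "ck_on k U g"
  shows "ck_on k U (\<lambda>x. f x + g x)"
  using assms(2,3)
proof (induction k arbitrary: f g)
  case 0
  then show ?case by (auto intro: continuous_on_add)
next
  case (Suc k)
  show ?case
    by (rule ck_on_SucI[OF assms(1) has_derivative_add[OF Suc.prems[THEN ck_on_has_derivative]]])
       (use Suc in auto)
qed

lemma ck_on_scaleR:
  fixes f :: "'a::euclidean_space \<Rightarrow> real" and g :: "'a \<Rightarrow> 'b::euclidean_space"
  assumes "open U" "ck_on k U f" "ck_on k U g"
  shows "ck_on k U (\<lambda>x. f x *\<^sub>R g x)"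
  using assms(2,3)
proof (induction k arbitrary: f g)
  case 0
  then show ?case by (auto intro: continuous_on_scaleR)
next
  case (Suc k)
  show ?case
  proof (rule ck_on_SucI[OF assms(1) has_derivative_scaleR[OF Suc.prems[THEN ck_on_has_derivative]]])
    fix v
    show "ck_on k U (\<lambda>x. f x *\<^sub>R frechet_derivative g (at x) v +
        frechet_derivative f (at x) v *\<^sub>R g x)"
      by (intro ck_on_add Suc.IH assms(1) ck_on_frechet[OF Suc.prems(1)] ck_on_frechet[OF Suc.prems(2)]
          ck_on_Suc_imp[OF Suc.prems(1)] ck_on_Suc_imp[OF Suc.prems(2)])
  qed
qed

lemma ck_on_sum:
  assumes "open U" "\<And>i. i \<in> A \<Longrightarrow> ck_on k U (f i)"
  shows "ck_on k U (\<lambda>x. \<Sum>i\<in>A. f i x)"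
proof (cases "finite A")
  case True
  then show ?thesis using assms(2)
    by (induction A) (auto intro!: ck_on_add ck_on_const assms(1))
qed (simp add: ck_on_const assms)

lemma ck_on_bounded_linear_compose:
  assumes "open U" "bounded_linear L" "ck_on k U f"
  shows "ck_on k U (\<lambda>x. L (f x))"
  using assms(3)
proof (induction k arbitrary: f)
  case 0
  then show ?case using assms(2) by (auto intro: bounded_linear.continuous_on)
next
  case (Suc k)
  show ?case
  proof (rule ck_on_SucI[OF assms(1) bounded_linear.has_derivative[OF assms(2) Suc.prems[THEN ck_on_has_derivative]]])
    show "ck_on k U (\<lambda>x. L (frechet_derivative f (at x) v))" for v
      by (intro Suc.IH ck_on_frechet Suc.prems)
  qed
qed

lemma ck_on_compose:
  fixes f :: "'a::euclidean_space \<Rightarrow> 'b::euclidean_space" and g :: "'b \<Rightarrow> 'c::euclidean_space"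
  assumes "open U" "open V" "f ` U \<subseteq> V" "ck_on k V g" "ck_on k U f"
  shows "ck_on k U (\<lambda>x. g (f x))"
  using assms(4,5)
proof (induction k arbitrary: g)
  case 0
  then show ?case using assms(3) by (auto intro: continuous_on_compose2)
next
  case (Suc k)
  let ?Df = "\<lambda>x. frechet_derivative f (at x)" and ?Dg = "\<lambda>y. frechet_derivative g (at y)"
  show ?case
  proof (rule ck_on_SucI[OF assms(1)])
    fix x assume x: "x \<in> U"
    then have fx: "f x \<in> V" using assms(3) by auto
    have 1: "((\<lambda>x. g (f x)) has_derivative (\<lambda>v. ?Dg (f x) (?Df x v))) (at x)"
      using has_derivative_compose[OF ck_on_has_derivative[OF Suc.prems(2) x]
          ck_on_has_derivative[OF Suc.prems(1) fx]] by simp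
    \<comment> \<open>The derivative of \<open>g\<close> is evaluated in a direction that itself
      depends on \<open>x\<close>. Expanding this direction in the basis leaves scalar functions
      times derivatives in fixed directions, to which the induction hypothesis applies.\<close>
    have "?Dg (f x) w = (\<Sum>b\<in>Basis. (w \<bullet> b) *\<^sub>R ?Dg (f x) b)" for w
    proof -
      have "linear (?Dg (f x))"
        using ck_on_has_derivative[OF Suc.prems(1) fx] has_derivative_linear by blast
      then have "?Dg (f x) (\<Sum>b\<in>Basis. (w \<bullet> b) *\<^sub>R b) = (\<Sum>b\<in>Basis. (w \<bullet> b) *\<^sub>R ?Dg (f x) b)"
        by (simp add: linear_sum linear_cmul)
      then show ?thesis by (simp only: euclidean_representation)
    qed
    then have "(\<lambda>v. ?Dg (f x) (?Df x v)) = (\<lambda>v. \<Sum>b\<in>Basis. (?Df x v \<bullet> b) *\<^sub>R ?Dg (f x) b)"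
      by blast
    with 1 show "((\<lambda>x. g (f x)) has_derivative
        (\<lambda>v. \<Sum>b\<in>Basis. (?Df x v \<bullet> b) *\<^sub>R ?Dg (f x) b)) (at x)" by (simp only:)
  next
    fix v
    show "ck_on k U (\<lambda>x. \<Sum>b\<in>Basis. (?Df x v \<bullet> b) *\<^sub>R ?Dg (f x) b)"
    proof (intro ck_on_sum ck_on_scaleR assms(1))
      fix b :: 'b
      show "ck_on k U (\<lambda>x. ?Df x v \<bullet> b)"
        by (rule ck_on_bounded_linear_compose[OF assms(1) bounded_linear_inner_left
              ck_on_frechet[OF Suc.prems(2)]])
      show "ck_on k U (\<lambda>x. ?Dg (f x) b)"
        by (rule Suc.IH[of "\<lambda>y. ?Dg y b", OF ck_on_frechet[OF Suc.prems(1)] ck_on_Suc_imp[OF Suc.prems(2)]])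
    qed
  qed
qed

section \<open>Functions smooth to all orders on open sets\<close>

definition Cinf :: "'a::euclidean_space set \<Rightarrow> ('a \<Rightarrow> 'b::euclidean_space) \<Rightarrow> bool"
  where "Cinf U f \<longleftrightarrow> open U \<and> (\<forall>k. ck_on k U f)"

lemma Cinf_open: "Cinf U f \<Longrightarrow> open U"
  by (simp add: Cinf_def)

lemma Cinf_cong: "Cinf U f \<Longrightarrow> (\<And>x. x \<in> U \<Longrightarrow> f x = g x) \<Longrightarrow> Cinf U g"
  unfolding Cinf_def using ck_on_cong by blast

lemma Cinf_subset: "Cinf U f \<Longrightarrow> V \<subseteq> U \<Longrightarrow> open V \<Longrightarrow> Cinf V f"
  unfolding Cinf_def using ck_on_subset by blast

lemma Cinf_local: "(\<And>x. x \<in> U \<Longrightarrow> \<exists>V. x \<in> V \<and> Cinf V f) \<Longrightarrow> open U \<Longrightarrow> Cinf U f"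
  unfolding Cinf_def by (meson ck_on_local)

lemma Cinf_const: "open U \<Longrightarrow> Cinf U (\<lambda>x. c)"
  by (simp add: Cinf_def ck_on_const)

lemma Cinf_linear: "bounded_linear f \<Longrightarrow> open U \<Longrightarrow> Cinf U f"
  by (simp add: Cinf_def ck_on_linear)

lemma Cinf_ident: "open U \<Longrightarrow> Cinf U (\<lambda>x. x)"
  by (rule Cinf_linear) auto

lemma Cinf_add: "Cinf U f \<Longrightarrow> Cinf U g \<Longrightarrow> Cinf U (\<lambda>x. f x + g x)"
  by (simp add: Cinf_def ck_on_add)

lemma Cinf_scaleR:
  fixes f :: "'a::euclidean_space \<Rightarrow> real"
  shows "Cinf U f \<Longrightarrow> Cinf U g \<Longrightarrow> Cinf U (\<lambda>x. f x *\<^sub>R g x)"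
  by (simp add: Cinf_def ck_on_scaleR)

lemma Cinf_mult:
  fixes f :: "'a::euclidean_space \<Rightarrow> real"
  shows "Cinf U f \<Longrightarrow> Cinf U g \<Longrightarrow> Cinf U (\<lambda>x. f x * g x)"
  using Cinf_scaleR[of U f g] by simp

lemma Cinf_bounded_linear:
  "bounded_linear L \<Longrightarrow> Cinf U f \<Longrightarrow> Cinf U (\<lambda>x. L (f x))"
  by (simp add: Cinf_def ck_on_bounded_linear_compose)

lemma Cinf_minus: "Cinf U f \<Longrightarrow> Cinf U (\<lambda>x. - f x)"
  by (rule Cinf_bounded_linear[where L=uminus]) (auto intro: bounded_linear_minus)

lemma Cinf_diff: "Cinf U f \<Longrightarrow> Cinf U g \<Longrightarrow> Cinf U (\<lambda>x. f x - g x)"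
  using Cinf_add[OF _ Cinf_minus, of U f g] by simp

lemma Cinf_power:
  fixes f :: "'a::euclidean_space \<Rightarrow> real"
  shows "Cinf U f \<Longrightarrow> Cinf U (\<lambda>x. f x ^ n)"
  by (induction n) (auto intro: Cinf_mult Cinf_const dest: Cinf_open)

lemma Cinf_sum:
  assumes "open U" "\<And>i. i \<in> A \<Longrightarrow> Cinf U (f i)"
  shows "Cinf U (\<lambda>x. \<Sum>i\<in>A. f i x)"
  using assms by (simp add: Cinf_def ck_on_sum)

lemma Cinf_compose:
  "Cinf V g \<Longrightarrow> Cinf U f \<Longrightarrow> f ` U \<subseteq> V \<Longrightarrow> Cinf U (\<lambda>x. g (f x))"
  unfolding Cinf_def using ck_on_compose by blast

lemma Cinf_Pair:
  assumes "Cinf U f" "Cinf U g"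
  shows "Cinf U (\<lambda>x. (f x, g x))"
proof (rule Cinf_cong)
  show "Cinf U (\<lambda>x. (f x, 0) + (0, g x))"
    by (intro Cinf_add Cinf_bounded_linear[where L="\<lambda>x. (x, 0)"] Cinf_bounded_linear[where L="\<lambda>x. (0, x)"]
        bounded_linear_Pair bounded_linear_ident bounded_linear_zero assms)
qed simp

lemma Cinf_has_derivative:
  "Cinf U f \<Longrightarrow> x \<in> U \<Longrightarrow> (f has_derivative frechet_derivative f (at x)) (at x)"
  unfolding Cinf_def using ck_on_has_derivative by blast

lemma Cinf_frechet: "Cinf U f \<Longrightarrow> Cinf U (\<lambda>x. frechet_derivative f (at x) v)"
  unfolding Cinf_def using ck_on_frechet by blast

lemma Cinf_continuous_on: "Cinf U f \<Longrightarrow> continuous_on U f"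
  unfolding Cinf_def using ck_on_imp_continuous_on by blast

lemma Cinf_isCont: "Cinf U f \<Longrightarrow> x \<in> U \<Longrightarrow> isCont f x"
  using Cinf_continuous_on Cinf_open continuous_on_eq_continuous_at by blast

lemma Cinf_imp_smooth_on: "Cinf U f \<Longrightarrow> S \<subseteq> U \<Longrightarrow> smooth_on S f"
  unfolding Cinf_def smooth_on_def by blast

lemma smooth_on_iff_Cinf:
  "smooth_on S f \<longleftrightarrow> (\<forall>x\<in>S. \<exists>U F. x \<in> U \<and> Cinf U F \<and> (\<forall>y\<in>U \<inter> S. F y = f y))"
  unfolding Cinf_def smooth_on_def by blast

text \<open>Near a point of an open subset of \<open>S\<close> the local extension coincides with
  \<open>f\<close> itself, so it certifies the differentiability of \<open>f\<close>.\<close>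

lemma smooth_on_open_imp_Cinf:
  assumes "smooth_on S f" "open U" "U \<subseteq> S"
  shows "Cinf U f"
proof (rule Cinf_local[OF _ assms(2)])
  fix x assume "x \<in> U"
  then obtain V F where V: "x \<in> V" "Cinf V F" "\<forall>y\<in>V \<inter> S. F y = f y"
    using assms(1,3) unfolding smooth_on_iff_Cinf by blast
  have "Cinf (V \<inter> U) f"
    by (rule Cinf_cong[OF Cinf_subset[OF V(2)]]) (use V(3) assms(2,3) Cinf_open[OF V(2)] in auto)
  then show "\<exists>V. x \<in> V \<and> Cinf V f" using V \<open>x \<in> U\<close> by blast
qed

lemma Cinf_inverse:
  fixes f :: "'a::euclidean_space \<Rightarrow> real"
  assumes "Cinf U f" "\<And>x. x \<in> U \<Longrightarrow> f x \<noteq> 0"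
  shows "Cinf U (\<lambda>x. inverse (f x))"
proof -
  have "ck_on k U (\<lambda>x. inverse (f x))" for k
  proof (induction k)
    case 0
    show ?case using continuous_on_inverse[OF Cinf_continuous_on[OF assms(1)]] assms(2) by simp
  next
    case (Suc k)
    show ?case
    proof (rule ck_on_SucI[OF Cinf_open[OF assms(1)]
          Deriv.has_derivative_inverse[OF assms(2) Cinf_has_derivative[OF assms(1)]]])
      fix v
      have D: "ck_on k U (\<lambda>x. frechet_derivative f (at x) v)"
        using Cinf_frechet[OF assms(1)] by (simp add: Cinf_def)
      show "ck_on k U (\<lambda>x. - (inverse (f x) * frechet_derivative f (at x) v * inverse (f x)))"
        by (intro ck_on_bounded_linear_compose[where L=uminus] bounded_linear_minus bounded_linear_ident
            ck_on_scaleR[where 'b=real, simplified] Suc D Cinf_open[OF assms(1)])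
    qed
  qed
  then show ?thesis using assms(1) by (simp add: Cinf_def)
qed

lemma Cinf_divide:
  fixes f :: "'a::euclidean_space \<Rightarrow> real"
  assumes "Cinf U f" "Cinf U g" "\<And>x. x \<in> U \<Longrightarrow> g x \<noteq> 0"
  shows "Cinf U (\<lambda>x. f x / g x)"
  unfolding divide_inverse by (intro Cinf_mult Cinf_inverse assms)

section \<open>Taylor series and flat functions on the line\<close>

unbundle no vec_syntax
unbundle fps_syntax

lemma Cinf_real_has_derivative:
  fixes f :: "real \<Rightarrow> real"
  assumes "Cinf U f" "x \<in> U"
  shows "(f has_real_derivative deriv f x) (at x)"
    and "frechet_derivative f (at x) 1 = deriv f x"
proof -
  let ?D = "frechet_derivative f (at x)"
  have D: "(f has_derivative ?D) (at x)" by (rule Cinf_has_derivative[OF assms])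
  have "linear ?D" using D has_derivative_linear by blast
  then have "?D v = ?D 1 * v" for v
    using linear_cmul[of ?D v 1] by (simp add: mult.commute)
  then have "?D = (*) (?D 1)" by blast
  then have "(f has_real_derivative ?D 1) (at x)"
    using D unfolding has_field_derivative_def by (simp only:)
  then show "(f has_real_derivative deriv f x) (at x)" "?D 1 = deriv f x"
    using DERIV_imp_deriv by metis+
qed

lemma Cinf_deriv:
  fixes f :: "real \<Rightarrow> real"
  assumes "Cinf U f"
  shows "Cinf U (deriv f)"
  by (rule Cinf_cong[OF Cinf_frechet[OF assms, of 1] Cinf_real_has_derivative(2)[OF assms]])

text \<open>Smoothness follows from a property closed under differentiation. Each use names a family
  of functions (parameter integrals, flat functions of roots, trigonometric polynomials, series) and
  one derivative formula, in place of formulas for all iterated derivatives.\<close>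

lemma Cinf_coinduct:
  fixes f :: "real \<Rightarrow> real"
  assumes "open U" "P f"
    and step: "\<And>f. P f \<Longrightarrow> \<exists>f'. P f' \<and> (\<forall>x\<in>U. (f has_real_derivative f' x) (at x))"
  shows "Cinf U f"
proof -
  have "ck_on k U f" for k
    using assms(2)
  proof (induction k arbitrary: f)
    case 0
    then obtain f' where "\<forall>x\<in>U. (f has_real_derivative f' x) (at x)" using step by blast
    then have "\<forall>x\<in>U. isCont f x" using DERIV_isCont by blast
    then show ?case by (simp add: continuous_at_imp_continuous_on)
  next
    case (Suc k)
    then obtain f' where f': "P f'" "\<And>x. x \<in> U \<Longrightarrow> (f has_real_derivative f' x) (at x)"
      using step by blast
    show ?case
    proof (rule ck_on_SucI[OF \<open>open U\<close>])
      show "(f has_derivative (\<lambda>v. f' x *\<^sub>R v)) (at x)" if "x \<in> U" for x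
        using f'(2)[OF that] by (simp add: has_field_derivative_def)
      show "ck_on k U (\<lambda>x. f' x *\<^sub>R v)" for v
        by (rule ck_on_scaleR[OF \<open>open U\<close> Suc.IH[OF f'(1)] ck_on_const[OF \<open>open U\<close>]])
    qed
  qed
  then show ?thesis using \<open>open U\<close> by (simp add: Cinf_def)
qed

section \<open>Taylor series as formal power series\<close>

definition taylor :: "real \<Rightarrow> (real \<Rightarrow> real) \<Rightarrow> real fps"
  where "taylor a f = Abs_fps (\<lambda>n. (deriv ^^ n) f a / fact n)"

lemma taylor_nth_0 [simp]: "taylor a f $ 0 = f a"
  by (simp add: taylor_def)

lemma fps_deriv_taylor: "fps_deriv (taylor a f) = taylor a (deriv f)"
  by (rule fps_ext) (simp add: taylor_def funpow_swap1 field_simps del: of_nat_Suc)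

lemma taylor_nth_Suc: "taylor a f $ Suc n = taylor a (deriv f) $ n / of_nat (Suc n)"
proof -
  have "of_nat (Suc n) * taylor a f $ Suc n = fps_deriv (taylor a f) $ n" by simp
  then show ?thesis by (simp add: fps_deriv_taylor field_simps)
qed

lemma taylor_cong:
  assumes "open U" "a \<in> U" "\<And>x. x \<in> U \<Longrightarrow> f x = g x"
  shows "taylor a f = taylor a g"
proof -
  have "\<forall>x\<in>U. (deriv ^^ n) f x = (deriv ^^ n) g x" for n
  proof (induction n)
    case (Suc n)
    show ?case
    proof
      fix x assume "x \<in> U"
      then have "\<forall>\<^sub>F y in nhds x. (deriv ^^ n) f y = (deriv ^^ n) g y"
        using Suc assms(1) eventually_nhds by blast
      then show "(deriv ^^ Suc n) f x = (deriv ^^ Suc n) g x"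
        by (simp add: deriv_cong_ev)
    qed
  qed (use assms in simp)
  then show ?thesis using assms(2) by (simp add: taylor_def)
qed

lemma fps_nth_Suc_eqI:
  fixes F G :: "real fps"
  assumes "fps_deriv F $ n = fps_deriv G $ n"
  shows "F $ Suc n = G $ Suc n"
  using assms by (simp del: of_nat_Suc)

lemma taylor_const [simp]: "taylor a (\<lambda>x. c) = fps_const c"
proof (rule fps_ext)
  have "(deriv ^^ n) (\<lambda>x. 0) = (\<lambda>x. 0 :: real)" for n
    by (induction n) auto
  then show "taylor a (\<lambda>x. c) $ n = fps_const c $ n" for n
    by (cases n) (auto simp: taylor_def funpow_Suc_right simp del: funpow.simps)
qed

lemma taylor_ident [simp]: "taylor a (\<lambda>x. x) = fps_const a + fps_X"
proof (rule fps_ext)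
  show "taylor a (\<lambda>x. x) $ n = (fps_const a + fps_X) $ n" for n
  proof (cases n)
    case (Suc m)
    have "deriv (\<lambda>x::real. x) = (\<lambda>x. 1)" by auto
    then show ?thesis using Suc by (simp add: taylor_nth_Suc del: of_nat_Suc) 
  qed simp
qed

lemma taylor_add:
  assumes "Cinf U f" "Cinf U g" "a \<in> U"
  shows "taylor a (\<lambda>x. f x + g x) = taylor a f + taylor a g"
proof -
  have "taylor a (\<lambda>x. f x + g x) $ n = (taylor a f + taylor a g) $ n" for n
    using assms(1,2)
  proof (induction n arbitrary: f g)
    case (Suc n)
    have "taylor a (deriv (\<lambda>x. f x + g x)) = taylor a (\<lambda>x. deriv f x + deriv g x)"
      by (rule taylor_cong[OF Cinf_open[OF assms(1)] assms(3)])
         (auto intro!: DERIV_imp_deriv DERIV_add Cinf_real_has_derivative Suc.prems)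
    then show ?case
      using Suc.IH[OF Suc.prems[THEN Cinf_deriv]] by (simp add: taylor_nth_Suc add_divide_distrib del: of_nat_Suc)
  qed simp
  then show ?thesis by (simp add: fps_ext)
qed

lemma taylor_mult:
  assumes "Cinf U f" "Cinf U g" "a \<in> U"
  shows "taylor a (\<lambda>x. f x * g x) = taylor a f * taylor a g"
proof -
  have "taylor a (\<lambda>x. f x * g x) $ n = (taylor a f * taylor a g) $ n" for n
    using assms(1,2)
  proof (induction n arbitrary: f g)
    case (Suc n)
    note D = Suc.prems[THEN Cinf_deriv]
    have "taylor a (deriv (\<lambda>x. f x * g x)) = taylor a (\<lambda>x. f x * deriv g x + deriv f x * g x)"
      by (rule taylor_cong[OF Cinf_open[OF assms(1)] assms(3)])
         (auto intro!: DERIV_imp_deriv DERIV_mult' Cinf_real_has_derivative Suc.prems)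
    also have "\<dots> = taylor a (\<lambda>x. f x * deriv g x) + taylor a (\<lambda>x. deriv f x * g x)"
      by (intro taylor_add[OF _ _ assms(3)] Cinf_mult Suc.prems D)
    finally have "fps_deriv (taylor a (\<lambda>x. f x * g x)) $ n = fps_deriv (taylor a f * taylor a g) $ n"
      using Suc.IH[OF Suc.prems(1) D(2)] Suc.IH[OF D(1) Suc.prems(2)]
      by (simp add: fps_deriv_taylor)
    then show ?case by (rule fps_nth_Suc_eqI)
  qed simp
  then show ?thesis by (simp add: fps_ext)
qed

lemma taylor_power:
  assumes "Cinf U f" "a \<in> U"
  shows "taylor a (\<lambda>x. f x ^ n) = taylor a f ^ n"
  by (induction n) (auto simp: taylor_mult[OF assms(1) Cinf_power[OF assms(1)] assms(2)])

lemma taylor_cmult: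
  assumes "Cinf U f" "a \<in> U"
  shows "taylor a (\<lambda>x. c * f x) = fps_const c * taylor a f"
  using taylor_mult[OF Cinf_const[OF Cinf_open[OF assms(1)]] assms] by simp

lemma taylor_minus:
  assumes "Cinf U f" "a \<in> U"
  shows "taylor a (\<lambda>x. - f x) = - taylor a f"
  using taylor_cmult[OF assms, of "-1"] by (simp add: fps_const_neg[symmetric] del: fps_const_neg)

lemma taylor_diff:
  assumes "Cinf U f" "Cinf U g" "a \<in> U"
  shows "taylor a (\<lambda>x. f x - g x) = taylor a f - taylor a g"
  using taylor_add[OF assms(1) Cinf_minus[OF assms(2)] assms(3)] taylor_minus[OF assms(2,3)] by simp

lemma taylor_sum:
  assumes "open U" "a \<in> U" "\<And>i. i \<in> A \<Longrightarrow> Cinf U (f i)"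
  shows "taylor a (\<lambda>x. \<Sum>i\<in>A. f i x) = (\<Sum>i\<in>A. taylor a (f i))"
proof (cases "finite A")
  case True
  then show ?thesis using assms(3)
  proof (induction A)
    case (insert i A)
    have "taylor a (\<lambda>x. f i x + (\<Sum>i\<in>A. f i x)) = taylor a (f i) + taylor a (\<lambda>x. \<Sum>i\<in>A. f i x)"
      by (rule taylor_add[OF _ _ assms(2)]) (auto intro!: Cinf_sum assms(1) insert.prems)
    then show ?case using insert by simp
  qed simp
qed simp

text \<open>The chain rule determines the coefficient of order \<open>m + 1\<close> by coefficients
  up to order \<open>m\<close> of the composite with \<open>deriv g\<close>; hence strong induction
  on the order with \<open>g\<close> arbitrary. The constant \<open>f a\<close> is subtracted
  because formal composition wants an inner series without constant term.\<close>

lemma taylor_compose: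
  assumes "Cinf V g" "Cinf U f" "f ` U \<subseteq> V" "a \<in> U"
  shows "taylor a (\<lambda>x. g (f x)) = taylor (f a) g oo (taylor a f - fps_const (f a))"
proof -
  let ?h = "taylor a f - fps_const (f a)"
  have h: "?h $ 0 = 0" "fps_deriv ?h = taylor a (deriv f)"
    by (simp_all add: fps_deriv_taylor)
  have "taylor a (\<lambda>x. g (f x)) $ n = (taylor (f a) g oo ?h) $ n" for n
    using assms(1)
  proof (induction n arbitrary: g rule: less_induct)
    case (less n)
    show ?case
    proof (cases n)
      case (Suc m)
      have "taylor a (deriv (\<lambda>x. g (f x))) = taylor a (\<lambda>x. deriv g (f x) * deriv f x)"
      proof (rule taylor_cong[OF Cinf_open[OF assms(2)] assms(4)])
        fix x assume "x \<in> U"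
        then have "f x \<in> V" using assms(3) by auto
        show "deriv (\<lambda>x. g (f x)) x = deriv g (f x) * deriv f x"
          by (intro DERIV_imp_deriv DERIV_chain2 Cinf_real_has_derivative[OF less.prems \<open>f x \<in> V\<close>]
               Cinf_real_has_derivative[OF assms(2) \<open>x \<in> U\<close>])
      qed
      also have "\<dots> = taylor a (\<lambda>x. deriv g (f x)) * taylor a (deriv f)"
        by (intro taylor_mult[OF _ _ assms(4)] Cinf_compose[OF _ assms(2,3)] Cinf_deriv less.prems assms(2))
      finally have "fps_deriv (taylor a (\<lambda>x. g (f x))) $ m
          = (taylor a (\<lambda>x. deriv g (f x)) * taylor a (deriv f)) $ m"
        by (simp add: fps_deriv_taylor)
      also have "\<dots> = ((taylor (f a) (deriv g) oo ?h) * taylor a (deriv f)) $ m"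
        unfolding fps_mult_nth
        by (intro sum.cong refl arg_cong2[where f="(*)"] less.IH[OF _ Cinf_deriv[OF less.prems]])
           (auto simp: Suc)
      also have "\<dots> = fps_deriv (taylor (f a) g oo ?h) $ m"
        by (simp only: fps_compose_deriv[OF h(1)] h(2) fps_deriv_taylor)
      finally show ?thesis unfolding Suc by (rule fps_nth_Suc_eqI)
    qed simp
  qed
  then show ?thesis by (rule fps_ext)
qed

section \<open>Division by the variable and roots of flat functions\<close>

lemma Cinf_integral_unit:
  fixes h :: "real \<Rightarrow> real"
  assumes "Cinf {-d<..<d} h"
  shows "Cinf {-d<..<d} (\<lambda>t. integral {0..1} (\<lambda>s. s ^ n * h (s * t)))"
proof (rule Cinf_coinduct[where P="\<lambda>f. \<exists>n h. Cinf {-d<..<d} h \<and> f = (\<lambda>t. integral {0..1} (\<lambda>s. s ^ n * h (s * t)))"])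
  show "\<exists>m g. Cinf {-d<..<d} g \<and> (\<lambda>t. integral {0..1} (\<lambda>s. s ^ n * h (s * t))) =
      (\<lambda>t. integral {0..1} (\<lambda>s. s ^ m * g (s * t)))"
    using assms by blast
next
  fix f :: "real \<Rightarrow> real"
  assume "\<exists>n h. Cinf {-d<..<d} h \<and> f = (\<lambda>t. integral {0..1} (\<lambda>s. s ^ n * h (s * t)))"
  then obtain n h where h: "Cinf {-d<..<d} h" and f: "f = (\<lambda>t. integral {0..1} (\<lambda>s. s ^ n * h (s * t)))"
    by blast
  have st: "s * t \<in> {-d<..<d}" if "t \<in> {-d<..<d}" "s \<in> {0..1}" for s t
  proof -
    have "\<bar>s * t\<bar> \<le> \<bar>t\<bar>" using that by (simp add: abs_mult mult_left_le_one_le)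
    then show ?thesis using that by auto
  qed
  show "\<exists>f'. (\<exists>n h. Cinf {-d<..<d} h \<and> f' = (\<lambda>t. integral {0..1} (\<lambda>s. s ^ n * h (s * t)))) \<and>
      (\<forall>x\<in>{-d<..<d}. (f has_real_derivative f' x) (at x))"
  proof (intro exI conjI ballI)
    show "Cinf {-d<..<d} (deriv h)" using h by (rule Cinf_deriv)
    show "(\<lambda>t. integral {0..1} (\<lambda>s. s ^ (Suc n) * deriv h (s * t))) = (\<lambda>t. integral {0..1} (\<lambda>s. s ^ (Suc n) * deriv h (s * t)))" ..
    fix t assume t: "t \<in> {-d<..<d}"
    \<comment> \<open>Differentiation under the integral brings down a factor \<open>s\<close>, so
      the family must contain all weights \<open>s ^ n\<close> to be closed.\<close>
    have "(f has_real_derivative integral (cbox 0 1) (\<lambda>s. s ^ Suc n * deriv h (s * t))) (at t within {-d<..<d})"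
      unfolding f interval_cbox
    proof (rule leibniz_rule_field_derivative)
      fix x s :: real assume x: "x \<in> {-d<..<d}" "s \<in> cbox 0 1"
      have "(h has_real_derivative deriv h (s * x)) (at (s * x))"
        by (rule Cinf_real_has_derivative[OF h st[OF x(1)]]) (use x in auto)
      then have "((\<lambda>x. h (s * x)) has_real_derivative deriv h (s * x) * s) (at x)"
        by (rule DERIV_chain2) (auto intro!: derivative_eq_intros)
      then have "((\<lambda>x. s ^ n * h (s * x)) has_real_derivative s ^ n * (deriv h (s * x) * s)) (at x)"
        by (rule DERIV_cmult)
      then show "((\<lambda>x. s ^ n * h (s * x)) has_real_derivative s ^ Suc n * deriv h (s * x)) (at x within {-d<..<d})"
        by (simp add: has_field_derivative_at_within ac_simps)
    next
      fix x assume x: "x \<in> {-d<..<d}"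
      show "(\<lambda>s. s ^ n * h (s * x)) integrable_on cbox 0 1"
        by (intro integrable_continuous continuous_intros continuous_on_compose2[OF Cinf_continuous_on[OF h]])
           (use st[OF x] in auto)
    next
      show "continuous_on ({-d<..<d} \<times> cbox 0 1) (\<lambda>(x, s). s ^ Suc n * deriv h (s * x))"
        unfolding case_prod_beta
        by (intro continuous_intros continuous_on_compose2[OF Cinf_continuous_on[OF Cinf_deriv[OF h]]])
           (use st in auto)
    qed (use t in auto)
    then show "(f has_real_derivative integral {0..1} (\<lambda>s. s ^ Suc n * deriv h (s * t))) (at t)"
      using t by (simp add: at_within_open[of t "{-d<..<d}"])
  qed
qed simp

text \<open>Integrating \<open>d/ds f (s t) = t f' (s t)\<close> over the unit interval exhibits the
  quotient as an integral that depends smoothly on \<open>t\<close>, also at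
  \<open>t = 0\<close>.\<close>

lemma hadamard_quotient:
  fixes f :: "real \<Rightarrow> real"
  assumes "Cinf {-d<..<d} f" "f 0 = 0"
  obtains g where "Cinf {-d<..<d} g" "\<And>t. t \<in> {-d<..<d} \<Longrightarrow> f t = t * g t"
proof
  show "Cinf {-d<..<d} (\<lambda>t. integral {0..1} (\<lambda>s. s ^ 0 * deriv f (s * t)))"
    by (rule Cinf_integral_unit[OF Cinf_deriv[OF assms(1)]])
  fix t assume t: "t \<in> {-d<..<d}"
  have st: "s * t \<in> {-d<..<d}" if "s \<in> {0..1}" for s
  proof -
    have "\<bar>s * t\<bar> \<le> \<bar>t\<bar>" using that by (simp add: abs_mult mult_left_le_one_le)
    then show ?thesis using t by auto
  qed
  have "((\<lambda>s. t * deriv f (s * t)) has_integral (f (1 * t) - f (0 * t))) {0..1}"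
  proof (rule fundamental_theorem_of_calculus)
    fix s :: real assume s: "s \<in> {0..1}"
    have "((\<lambda>s. f (s * t)) has_real_derivative deriv f (s * t) * t) (at s)"
      by (rule DERIV_chain2[where f=f and g="\<lambda>s. s * t" and x=s, OF Cinf_real_has_derivative(1)[OF assms(1) st[OF s]]])
         (auto intro!: derivative_eq_intros)
    then show "((\<lambda>s. f (s * t)) has_vector_derivative t * deriv f (s * t)) (at s within {0..1})"
      by (simp add: has_real_derivative_iff_has_vector_derivative mult.commute has_vector_derivative_at_within)
  qed simp
  then have "integral {0..1} (\<lambda>s. t * deriv f (s * t)) = f (1 * t) - f (0 * t)"
    by (rule integral_unique)
  then show "f t = t * integral {0..1} (\<lambda>s. s ^ 0 * deriv f (s * t))"
    using assms(2) by simp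
qed

text \<open>Hadamard division is iterated. Flatness survives each division because
  \<open>taylor 0 q = fps_X * taylor 0 g\<close> and multiplication by \<open>fps_X\<close> is
  injective.\<close>

lemma flat_quotient:
  assumes "Cinf {-d<..<d} r" "d > 0" "taylor 0 r = 0"
  obtains q where "Cinf {-d<..<d} q" "taylor 0 q = 0" "\<And>t. t \<in> {-d<..<d} \<Longrightarrow> r t = t ^ k * q t"
proof -
  have "\<exists>q. Cinf {-d<..<d} q \<and> taylor 0 q = 0 \<and> (\<forall>t\<in>{-d<..<d}. r t = t ^ k * q t)"
  proof (induction k)
    case 0
    then show ?case using assms by auto
  next
    case (Suc k)
    then obtain q where q: "Cinf {-d<..<d} q" "taylor 0 q = 0" "\<forall>t\<in>{-d<..<d}. r t = t ^ k * q t"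
      by blast
    have "q 0 = 0" using q(2) by (metis fps_zero_nth taylor_nth_0)
    then obtain g where g: "Cinf {-d<..<d} g" "\<And>t. t \<in> {-d<..<d} \<Longrightarrow> q t = t * g t"
      using hadamard_quotient[OF q(1)] by blast
    have "taylor 0 q = taylor 0 (\<lambda>t. t * g t)"
      by (rule taylor_cong[of "{-d<..<d}"]) (use g assms in auto)
    also have "\<dots> = fps_X * taylor 0 g"
      using taylor_mult[OF Cinf_ident g(1)] assms(2) by simp
    finally have "taylor 0 g = 0" using q(2) by simp
    then show ?case using g q(3) by (intro exI[of _ g]) (auto simp: algebra_simps)
  qed
  then show ?thesis using that by blast
qed

text \<open>The composite is continued by zero to negative \<open>u\<close>. Writing
  \<open>r' t = t ^ (i - 1) q t\<close> with \<open>q\<close> flat, the singular factor in the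
  derivative of the root cancels, and the derivative is \<open>q / i\<close> composed with the same
  root. Composites of this form are thus closed under differentiation.\<close>

lemma Cinf_flat_root:
  assumes "Cinf {-d<..<d} r" "d > 0" "taylor 0 r = 0" "i > 0"
  shows "Cinf {..<d ^ i} (\<lambda>u. r (root i (max 0 u)))"
proof (rule Cinf_coinduct[where P="\<lambda>f. \<exists>r. Cinf {-d<..<d} r \<and> taylor 0 r = 0 \<and> f = (\<lambda>u. r (root i (max 0 u)))"])
  show "\<exists>s. Cinf {-d<..<d} s \<and> taylor 0 s = 0 \<and> (\<lambda>u. r (root i (max 0 u))) = (\<lambda>u. s (root i (max 0 u)))"
    using assms by blast
next
  fix f :: "real \<Rightarrow> real"
  assume "\<exists>r. Cinf {-d<..<d} r \<and> taylor 0 r = 0 \<and> f = (\<lambda>u. r (root i (max 0 u)))"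
  then obtain r where r: "Cinf {-d<..<d} r" "taylor 0 r = 0" and f: "f = (\<lambda>u. r (root i (max 0 u)))"
    by blast
  obtain k where i: "i = Suc k" using assms(4) by (cases i) auto
  have "taylor 0 (deriv r) = 0" using r(2) fps_deriv_taylor[of 0 r] by simp
  then obtain q where q: "Cinf {-d<..<d} q" "taylor 0 q = 0"
    "\<And>t. t \<in> {-d<..<d} \<Longrightarrow> deriv r t = t ^ k * q t"
    using flat_quotient[OF Cinf_deriv[OF r(1)] assms(2)] by blast
  obtain w where w: "Cinf {-d<..<d} w" "taylor 0 w = 0" "\<And>t. t \<in> {-d<..<d} \<Longrightarrow> r t = t ^ i * w t"
    using flat_quotient[OF r(1) assms(2) r(2)] by blast
  have zero: "r 0 = 0" "q 0 = 0" "w 0 = 0"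
    using r(2) q(2) w(2) by (metis fps_zero_nth taylor_nth_0)+
  have dom: "root i (max 0 u) \<in> {-d<..<d}" if "u < d ^ i" for u
  proof -
    have "root i (max 0 u) < root i (d ^ i)"
      using that assms(2,4) by (intro real_root_less_mono) auto
    moreover have "root i (d ^ i) = d"
      using assms(2,4) by (simp add: real_root_power_cancel)
    moreover have "root i (max 0 u) \<ge> 0" using assms(4) by simp
    ultimately show ?thesis using assms(2) by auto
  qed
  let ?g = "\<lambda>t. (1 / of_nat i) * q t"
  have "(f has_real_derivative ?g (root i (max 0 u))) (at u)" if u: "u \<in> {..<d ^ i}" for u
  proof -
    consider "u < 0" | "u = 0" | "u > 0" by linarith
    then show ?thesis
    proof cases
      case 1
      have "((\<lambda>u. 0) has_real_derivative 0) (at u)" by simp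
      then have "(f has_real_derivative 0) (at u)"
        by (rule has_field_derivative_transform_within_open[of _ _ _ "{..<0}"])
           (use 1 zero assms(4) in \<open>auto simp: f max_def\<close>)
      then show ?thesis using 1 zero by (simp add: max_def)
    next
      case 2
      have cw: "isCont w (root i (max 0 0))"
        by (rule Cinf_isCont[OF w(1)]) (use assms(2) in auto)
      have "isCont (\<lambda>u. root i (max 0 u)) 0"
        by (intro isCont_real_root continuous_max continuous_const continuous_ident continuous_real_root)
      then have c: "isCont (\<lambda>u. w (root i (max 0 u))) 0"
        using cw by (rule isCont_o2)
      \<comment> \<open>At the origin \<open>r t = t ^ i * w t\<close> turns the composite into
        \<open>u\<close> times a continuous function that vanishes at \<open>0\<close>, and
        Caratheodory's form of the derivative gives \<open>0\<close>.\<close>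
      have "((\<lambda>u. u * w (root i (max 0 u))) has_real_derivative 0) (at 0)"
        unfolding CARAT_DERIV using c zero
        by (intro exI[of _ "\<lambda>u. w (root i (max 0 u))"]) (auto simp: max_def)
      then have "(f has_real_derivative 0) (at 0)"
      proof (rule has_field_derivative_transform_within_open[of _ _ _ "{..<d ^ i}"])
        fix v assume "v \<in> {..<d ^ i}"
        then have "r (root i (max 0 v)) = root i (max 0 v) ^ i * w (root i (max 0 v))"
          using w(3) dom by auto
        also have "root i (max 0 v) ^ i = max 0 v" using assms(4) by simp
        finally show "v * w (root i (max 0 v)) = f v"
          using zero by (auto simp: f max_def)
      qed (use assms in auto)
      then show ?thesis using 2 zero by simp
    next
      case 3
      have t: "root i u \<in> {-d<..<d}" "root i u > 0" using dom[of u] u 3 assms(4) by auto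
      have D: "(root i has_real_derivative inverse (of_nat i * root i u ^ (i - Suc 0))) (at u)"
        by (rule DERIV_real_root[OF assms(4) 3])
      have "((\<lambda>u. r (root i u)) has_real_derivative
          deriv r (root i u) * inverse (of_nat i * root i u ^ (i - Suc 0))) (at u)"
        by (rule DERIV_chain2[where f=r and g="root i", OF Cinf_real_has_derivative(1)[OF r(1) t(1)] D])
      also have "deriv r (root i u) * inverse (of_nat i * root i u ^ (i - Suc 0)) = ?g (root i u)"
        using q(3)[OF t(1)] t(2) by (simp add: i divide_inverse del: of_nat_Suc)
      finally have "(f has_real_derivative ?g (root i u)) (at u)"
        by (rule has_field_derivative_transform_within_open[of _ _ _ "{0<..}"])
           (use 3 in \<open>auto simp: f max_def\<close>)
      then show ?thesis using 3 by (simp add: max_def)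
    qed
  qed
  moreover have "Cinf {-d<..<d} ?g" by (intro Cinf_mult Cinf_const q) simp
  moreover have "taylor 0 ?g = 0" using taylor_cmult[OF q(1), of 0 "1 / of_nat i"] assms(2) q(2) by simp
  ultimately show "\<exists>f'. (\<exists>r. Cinf {-d<..<d} r \<and> taylor 0 r = 0 \<and> f' = (\<lambda>u. r (root i (max 0 u)))) \<and>
      (\<forall>x\<in>{..<d ^ i}. (f has_real_derivative f' x) (at x))"
    by (intro exI[of _ "\<lambda>u. ?g (root i (max 0 u))"]) blast
qed simp

section \<open>Borel's lemma and functions of two monomials\<close>

text \<open>Powers of \<open>sin\<close> take the place of cut-off monomials in Borel's
  construction: \<open>sin x ^ n\<close> starts with \<open>x ^ n\<close>, and its derivatives are
  again trigonometric polynomials, hence bounded on the whole line.\<close>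

inductive trig_poly :: "(real \<Rightarrow> real) \<Rightarrow> bool" where
  const: "trig_poly (\<lambda>x. c)"
| sin: "trig_poly sin"
| cos: "trig_poly cos"
| add: "trig_poly f \<Longrightarrow> trig_poly g \<Longrightarrow> trig_poly (\<lambda>x. f x + g x)"
| mult: "trig_poly f \<Longrightarrow> trig_poly g \<Longrightarrow> trig_poly (\<lambda>x. f x * g x)"

lemma trig_poly_bounded: "trig_poly f \<Longrightarrow> \<exists>M. \<forall>x. \<bar>f x\<bar> \<le> M"
proof (induction rule: trig_poly.induct)
  case (add f g)
  then obtain M N where MN: "\<forall>x. \<bar>f x\<bar> \<le> M" "\<forall>x. \<bar>g x\<bar> \<le> N" by blast
  have "\<bar>f x + g x\<bar> \<le> M + N" for x
    using MN abs_triangle_ineq[of "f x" "g x"] by (smt (verit))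
  then show ?case by blast
next
  case (mult f g)
  then obtain M N where MN: "\<forall>x. \<bar>f x\<bar> \<le> M" "\<forall>x. \<bar>g x\<bar> \<le> N" by blast
  have "\<bar>f x * g x\<bar> \<le> M * N" for x
    unfolding abs_mult using MN by (intro mult_mono) (auto intro: order_trans[OF abs_ge_zero])
  then show ?case by blast
qed (auto intro: abs_sin_le_one abs_cos_le_one)

lemma trig_poly_has_derivative:
  "trig_poly f \<Longrightarrow> \<exists>f'. trig_poly f' \<and> (\<forall>x. (f has_real_derivative f' x) (at x))"
proof (induction rule: trig_poly.induct)
  case (const c)
  show ?case by (rule exI[of _ "\<lambda>x. 0"]) (auto intro: trig_poly.intros)
next
  case sin
  show ?case by (rule exI[of _ cos]) (auto intro: trig_poly.intros DERIV_sin)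
next
  case cos
  have "trig_poly (\<lambda>x. (-1) * sin x)" by (intro trig_poly.intros)
  then show ?case using DERIV_cos by (intro exI[of _ "\<lambda>x. (-1) * sin x"]) simp
next
  case (add f g)
  then obtain f' g' where "trig_poly f'" "trig_poly g'"
    "\<And>x. (f has_real_derivative f' x) (at x)" "\<And>x. (g has_real_derivative g' x) (at x)" by blast
  then show ?case
    by (intro exI[of _ "\<lambda>x. f' x + g' x"]) (auto intro: trig_poly.intros DERIV_add)
next
  case (mult f g)
  then obtain f' g' where "trig_poly f'" "trig_poly g'"
    "\<And>x. (f has_real_derivative f' x) (at x)" "\<And>x. (g has_real_derivative g' x) (at x)" by blast
  with mult show ?case
    by (intro exI[of _ "\<lambda>x. f x * g' x + f' x * g x"]) (auto intro: trig_poly.intros DERIV_mult')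
qed

lemma trig_poly_Cinf: "trig_poly f \<Longrightarrow> Cinf UNIV f"
  by (rule Cinf_coinduct[where P=trig_poly]) (use trig_poly_has_derivative in auto)

lemma trig_poly_deriv: "trig_poly f \<Longrightarrow> trig_poly (deriv f)"
proof -
  assume "trig_poly f"
  then obtain f' where f': "trig_poly f'" "\<And>x. (f has_real_derivative f' x) (at x)"
    using trig_poly_has_derivative by blast
  have "deriv f = f'" using DERIV_imp_deriv[OF f'(2)] by blast
  then show ?thesis using f'(1) by simp
qed

lemma trig_poly_iterated_deriv: "trig_poly f \<Longrightarrow> trig_poly ((deriv ^^ k) f)"
  by (induction k) (auto intro: trig_poly_deriv)

lemma trig_poly_power: "trig_poly f \<Longrightarrow> trig_poly (\<lambda>x. f x ^ n)"
  by (induction n) (auto intro: trig_poly.intros)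

lemma taylor_sin_power:
  "k < n \<Longrightarrow> taylor 0 (\<lambda>x. sin x ^ n) $ k = 0" "taylor 0 (\<lambda>x. sin x ^ n) $ n = 1"
proof -
  have "taylor 0 sin $ 0 = 0" "taylor 0 sin $ 1 = 1"
    using DERIV_imp_deriv[OF DERIV_sin[of 0]] by (simp_all add: taylor_nth_Suc)
  moreover have "fps_X * Abs_fps (\<lambda>k. taylor 0 sin $ Suc k) = taylor 0 sin"
    by (rule fps_ext) (auto simp: calculation(1))
  ultimately obtain G where G: "taylor 0 sin = fps_X * G" "G $ 0 = 1"
    by (metis One_nat_def fps_nth_Abs_fps)
  have "taylor 0 (\<lambda>x. sin x ^ n) = fps_X ^ n * G ^ n"
    using taylor_power[OF trig_poly_Cinf[OF trig_poly.sin], of 0 n] by (simp add: G power_mult_distrib)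
  then show "k < n \<Longrightarrow> taylor 0 (\<lambda>x. sin x ^ n) $ k = 0" "taylor 0 (\<lambda>x. sin x ^ n) $ n = 1"
    by (auto simp: fps_X_power_mult_nth fps_power_zeroth G)
qed

text \<open>The scale of the \<open>n\<close>-th summand is chosen so large that its derivatives of order less than
  \<open>n\<close> are at most \<open>1 / 2 ^ n\<close>; the coefficients \<open>b n\<close> solve the triangular system that prescribes
  the Taylor coefficients of the sum.\<close>

theorem borel_lemma:
  fixes A :: "real fps"
  obtains F where "Cinf UNIV F" "taylor 0 F = A"
proof -
  define \<psi> where "\<psi> n k = (deriv ^^ k) (\<lambda>x::real. sin x ^ n)" for n k
  have tp: "trig_poly (\<psi> n k)" for n k
    unfolding \<psi>_def by (intro trig_poly_iterated_deriv trig_poly_power trig_poly.sin)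
  have D\<psi>: "(\<psi> n k has_real_derivative \<psi> n (Suc k) x) (at x)" for n k x
    using Cinf_real_has_derivative(1)[OF trig_poly_Cinf[OF tp], of x n k] by (simp add: \<psi>_def)
  obtain B where B: "\<And>n k x. \<bar>\<psi> n k x\<bar> \<le> B n k"
    using trig_poly_bounded[OF tp] by metis
  have B0: "B n k \<ge> 0" for n k
    using B[of n k 0] by linarith
  define M where "M n = (\<Sum>k<n. B n k)" for n
  have M: "\<bar>\<psi> n k x\<bar> \<le> M n" if "k < n" for n k x
  proof -
    have "B n k \<le> M n" unfolding M_def using that B0 by (intro member_le_sum) auto
    then show ?thesis using B[of n k x] by linarith
  qed
  have M0: "M n \<ge> 0" for n
    unfolding M_def using B0 by (simp add: sum_nonneg)
  define L where "L n b = 1 + 2 ^ n * \<bar>b\<bar> * M n" for n and b :: real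
  have L1: "L n b \<ge> 1" for n b
    using M0 by (simp add: L_def)
  define \<tau> where "\<tau> n k = taylor 0 (\<lambda>x. sin x ^ n) $ k" for n k
  have \<tau>_less: "\<tau> n k = 0" if "k < n" for n k using taylor_sin_power(1)[OF that] by (simp add: \<tau>_def)
  have \<tau>_eq: "\<tau> n n = 1" for n by (simp add: \<tau>_def taylor_sin_power)
  \<comment> \<open>The summand of index \<open>k\<close> will be
    \<open>b k * sin (l k * x) ^ k / l k ^ k\<close>. Unlike a monomial it may also contribute to
    coefficients of order \<open>n > k\<close>; \<open>H\<close> subtracts these contributions, in
    which the scale depends on \<open>b k\<close> itself.\<close>
  define H where "H b n = A $ n - (\<Sum>k<n. b k * L k (b k) ^ n / L k (b k) ^ k * \<tau> k n)" for b n
  have H: "H b n = H c n" if "\<And>k. k < n \<Longrightarrow> b k = c k" for b c n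
    unfolding H_def using that by (intro arg_cong2[where f="(-)"] sum.cong refl) simp
  have "\<exists>b. \<forall>n::nat. b n = H b n"
  proof (rule dependent_wellorder_choice[where P="\<lambda>b n r. r = H b n"])
    show "(r = H b n) = (r = H c n)" if "\<And>k. k < n \<Longrightarrow> b k = c k" for r b c n
      using H[OF that] by simp
  qed blast
  then obtain b where b: "\<And>n. b n = H b n"
    by blast
  define l where "l n = L n (b n)" for n
  have l1: "l n \<ge> 1" for n using L1 by (simp add: l_def)
  \<comment> \<open>\<open>u k n\<close> is the \<open>k\<close>-th derivative of the summand of
    index \<open>n\<close>. For \<open>k < n\<close> the factor \<open>l n ^ k / l n ^ n\<close> is
    at most \<open>1 / l n\<close>, which is what absorbs \<open>b n\<close> and the bound
    \<open>M n\<close>.\<close>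
  define u where "u k n x = b n * l n ^ k / l n ^ n * \<psi> n k (l n * x)" for k n x
  have Du: "(u k n has_real_derivative u (Suc k) n x) (at x)" for k n x
  proof -
    have "((\<lambda>x. \<psi> n k (l n * x)) has_real_derivative \<psi> n (Suc k) (l n * x) * l n) (at x)"
      by (rule DERIV_chain2[where f="\<psi> n k" and g="\<lambda>x. l n * x" and x=x, OF D\<psi>])
         (auto intro!: derivative_eq_intros)
    from DERIV_cmult[OF this, of "b n * l n ^ k / l n ^ n"] show ?thesis
      unfolding u_def[abs_def] by (simp add: ac_simps)
  qed
  have bound: "\<bar>u k n x\<bar> \<le> (1 / 2) ^ n" if "k < n" for k n x
  proof -
    have pos: "l n > 0" using l1[of n] by linarith
    have "l n ^ k * l n \<le> l n ^ n"
      using that l1[of n] power_increasing[of "Suc k" n "l n"] by (simp add: mult.commute)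
    then have q: "l n ^ k / l n ^ n \<le> 1 / l n"
      using pos by (simp add: field_simps)
    have "\<bar>u k n x\<bar> = \<bar>b n\<bar> * (l n ^ k / l n ^ n) * \<bar>\<psi> n k (l n * x)\<bar>"
      using pos by (simp add: u_def abs_mult)
    also have "\<dots> \<le> \<bar>b n\<bar> * (1 / l n) * M n"
      using q M[OF that] M0 pos by (intro mult_mono mult_nonneg_nonneg) auto
    also have "\<dots> \<le> (1 / 2) ^ n"
    proof -
      have "2 ^ n * \<bar>b n\<bar> * M n \<le> l n" by (simp add: l_def L_def)
      then show ?thesis using pos by (simp add: field_simps power_divide)
    qed
    finally show ?thesis .
  qed
  have half: "summable (\<lambda>n. (1 / 2 :: real) ^ n)" by (simp add: summable_geometric)
  have unif: "uniformly_convergent_on UNIV (\<lambda>N x. \<Sum>n<N. u k n x)" for k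
    by (rule Weierstrass_m_test'_ev[OF _ half])
       (use bound in \<open>auto simp: eventually_at_top_linorder intro!: exI[of _ "Suc k"]\<close>)
  have summ: "summable (\<lambda>n. u k n 0)" for k
    by (rule summable_comparison_test_ev[OF _ half])
       (use bound in \<open>auto simp: eventually_at_top_linorder intro!: exI[of _ "Suc k"]\<close>)
  define F where "F k x = (\<Sum>n. u k n x)" for k x
  have DF: "(F k has_real_derivative F (Suc k) x) (at x)" for k x
    unfolding F_def[abs_def]
    by (rule has_field_derivative_series'(2)[of UNIV "u k" "u (Suc k)" 0 x])
       (use Du unif summ in auto)
  have "Cinf UNIV (F 0)"
    by (rule Cinf_coinduct[where P="\<lambda>f. \<exists>k. f = F k"]) (use DF in auto)
  moreover have "taylor 0 (F 0) = A"
  proof (rule fps_ext)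
    fix k
    have dF: "(deriv ^^ k) (F 0) = F k"
    proof (induction k)
      case (Suc k)
      then show ?case using DERIV_imp_deriv[OF DF] by auto
    qed simp
    have u0: "u k n 0 / fact k = b n * l n ^ k / l n ^ n * \<tau> n k" for n
      by (simp add: u_def \<tau>_def taylor_def \<psi>_def)
    have "taylor 0 (F 0) $ k = (\<Sum>n. u k n 0) / fact k"
      by (simp add: taylor_def dF F_def)
    also have "\<dots> = (\<Sum>n. b n * l n ^ k / l n ^ n * \<tau> n k)"
      by (simp add: suminf_divide[OF summ, symmetric] u0)
    also have "\<dots> = (\<Sum>n<Suc k. b n * l n ^ k / l n ^ n * \<tau> n k)"
      by (rule suminf_finite) (auto simp: \<tau>_less)
    also have "\<dots> = (\<Sum>n<k. b n * l n ^ k / l n ^ n * \<tau> n k) + b k"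
      using l1[of k] by (simp add: \<tau>_eq)
    also have "\<dots> = A $ k" using b[of k] by (simp add: l_def H_def)
    finally show "taylor 0 (F 0) $ k = A $ k" .
  qed
  ultimately show ?thesis using that by blast
qed

text \<open>For \<open>i = 2\<close> the even part is a function of \<open>t ^ 2\<close>, and the
  odd part divided by \<open>t ^ j\<close> is even because \<open>j\<close> is odd. For
  \<open>i = 3\<close> the map \<open>t ^ 3\<close> is a bijection of the line, so \<open>r\<close>
  itself is a function of \<open>t ^ 3\<close> and the summand \<open>b = 0\<close> suffices. In
  both cases flatness makes the composites with the roots smooth at the origin.\<close>

lemma flat_decompose:
  assumes r: "Cinf {-d<..<d} r" "d > 0" "taylor 0 r = 0" and ij: "i = 2 \<or> i = 3" "coprime i j"
  obtains \<rho> :: "nat \<Rightarrow> real \<Rightarrow> real" where "\<And>b. Cinf {-(d^i)<..<d^i} (\<rho> b)"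
    "\<And>t. t \<in> {-d<..<d} \<Longrightarrow> r t = (\<Sum>b<i. t ^ (j * b) * \<rho> b (t ^ i))"
proof -
  have r0: "r 0 = 0" using r(3) by (metis fps_zero_nth taylor_nth_0)
  have neg: "Cinf {-d<..<d} (\<lambda>t. r (- t))"
    by (rule Cinf_compose[OF r(1) Cinf_minus[OF Cinf_ident]]) auto
  have neg0: "taylor 0 (\<lambda>t. r (- t)) = 0"
    using taylor_compose[OF r(1) Cinf_minus[OF Cinf_ident, of "{-d<..<d}"], of 0] r(2,3) by auto
  have sub: "Cinf {-(d^i)<..<d^i} f" if "Cinf {..<d^i} f" for f :: "real \<Rightarrow> real"
    by (rule Cinf_subset[OF that]) auto
  have i0: "i > 0" using ij by auto
  show ?thesis
  proof (cases "i = 2")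
    case False
    then have i: "i = 3" using ij by simp
    \<comment> \<open>One root for each side of the origin; on the opposite side each term reduces
      to \<open>r 0 = 0\<close>.\<close>
    define \<rho> where "\<rho> b = (if b = (0::nat) then (\<lambda>u. r (root i (max 0 u)) + r (- root i (max 0 (- u)))) else (\<lambda>u. 0))" for b
    show ?thesis
    proof
      have "Cinf {-(d^i)<..<d^i} (\<lambda>u. r (- root i (max 0 (- u))))"
        by (rule Cinf_compose[OF sub[OF Cinf_flat_root[OF neg r(2) neg0 i0]] Cinf_minus[OF Cinf_ident]]) auto
      then show "Cinf {-(d^i)<..<d^i} (\<rho> b)" for b
        unfolding \<rho>_def using sub[OF Cinf_flat_root[OF r i0]] by (auto intro: Cinf_add Cinf_const)
      fix t assume "t \<in> {-d<..<d}"
      have "r (root 3 (max 0 (t ^ 3))) + r (- root 3 (max 0 (- (t ^ 3)))) = r t"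
      proof (cases "t \<ge> 0")
        case True
        then show ?thesis using r0 by (simp add: max_def real_root_power_cancel)
      next
        case False
        then have "t ^ 3 < 0" by (simp add: odd_power_less_zero)
        moreover have "root 3 (- (t ^ 3)) = - t"
          using real_root_power_cancel[of 3 "- t"] False by simp
        ultimately show ?thesis using r0 by (simp add: max_def)
      qed
      then show "r t = (\<Sum>b<i. t ^ (j * b) * \<rho> b (t ^ i))"
        by (simp add: i \<rho>_def eval_nat_numeral)
    qed
  next
    case i: True
    then have "odd j" using ij by simp
    define e where "e t = (1 / 2) * (r t + r (- t))" for t
    define p where "p t = (1 / 2) * (r t - r (- t))" for t
    have e: "Cinf {-d<..<d} e" and p: "Cinf {-d<..<d} p"
      unfolding e_def[abs_def] p_def[abs_def]
      by (intro Cinf_mult Cinf_const Cinf_add Cinf_diff r neg; simp)+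
    have e0: "taylor 0 e = 0" 
      using taylor_cmult[OF Cinf_add[OF r(1) neg], of 0 "1/2"] taylor_add[OF r(1) neg, of 0] r(2,3) neg0
      by (simp add: e_def[abs_def])
    have p0: "taylor 0 p = 0" 
      using taylor_cmult[OF Cinf_diff[OF r(1) neg], of 0 "1/2"] taylor_diff[OF r(1) neg, of 0] r(2,3) neg0
      by (simp add: p_def[abs_def])
    obtain w where w: "Cinf {-d<..<d} w" "taylor 0 w = 0" "\<And>t. t \<in> {-d<..<d} \<Longrightarrow> p t = t ^ j * w t"
      using flat_quotient[OF p r(2) p0] by blast
    define \<rho> where "\<rho> b = (if b = (0::nat) then (\<lambda>u. e (root i (max 0 u))) else (\<lambda>u. w (root i (max 0 u))))" for b
    show ?thesis
    proof
      show "Cinf {-(d^i)<..<d^i} (\<rho> b)" for b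
        unfolding \<rho>_def using sub[OF Cinf_flat_root[OF e r(2) e0 i0]] sub[OF Cinf_flat_root[OF w(1) r(2) w(2) i0]]
        by auto
      fix t assume t: "t \<in> {-d<..<d}"
      have root: "root i (max 0 (t ^ i)) = \<bar>t\<bar>"
        by (simp add: i max_def sqrt_def[symmetric])
      have "e \<bar>t\<bar> = e t" by (simp add: e_def abs_if)
      moreover have "t ^ j * w \<bar>t\<bar> = p t"
      proof (cases "t \<ge> 0")
        case False
        have "- t \<in> {-d<..<d}" using t by auto
        then have "p (- t) = - (t ^ j * w \<bar>t\<bar>)"
          using w(3)[of "- t"] \<open>odd j\<close> False by simp
        then show ?thesis by (simp add: p_def algebra_simps)
      qed (use w(3) t in simp)
      moreover have "r t = e t + p t" by (simp add: e_def p_def field_simps)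
      ultimately show "r t = (\<Sum>b<i. t ^ (j * b) * \<rho> b (t ^ i))"
        unfolding \<rho>_def using root by (simp add: i eval_nat_numeral)
    qed
  qed
qed

section \<open>Power series supported on a numerical semigroup\<close>

lemma fps_nth_compose_X_power:
  fixes f :: "real fps"
  assumes "d > 0"
  shows "(f oo fps_X ^ d) $ n = (if d dvd n then f $ (n div d) else 0)"
proof -
  have "(f oo fps_X ^ d) $ n = (\<Sum>i\<in>{0..n}. f $ i * (if n = d * i then 1 else 0))"
    by (simp add: fps_compose_nth power_mult[symmetric])
  also have "\<dots> = (if d dvd n then f $ (n div d) else 0)"
  proof (cases "d dvd n")
    case True
    then obtain k where n: "n = d * k" by blast
    have "(\<Sum>i\<in>{0..n}. f $ i * (if n = d * i then 1 else 0)) = (\<Sum>i\<in>{0..n}. if k = i then f $ i else 0)"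
      using assms by (intro sum.cong) (auto simp: n)
    then show ?thesis using assms by (simp add: n)
  qed (auto intro!: sum.neutral)
  finally show ?thesis .
qed

definition semigroup_supported :: "nat \<Rightarrow> nat \<Rightarrow> real fps \<Rightarrow> bool"
  where "semigroup_supported i j A \<longleftrightarrow> (\<forall>n. (\<nexists>a b. n = i * a + j * b) \<longrightarrow> A $ n = 0)"

text \<open>Since \<open>i\<close> and \<open>j\<close> are coprime, every element of the semigroup
  is \<open>i * a + j * b\<close> with exactly one \<open>b < i\<close>. Each admissible coefficient
  therefore occurs in exactly one of the \<open>i\<close> summands.\<close>

lemma semigroup_decompose:
  assumes A: "semigroup_supported i j A" and ij: "i > 0" "coprime i j"
  shows "(\<Sum>b<i. fps_X ^ (j * b) * (Abs_fps (\<lambda>a. A $ (i * a + j * b)) oo fps_X ^ i)) = A"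
proof (rule fps_ext)
  fix n
  let ?t = "\<lambda>b. (fps_X ^ (j * b) * (Abs_fps (\<lambda>a. A $ (i * a + j * b)) oo fps_X ^ i)) $ n"
  have t: "?t b = (if j * b \<le> n \<and> i dvd n - j * b then A $ n else 0)" for b
    by (auto simp: fps_X_power_mult_nth fps_nth_compose_X_power[OF ij(1)])
  show "(\<Sum>b<i. fps_X ^ (j * b) * (Abs_fps (\<lambda>a. A $ (i * a + j * b)) oo fps_X ^ i)) $ n = A $ n"
  proof (cases "\<exists>a b. n = i * a + j * b")
    case False
    then have "A $ n = 0" using A by (auto simp: semigroup_supported_def)
    then show ?thesis unfolding fps_sum_nth t by (auto intro!: sum.neutral)
  next
    case True
    then obtain a b where n: "n = i * a + j * b" by blast
    \<comment> \<open>Multiples of \<open>i\<close> inside \<open>b\<close> are moved to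
      \<open>a\<close>, using \<open>j * (i * q) = i * (j * q)\<close>.\<close>
    define c where "c = b mod i"
    have c: "c < i" using ij by (simp add: c_def)
    have "b = i * (b div i) + c" by (simp add: c_def)
    then have "n = i * (a + j * (b div i)) + j * c"
      unfolding n by (metis add.assoc distrib_left mult.left_commute)
    then obtain a' where n': "n = i * a' + j * c" by blast
    have uniq: "b' = c" if b': "b' < i" "j * b' \<le> n" "i dvd n - j * b'" for b'
    proof -
      obtain k where "n - j * b' = i * k" using b'(3) by (auto elim: dvdE)
      then have "n = i * k + j * b'" using b'(2) by simp
      then have "int (i * k + j * b') = int (i * a' + j * c)" using n' by simp
      then have "int j * (int b' - int c) = int i * (int a' - int k)"
        unfolding of_nat_add of_nat_mult right_diff_distrib by linarith
      then have "int i dvd int j * (int b' - int c)" by (metis dvd_triv_left)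
      moreover have "coprime (int i) (int j)" using ij(2) by simp
      ultimately have dvd: "int i dvd int b' - int c"
        using coprime_dvd_mult_right_iff by blast
      have "\<bar>int b' - int c\<bar> < int i" using b'(1) c by linarith
      then have "int b' - int c = 0" using dvd_imp_le_int[OF _ dvd] by linarith
      then show ?thesis by simp
    qed
    have "?t b' = (if b' = c then A $ n else 0)" if "b' < i" for b'
      unfolding t using uniq[OF that] n' by auto
    then have "(\<Sum>b'<i. ?t b') = (\<Sum>b'<i. if b' = c then A $ n else 0)"
      by (intro sum.cong) auto
    then show ?thesis unfolding fps_sum_nth using c by simp
  qed
qed

text \<open>The bound \<open>b < i\<close> makes the germ a polynomial in \<open>t ^ j\<close> with
  coefficients that are smooth in \<open>t ^ i\<close>; replacing the two monomials by independent
  coordinates gives a smooth function on a strip of the plane. The coefficients are Borel sums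
  corrected by the decomposition of the flat remainder.\<close>

lemma semigroup_generated:
  assumes g: "Cinf {-d<..<d} g" "d > 0" "semigroup_supported i j (taylor 0 g)"
    and ij: "i = 2 \<or> i = 3" "coprime i j"
  obtains \<alpha> :: "nat \<Rightarrow> real \<Rightarrow> real" where "\<And>b. Cinf {-(d^i)<..<d^i} (\<alpha> b)"
    "\<And>t. t \<in> {-d<..<d} \<Longrightarrow> g t = (\<Sum>b<i. t ^ (j * b) * \<alpha> b (t ^ i))"
proof -
  have "\<exists>F. Cinf UNIV F \<and> taylor 0 F = Abs_fps (\<lambda>a. taylor 0 g $ (i * a + j * b))" for b
    using borel_lemma by blast
  then obtain \<beta> where \<beta>: "\<And>b. Cinf UNIV (\<beta> b)"
    "\<And>b. taylor 0 (\<beta> b) = Abs_fps (\<lambda>a. taylor 0 g $ (i * a + j * b))" by metis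
  define s where "s b t = t ^ (j * b) * \<beta> b (t ^ i)" for b t
  have i0: "i > 0" using ij by auto
  have pow: "Cinf U (\<lambda>t::real. t ^ k)" if "open U" for U k
    by (rule Cinf_power[OF Cinf_ident[OF that]])
  have s: "Cinf {-d<..<d} (s b)" for b
    unfolding s_def[abs_def] by (intro Cinf_mult pow Cinf_compose[OF \<beta>(1)]) auto
  have tpow: "taylor 0 (\<lambda>t. t ^ k) = fps_X ^ k" for k
    using taylor_power[OF Cinf_ident[OF open_UNIV], of 0 k] by simp
  have ts: "taylor 0 (s b) = fps_X ^ (j * b) * (Abs_fps (\<lambda>a. taylor 0 g $ (i * a + j * b)) oo fps_X ^ i)" for b
  proof -
    have "taylor 0 (\<lambda>t. \<beta> b (t ^ i)) = taylor 0 (\<beta> b) oo fps_X ^ i"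
      using taylor_compose[OF \<beta>(1) pow[OF open_UNIV, of i], of 0] i0
      by (simp add: tpow power_0_left)
    then show ?thesis
      using taylor_mult[OF pow[OF open_UNIV, of "j * b"] Cinf_compose[OF \<beta>(1)[of b] pow[OF open_UNIV, of i]], of 0]
      by (simp add: s_def[abs_def] tpow \<beta>(2))
  qed
  define r where "r t = g t - (\<Sum>b<i. s b t)" for t
  have S: "Cinf {-d<..<d} (\<lambda>t. \<Sum>b<i. s b t)" by (intro Cinf_sum s) simp
  have r: "Cinf {-d<..<d} r" unfolding r_def[abs_def] by (intro Cinf_diff g S)
  have "taylor 0 r = taylor 0 g - (\<Sum>b<i. taylor 0 (s b))"
    using taylor_diff[OF g(1) S, of 0] taylor_sum[of "{-d<..<d}" 0 "{..<i}" s] s g(2)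
    by (simp add: r_def[abs_def])
  then have "taylor 0 r = 0"
    using semigroup_decompose[OF g(3) i0 ij(2)] by (simp add: ts)
  then obtain \<rho> :: "nat \<Rightarrow> real \<Rightarrow> real" where \<rho>: "\<And>b. Cinf {-(d^i)<..<d^i} (\<rho> b)"
    "\<And>t. t \<in> {-d<..<d} \<Longrightarrow> r t = (\<Sum>b<i. t ^ (j * b) * \<rho> b (t ^ i))"
    using flat_decompose[OF r g(2) _ ij] by metis
  show ?thesis
  proof
    show "Cinf {-(d^i)<..<d^i} (\<lambda>u. \<beta> b u + \<rho> b u)" for b
      by (intro Cinf_add \<rho> Cinf_subset[OF \<beta>(1)]) auto
    show "g t = (\<Sum>b<i. t ^ (j * b) * (\<beta> b (t ^ i) + \<rho> b (t ^ i)))" if "t \<in> {-d<..<d}" for t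
      using \<rho>(2)[OF that] by (simp add: r_def s_def sum.distrib algebra_simps)
  qed
qed

section \<open>Cusps of plane curves\<close>

text \<open>\<open>H v z\<close> solves \<open>Df(z) w = v\<close> for \<open>w\<close>; smoothness of \<open>H v\<close> bootstraps the regularity of the
  inverse.\<close>

lemma local_inverse:
  fixes f :: "'a::euclidean_space \<Rightarrow> 'a"
  assumes f: "Cinf V f" "x0 \<in> V"
    and H: "\<And>v. Cinf V (H v)" "\<And>z v. z \<in> V \<Longrightarrow> frechet_derivative f (at z) (H v z) = v"
  obtains A B g where "open A" "x0 \<in> A" "A \<subseteq> V" "homeomorphism A B f g" "Cinf B g"
proof -
  let ?D = "\<lambda>z. frechet_derivative f (at z)"
  have D: "(f has_derivative ?D z) (at z)" if "z \<in> V" for z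
    by (rule Cinf_has_derivative[OF f(1) that])
  have bl: "bounded_linear (?D z)" if "z \<in> V" for z
    using D[OF that] by (rule has_derivative_bounded_linear)
  define f' where "f' z = Blinfun (?D z)" for z
  have f': "blinfun_apply (f' z) = ?D z" if "z \<in> V" for z
    unfolding f'_def by (rule bounded_linear_Blinfun_apply[OF bl[OF that]])
  have cont: "continuous_on V f'"
  proof (rule continuous_on_blinfun_componentwise)
    fix b :: 'a
    show "continuous_on V (\<lambda>z. blinfun_apply (f' z) b)"
      by (rule continuous_on_eq[OF Cinf_continuous_on[OF Cinf_frechet[OF f(1), of b]]]) (simp add: f')
  qed
  have surj: "surj (?D z)" if "z \<in> V" for z
    by (rule surjI[of _ "\<lambda>v. H v z"]) (rule H(2)[OF that])
  obtain h where h: "linear h" "?D x0 \<circ> h = id"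
    using linear_surjective_right_inverse[OF _ surj[OF f(2)]] bl[OF f(2)] bounded_linear.linear by blast
  have lin0: "linear (?D x0)" using bl[OF f(2)] bounded_linear.linear by blast
  then have "h \<circ> ?D x0 = id" using h linear_inverse_left by blast
  moreover have "bounded_linear h" using h(1) linear_conv_bounded_linear by blast
  ultimately have inv: "Blinfun h o\<^sub>L f' x0 = id_blinfun"
    by (intro blinfun_eqI) (simp add: f'[OF f(2)] bounded_linear_Blinfun_apply pointfree_idE)
  obtain A B g g' where AB: "open A" "A \<subseteq> V" "x0 \<in> A" "open B" "f x0 \<in> B" "homeomorphism A B f g"
    and g: "\<And>y. y \<in> B \<Longrightarrow> (g has_derivative (g' y)) (at y)"
      "\<And>y. y \<in> B \<Longrightarrow> g' y = inv (blinfun_apply (f' (g y)))"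
      "\<And>y. y \<in> B \<Longrightarrow> bij (blinfun_apply (f' (g y)))"
    using inverse_function_theorem[of V f f' x0 "Blinfun h"] Cinf_open[OF f(1)] D f' cont f(2) inv
    by metis
  have gB: "g ` B \<subseteq> V" using AB by (auto simp: homeomorphism_def)
  have g'H: "g' y v = H v (g y)" if "y \<in> B" for y v
  proof -
    have V: "g y \<in> V" using gB that by auto
    have "blinfun_apply (f' (g y)) (H v (g y)) = v" using H(2)[OF V] f'[OF V] by simp
    then show ?thesis using g(2,3)[OF that] by (metis bij_inv_eq_iff)
  qed
  have "ck_on k B g" for k
  proof (induction k)
    case 0
    then show ?case using AB(6) by (simp add: homeomorphism_def)
  next
    case (Suc k)
    show ?case
    proof (rule ck_on_SucI[OF AB(4) g(1)])
      fix v
      have "ck_on k B (\<lambda>y. H v (g y))"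
        using H(1)[of v] by (intro ck_on_compose[OF AB(4) Cinf_open[OF f(1)] gB _ Suc]) (simp add: Cinf_def)
      then show "ck_on k B (\<lambda>y. g' y v)"
        by (rule ck_on_cong[OF AB(4), rotated]) (simp add: g'H)
    qed
  qed
  then have "Cinf B g" using AB(4) by (simp add: Cinf_def)
  with AB show ?thesis by (intro that)
qed

lemma Cinf_open_preimage:
  assumes "Cinf V f" "open T"
  shows "open {x \<in> V. f x \<in> T}"
proof -
  have "open (V \<inter> f -` T)"
    by (rule continuous_open_preimage[OF Cinf_continuous_on[OF assms(1)] Cinf_open[OF assms(1)] assms(2)])
  moreover have "V \<inter> f -` T = {x \<in> V. f x \<in> T}" by auto
  ultimately show ?thesis by simp
qed

lemma local_inverse_real:
  fixes f :: "real \<Rightarrow> real"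
  assumes f: "Cinf V f" "x0 \<in> V" "deriv f x0 \<noteq> 0"
  obtains A B g where "open A" "x0 \<in> A" "A \<subseteq> V" "homeomorphism A B f g" "Cinf B g"
proof -
  \<comment> \<open>On \<open>W\<close> the derivative has no zero, so the right inverse
    \<open>v / deriv f z\<close> is smooth on the whole domain, as \<open>local_inverse\<close>
    demands.\<close>
  define W where "W = {x \<in> V. deriv f x \<noteq> 0}"
  have W: "open W"
    using Cinf_open_preimage[OF Cinf_deriv[OF f(1)] open_Compl[OF closed_singleton[of 0]]] by (simp add: W_def)
  have fW: "Cinf W f" by (rule Cinf_subset[OF f(1) _ W]) (auto simp: W_def)
  have "frechet_derivative f (at z) (v / deriv f z) = v" if "z \<in> W" for z v
  proof -
    have "linear (frechet_derivative f (at z))"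
      using Cinf_has_derivative[OF fW that] has_derivative_linear by blast
    from linear_cmul[OF this, of "v / deriv f z" 1] show ?thesis
      using Cinf_real_has_derivative(2)[OF fW that] that by (simp add: W_def)
  qed
  moreover have "Cinf W (\<lambda>z. v / deriv f z)" for v
    by (intro Cinf_divide Cinf_const W Cinf_deriv[OF fW]) (simp add: W_def)
  moreover have "x0 \<in> W" using f by (simp add: W_def)
  ultimately obtain A B g where "open A" "x0 \<in> A" "A \<subseteq> W" "homeomorphism A B f g" "Cinf B g"
    using local_inverse[OF fW, of x0 "\<lambda>v z. v / deriv f z"] by metis
  moreover have "W \<subseteq> V" by (auto simp: W_def)
  ultimately show ?thesis by (intro that) auto
qed

section \<open>Jacobians and local inversion in the plane\<close>

abbreviation partial1 :: "(real \<times> real \<Rightarrow> real) \<Rightarrow> real \<times> real \<Rightarrow> real"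
  where "partial1 P z \<equiv> frechet_derivative P (at z) (1, 0)"

abbreviation partial2 :: "(real \<times> real \<Rightarrow> real) \<Rightarrow> real \<times> real \<Rightarrow> real"
  where "partial2 P z \<equiv> frechet_derivative P (at z) (0, 1)"

definition jacobian :: "(real \<times> real \<Rightarrow> real) \<Rightarrow> (real \<times> real \<Rightarrow> real) \<Rightarrow> real \<times> real \<Rightarrow> real"
  where "jacobian P Q z = partial1 P z * partial2 Q z - partial2 P z * partial1 Q z"

lemma frechet_derivative_plane:
  assumes "Cinf V P" "z \<in> V"
  shows "frechet_derivative P (at z) (a, b) = a * partial1 P z + b * partial2 P z"
proof -
  let ?D = "frechet_derivative P (at z)"
  have lin: "linear ?D" using Cinf_has_derivative[OF assms] has_derivative_linear by blast
  have "?D (a, b) = ?D (a *\<^sub>R (1, 0) + b *\<^sub>R (0, 1))" by simp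
  also have "\<dots> = a *\<^sub>R ?D (1, 0) + b *\<^sub>R ?D (0, 1)"
    by (simp only: linear_add[OF lin] linear_cmul[OF lin])
  finally show ?thesis by simp
qed

lemma cramer2:
  fixes a b c d u v \<Delta> :: real
  assumes "a * d - b * c = \<Delta>" "\<Delta> \<noteq> 0"
  shows "(d * u - b * v) / \<Delta> * a + (a * v - c * u) / \<Delta> * b = u"
    and "(d * u - b * v) / \<Delta> * c + (a * v - c * u) / \<Delta> * d = v"
proof -
  have "(d * u - b * v) * a + (a * v - c * u) * b = u * \<Delta>"
    "(d * u - b * v) * c + (a * v - c * u) * d = v * \<Delta>"
    unfolding assms(1)[symmetric] by (simp_all add: algebra_simps)
  then show "(d * u - b * v) / \<Delta> * a + (a * v - c * u) / \<Delta> * b = u"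
    "(d * u - b * v) / \<Delta> * c + (a * v - c * u) / \<Delta> * d = v"
    using assms(2) by (simp_all add: add_divide_distrib[symmetric])
qed

lemma local_inverse_plane:
  assumes P: "Cinf V P" and Q: "Cinf V Q" and "z0 \<in> V" "jacobian P Q z0 \<noteq> 0"
  obtains A B g where "open A" "z0 \<in> A" "A \<subseteq> V" "homeomorphism A B (\<lambda>z. (P z, Q z)) g" "Cinf B g"
proof -
  have J: "Cinf V (jacobian P Q)"
    unfolding jacobian_def[abs_def] by (intro Cinf_diff Cinf_mult Cinf_frechet P Q)
  define W where "W = {z \<in> V. jacobian P Q z \<noteq> 0}"
  have W: "open W" "W \<subseteq> V"
    using Cinf_open_preimage[OF J open_Compl[OF closed_singleton[of 0]]] by (auto simp: W_def)
  have PW: "Cinf W P" and QW: "Cinf W Q" and JW: "Cinf W (jacobian P Q)"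
    using Cinf_subset W P Q J by blast+
  \<comment> \<open>Cramer's rule for the linear system with the Jacobian matrix; smooth because the
    Jacobian has no zero on \<open>W\<close>.\<close>
  define H where "H v z = ((partial2 Q z * fst v - partial2 P z * snd v) / jacobian P Q z,
    (partial1 P z * snd v - partial1 Q z * fst v) / jacobian P Q z)" for v z
  have H: "Cinf W (H v)" for v
    unfolding H_def[abs_def]
    by (intro Cinf_Pair Cinf_divide Cinf_diff Cinf_mult Cinf_frechet Cinf_const PW QW JW W)
       (auto simp: W_def)
  have "frechet_derivative (\<lambda>z. (P z, Q z)) (at z) (H v z) = v" if z: "z \<in> W" for z v
  proof -
    have jac: "jacobian P Q z \<noteq> 0" using z by (simp add: W_def)
    have "((\<lambda>z. (P z, Q z)) has_derivative
        (\<lambda>w. (frechet_derivative P (at z) w, frechet_derivative Q (at z) w))) (at z)"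
      by (intro has_derivative_Pair Cinf_has_derivative[OF PW z] Cinf_has_derivative[OF QW z])
    then have "frechet_derivative (\<lambda>z. (P z, Q z)) (at z) =
        (\<lambda>w. (frechet_derivative P (at z) w, frechet_derivative Q (at z) w))"
      by (rule frechet_derivative_at[symmetric])
    moreover have "frechet_derivative P (at z) (H v z) = fst v" "frechet_derivative Q (at z) (H v z) = snd v"
      unfolding H_def
      by (rule trans[OF frechet_derivative_plane[OF PW z] cramer2(1)[OF jacobian_def[symmetric] jac]]
            trans[OF frechet_derivative_plane[OF QW z] cramer2(2)[OF jacobian_def[symmetric] jac]])+
    ultimately show ?thesis by simp
  qed
  moreover have "z0 \<in> W" using assms(3,4) by (simp add: W_def)
  ultimately obtain A B g where "open A" "z0 \<in> A" "A \<subseteq> W" "homeomorphism A B (\<lambda>z. (P z, Q z)) g" "Cinf B g"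
    using local_inverse[OF Cinf_Pair[OF PW QW], of z0 H] H by metis
  with W(2) show ?thesis by (intro that) auto
qed

section \<open>Taylor coefficients along the monomial curve\<close>

lemma Cinf_monomial_curve:
  fixes U :: "real set"
  assumes "open U"
  shows "Cinf U (\<lambda>s::real. (s ^ i, s ^ j))"
  by (intro Cinf_Pair Cinf_power Cinf_ident assms)

lemma deriv_monomial_curve:
  assumes "Cinf V P" "(s ^ i, s ^ j) \<in> V"
  shows "deriv (\<lambda>s. P (s ^ i, s ^ j)) s = of_nat i * (s ^ (i - 1) * partial1 P (s ^ i, s ^ j))
      + of_nat j * (s ^ (j - 1) * partial2 P (s ^ i, s ^ j))"
proof -
  let ?z = "(s ^ i, s ^ j)"
  have "((\<lambda>s. (s ^ i, s ^ j)) has_derivative (\<lambda>v. (v * (of_nat i * s ^ (i - 1)), v * (of_nat j * s ^ (j - 1))))) (at s)"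
    by (auto intro!: derivative_eq_intros)
  then have D: "((\<lambda>s. P (s ^ i, s ^ j)) has_derivative
      (\<lambda>v. frechet_derivative P (at ?z) (v * (of_nat i * s ^ (i - 1)), v * (of_nat j * s ^ (j - 1))))) (at s)"
    by (rule has_derivative_compose) (rule Cinf_has_derivative[OF assms])
  have e: "frechet_derivative P (at ?z) (v * (of_nat i * s ^ (i - 1)), v * (of_nat j * s ^ (j - 1))) =
      (of_nat i * (s ^ (i - 1) * partial1 P ?z) + of_nat j * (s ^ (j - 1) * partial2 P ?z)) * v" for v
    by (rule trans[OF frechet_derivative_plane[OF assms]]) (simp add: algebra_simps)
  have "((\<lambda>s. P (s ^ i, s ^ j)) has_real_derivative
      of_nat i * (s ^ (i - 1) * partial1 P ?z) + of_nat j * (s ^ (j - 1) * partial2 P ?z)) (at s)"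
    unfolding has_field_derivative_def by (rule has_derivative_eq_rhs[OF D]) (rule ext, rule e)
  then show ?thesis by (rule DERIV_imp_deriv)
qed

text \<open>The chain rule relates order \<open>n\<close> for \<open>P\<close> to orders
  \<open>n - i\<close> and \<open>n - j\<close> for its partial derivatives. This recursion stands
  in for a Taylor expansion in two variables.\<close>

lemma taylor_monomial_curve:
  assumes P: "Cinf V P" and U: "open U" "0 \<in> U" "\<And>s. s \<in> U \<Longrightarrow> (s ^ i, s ^ j) \<in> V"
    and ij: "0 < i" "0 < j"
  shows "of_nat n * taylor 0 (\<lambda>s. P (s ^ i, s ^ j)) $ n =
      (if i \<le> n then of_nat i * taylor 0 (\<lambda>s. partial1 P (s ^ i, s ^ j)) $ (n - i) else 0) +
      (if j \<le> n then of_nat j * taylor 0 (\<lambda>s. partial2 P (s ^ i, s ^ j)) $ (n - j) else 0)"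
proof (cases n)
  case 0
  then show ?thesis using ij by simp
next
  case (Suc m)
  have C: "Cinf U (\<lambda>s. R (s ^ i, s ^ j))" if "Cinf V R" for R :: "real \<times> real \<Rightarrow> real"
    by (rule Cinf_compose[OF that Cinf_monomial_curve[OF U(1)]]) (use U in auto)
  have pow: "Cinf U (\<lambda>s. s ^ k)" for k by (intro Cinf_power Cinf_ident U)
  have C1: "Cinf U (\<lambda>s. partial1 P (s ^ i, s ^ j))" and C2: "Cinf U (\<lambda>s. partial2 P (s ^ i, s ^ j))"
    by (intro C Cinf_frechet P)+
  have tpow: "taylor 0 (\<lambda>t. t ^ k) = fps_X ^ k" for k
    using taylor_power[OF Cinf_ident[OF open_UNIV], of 0 k] by simp
  have "taylor 0 (deriv (\<lambda>s. P (s ^ i, s ^ j))) =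
      taylor 0 (\<lambda>s. of_nat i * (s ^ (i - 1) * partial1 P (s ^ i, s ^ j)) +
        of_nat j * (s ^ (j - 1) * partial2 P (s ^ i, s ^ j)))"
    by (rule taylor_cong[OF U(1,2)]) (rule deriv_monomial_curve[OF P U(3)])
  also have "\<dots> = fps_const (of_nat i) * (fps_X ^ (i - 1) * taylor 0 (\<lambda>s. partial1 P (s ^ i, s ^ j)))
      + fps_const (of_nat j) * (fps_X ^ (j - 1) * taylor 0 (\<lambda>s. partial2 P (s ^ i, s ^ j)))"
    using taylor_add[OF Cinf_mult[OF Cinf_const[OF U(1), of "of_nat i"] Cinf_mult[OF pow C1]]
        Cinf_mult[OF Cinf_const[OF U(1), of "of_nat j"] Cinf_mult[OF pow C2]] U(2), of "i - 1" "j - 1"]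
    by (simp add: taylor_cmult[OF Cinf_mult[OF pow C1] U(2)] taylor_cmult[OF Cinf_mult[OF pow C2] U(2)]
        taylor_mult[OF pow C1 U(2)] taylor_mult[OF pow C2 U(2)] tpow)
  finally have "of_nat n * taylor 0 (\<lambda>s. P (s ^ i, s ^ j)) $ n =
      (fps_const (of_nat i) * (fps_X ^ (i - 1) * taylor 0 (\<lambda>s. partial1 P (s ^ i, s ^ j)))
      + fps_const (of_nat j) * (fps_X ^ (j - 1) * taylor 0 (\<lambda>s. partial2 P (s ^ i, s ^ j)))) $ m"
    by (simp add: Suc taylor_nth_Suc del: of_nat_Suc)
  moreover have "m < i - 1 \<longleftrightarrow> \<not> i \<le> n" "m < j - 1 \<longleftrightarrow> \<not> j \<le> n" "m - (i - 1) = n - i" "m - (j - 1) = n - j"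
    using Suc ij by auto
  ultimately show ?thesis by (auto simp: fps_X_power_mult_nth)
qed

text \<open>If \<open>n\<close> lies outside the semigroup, so do \<open>n - i\<close> (for
  \<open>i \<le> n\<close>) and \<open>n - j\<close> (for \<open>j \<le> n\<close>). The recursion
  then expresses the coefficient by coefficients of partial derivatives that vanish by
  induction.\<close>

lemma semigroup_supported_monomial_curve:
  assumes P: "Cinf V P" and U: "open U" "0 \<in> U" "\<And>s. s \<in> U \<Longrightarrow> (s ^ i, s ^ j) \<in> V"
    and ij: "0 < i" "0 < j"
  shows "semigroup_supported i j (taylor 0 (\<lambda>s. P (s ^ i, s ^ j)))"
  unfolding semigroup_supported_def
proof (intro allI impI)
  fix n
  assume "\<nexists>a b. n = i * a + j * b"
  with P show "taylor 0 (\<lambda>s. P (s ^ i, s ^ j)) $ n = 0"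
  proof (induction n arbitrary: P rule: less_induct)
    case (less n)
    have "n \<noteq> 0" using less.prems(2) by (metis add_0 mult_0_right)
    have *: "taylor 0 (\<lambda>s. R (s ^ i, s ^ j)) $ (n - k) = 0"
      if "k = i \<or> k = j" "k \<le> n" "Cinf V R" for R :: "real \<times> real \<Rightarrow> real" and k
    proof (rule less.IH[OF _ that(3)])
      show "n - k < n" using that ij \<open>n \<noteq> 0\<close> by auto
      show "\<nexists>a b. n - k = i * a + j * b"
      proof
        assume "\<exists>a b. n - k = i * a + j * b"
        then obtain a b where "n - k = i * a + j * b" by blast
        then have "n = i * Suc a + j * b \<or> n = i * a + j * Suc b" using that(1,2) by auto
        then show False using less.prems(2) by blast
      qed
    qed
    have "of_nat n * taylor 0 (\<lambda>s. P (s ^ i, s ^ j)) $ n = 0"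
      using taylor_monomial_curve[OF less.prems(1) U ij, of n] *[of i "partial1 P"] *[of j "partial2 P"]
        Cinf_frechet[OF less.prems(1)] by auto
    then show ?case using \<open>n \<noteq> 0\<close> by simp
  qed
qed

text \<open>In order \<open>j\<close> the recursion also yields the coefficient of order
  \<open>j - i\<close> of the first partial derivative. It vanishes because \<open>j - i\<close> is
  a gap of the semigroup: otherwise \<open>i\<close> would divide \<open>j\<close>, against
  coprimality and \<open>2 \<le> i\<close>.\<close>

lemma taylor_monomial_curve_coeffs:
  assumes P: "Cinf V P" and U: "open U" "0 \<in> U" "\<And>s. s \<in> U \<Longrightarrow> (s ^ i, s ^ j) \<in> V"
    and ij: "2 \<le> i" "i < j" "coprime i j"
  shows "taylor 0 (\<lambda>s. P (s ^ i, s ^ j)) $ i = partial1 P (0, 0)"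
    and "taylor 0 (\<lambda>s. P (s ^ i, s ^ j)) $ j = partial2 P (0, 0)"
proof -
  have pos: "0 < i" "0 < j" using ij by auto
  show "taylor 0 (\<lambda>s. P (s ^ i, s ^ j)) $ i = partial1 P (0, 0)"
    using taylor_monomial_curve[OF P U pos, of i] ij by (simp add: power_0_left)
  have "\<nexists>a b. j - i = i * a + j * b"
  proof
    assume "\<exists>a b. j - i = i * a + j * b"
    then obtain a b where ab: "j - i = i * a + j * b" by blast
    have "b = 0"
    proof (rule ccontr)
      assume "b \<noteq> 0"
      then have "j \<le> j * b" by simp
      then show False using ab ij by linarith
    qed
    then have "j = i * Suc a" using ab ij by simp
    then have "i dvd j" by simp
    then have "i dvd 1" using ij(3) by (metis coprime_common_divisor dvd_refl)
    then show False using ij by simp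
  qed
  then have "taylor 0 (\<lambda>s. partial1 P (s ^ i, s ^ j)) $ (j - i) = 0"
    using semigroup_supported_monomial_curve[OF Cinf_frechet[OF P] U pos] by (simp add: semigroup_supported_def)
  then show "taylor 0 (\<lambda>s. P (s ^ i, s ^ j)) $ j = partial2 P (0, 0)"
    using taylor_monomial_curve[OF P U pos, of j] ij by (simp add: power_0_left)
qed

text \<open>Both changes of coordinates point from the model to the curve: \<open>\<theta>\<close>
  for the source and \<open>(P, Q)\<close> for the target. Local invertibility is recorded only by a
  derivative and a Jacobian at the base point, which Taylor coefficients can detect.\<close>

definition planar_cusp :: "nat \<Rightarrow> nat \<Rightarrow> (real \<Rightarrow> real) \<Rightarrow> (real \<Rightarrow> real) \<Rightarrow> real \<Rightarrow> bool"
  where "planar_cusp i j x y a \<longleftrightarrow> (\<exists>U \<theta> V P Q. Cinf U \<theta> \<and> 0 \<in> U \<and> \<theta> 0 = a \<and> deriv \<theta> 0 \<noteq> 0 \<and>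
      Cinf V P \<and> Cinf V Q \<and> jacobian P Q (0, 0) \<noteq> 0 \<and>
      (\<forall>s\<in>U. (s ^ i, s ^ j) \<in> V \<and> x (\<theta> s) = P (s ^ i, s ^ j) \<and> y (\<theta> s) = Q (s ^ i, s ^ j)))"

text \<open>The formal shadow of \<open>planar_cusp\<close>: \<open>h\<close> is the change of
  parameter, and the determinant of the coefficients of order \<open>i\<close> and \<open>j\<close>
  is the Jacobian of \<open>(P, Q)\<close> at the origin.\<close>

definition fps_cusp :: "nat \<Rightarrow> nat \<Rightarrow> real fps \<Rightarrow> real fps \<Rightarrow> bool"
  where "fps_cusp i j X Y \<longleftrightarrow> (\<exists>h. h $ 0 = 0 \<and> h $ 1 \<noteq> 0 \<and>
      semigroup_supported i j (X oo h) \<and> semigroup_supported i j (Y oo h) \<and>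
      (X oo h) $ i * (Y oo h) $ j - (X oo h) $ j * (Y oo h) $ i \<noteq> 0)"

text \<open>One direction takes Taylor series. In the other, Borel's lemma turns \<open>h\<close>
  into a smooth \<open>\<theta>\<close>, and the two support conditions then produce
  \<open>P\<close> and \<open>Q\<close> as smooth functions, with exact equality along the curve and
  not only to infinite order.\<close>

lemma planar_cusp_iff_fps_cusp:
  assumes x: "Cinf J x" and y: "Cinf J y" and a: "a \<in> J"
    and ij: "i = 2 \<or> i = 3" "i < j" "coprime i j"
  shows "planar_cusp i j x y a \<longleftrightarrow> fps_cusp i j (taylor a x) (taylor a y)"
proof
  assume "planar_cusp i j x y a"
  then obtain U \<theta> V P Q where \<theta>: "Cinf U \<theta>" "0 \<in> U" "\<theta> 0 = a" "deriv \<theta> 0 \<noteq> 0"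
    and PQ: "Cinf V P" "Cinf V Q" "jacobian P Q (0, 0) \<noteq> 0"
    and eq: "\<And>s. s \<in> U \<Longrightarrow> (s ^ i, s ^ j) \<in> V" "\<And>s. s \<in> U \<Longrightarrow> x (\<theta> s) = P (s ^ i, s ^ j)"
      "\<And>s. s \<in> U \<Longrightarrow> y (\<theta> s) = Q (s ^ i, s ^ j)"
    unfolding planar_cusp_def by blast
  define W where "W = {s \<in> U. \<theta> s \<in> J}"
  have W: "open W" "0 \<in> W" "W \<subseteq> U" "\<theta> ` W \<subseteq> J"
    using Cinf_open_preimage[OF \<theta>(1) Cinf_open[OF x]] \<theta> a by (auto simp: W_def)
  have \<theta>W: "Cinf W \<theta>" by (rule Cinf_subset[OF \<theta>(1) W(3,1)])
  let ?h = "taylor 0 \<theta> - fps_const a"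
  have X: "taylor a x oo ?h = taylor 0 (\<lambda>s. P (s ^ i, s ^ j))"
  proof -
    have "taylor 0 (\<lambda>s. x (\<theta> s)) = taylor 0 (\<lambda>s. P (s ^ i, s ^ j))"
      by (rule taylor_cong[OF W(1,2)]) (use eq(2) W(3) in blast)
    then show ?thesis using taylor_compose[OF x \<theta>W W(4,2)] \<theta>(3) by simp
  qed
  have Y: "taylor a y oo ?h = taylor 0 (\<lambda>s. Q (s ^ i, s ^ j))"
  proof -
    have "taylor 0 (\<lambda>s. y (\<theta> s)) = taylor 0 (\<lambda>s. Q (s ^ i, s ^ j))"
      by (rule taylor_cong[OF W(1,2)]) (use eq(3) W(3) in blast)
    then show ?thesis using taylor_compose[OF y \<theta>W W(4,2)] \<theta>(3) by simp
  qed
  have V: "\<And>s. s \<in> W \<Longrightarrow> (s ^ i, s ^ j) \<in> V" using eq(1) W(3) by blast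
  show "fps_cusp i j (taylor a x) (taylor a y)"
    unfolding fps_cusp_def
  proof (intro exI[of _ ?h] conjI)
    show "?h $ 1 \<noteq> 0" using \<theta>(4) by (simp add: taylor_nth_Suc)
    show "semigroup_supported i j (taylor a x oo ?h)" "semigroup_supported i j (taylor a y oo ?h)"
      unfolding X Y using semigroup_supported_monomial_curve[OF PQ(1) W(1,2) V] ij
        semigroup_supported_monomial_curve[OF PQ(2) W(1,2) V] by auto
    show "(taylor a x oo ?h) $ i * (taylor a y oo ?h) $ j - (taylor a x oo ?h) $ j * (taylor a y oo ?h) $ i \<noteq> 0"
      unfolding X Y using taylor_monomial_curve_coeffs[OF PQ(1) W(1,2) V _ ij(2,3)]
        taylor_monomial_curve_coeffs[OF PQ(2) W(1,2) V _ ij(2,3)] ij(1) PQ(3)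
      by (auto simp: jacobian_def)
  qed (use \<theta>(3) in simp)
next
  assume "fps_cusp i j (taylor a x) (taylor a y)"
  then obtain h where h: "h $ 0 = 0" "h $ 1 \<noteq> 0"
    and supp: "semigroup_supported i j (taylor a x oo h)" "semigroup_supported i j (taylor a y oo h)"
    and det: "(taylor a x oo h) $ i * (taylor a y oo h) $ j - (taylor a x oo h) $ j * (taylor a y oo h) $ i \<noteq> 0"
    unfolding fps_cusp_def by blast
  obtain \<theta> where \<theta>: "Cinf UNIV \<theta>" "taylor 0 \<theta> = fps_const a + h" using borel_lemma by blast
  have \<theta>0: "\<theta> 0 = a" using taylor_nth_0[of 0 \<theta>] h by (simp add: \<theta>(2))
  have \<theta>1: "deriv \<theta> 0 \<noteq> 0"
    using taylor_nth_Suc[of 0 \<theta> 0] h by (simp add: \<theta>(2))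
  have "open (\<theta> -` J)"
    using continuous_open_vimage[OF Cinf_open[OF x]] Cinf_isCont[OF \<theta>(1)] by blast
  moreover have "0 \<in> \<theta> -` J" using \<theta>0 a by simp
  ultimately obtain d where d: "d > 0" "ball 0 d \<subseteq> \<theta> -` J" using open_contains_ball by blast
  then have dJ: "\<theta> ` {-d<..<d} \<subseteq> J" by (auto simp: ball_eq_greaterThanLessThan)
  have \<theta>d: "Cinf {-d<..<d} \<theta>" by (rule Cinf_subset[OF \<theta>(1)]) auto
  have zero: "(0::real) \<in> {-d<..<d}" using d by simp
  have "\<exists>P. Cinf ({-(d^i)<..<d^i} \<times> UNIV) P \<and> (\<forall>s\<in>{-d<..<d}. z (\<theta> s) = P (s ^ i, s ^ j))"
    if z: "Cinf J z" "semigroup_supported i j (taylor a z oo h)" for z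
  proof -
    have C: "Cinf {-d<..<d} (\<lambda>s. z (\<theta> s))" by (rule Cinf_compose[OF z(1) \<theta>d dJ])
    have "semigroup_supported i j (taylor 0 (\<lambda>s. z (\<theta> s)))"
      using z(2) taylor_compose[OF z(1) \<theta>d dJ zero] by (simp add: \<theta>0 \<theta>(2))
    then obtain \<alpha> :: "nat \<Rightarrow> real \<Rightarrow> real" where \<alpha>: "\<And>b. Cinf {-(d^i)<..<d^i} (\<alpha> b)"
      "\<And>s. s \<in> {-d<..<d} \<Longrightarrow> z (\<theta> s) = (\<Sum>b<i. s ^ (j * b) * \<alpha> b (s ^ i))"
      using semigroup_generated[OF C d(1) _ ij(1,3)] by metis
    have o: "open ({-(d^i)<..<d^i} \<times> (UNIV :: real set))" by (intro open_Times) auto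
    show ?thesis
    proof (intro exI conjI ballI)
      show "Cinf ({-(d^i)<..<d^i} \<times> UNIV) (\<lambda>w. \<Sum>b<i. snd w ^ b * \<alpha> b (fst w))"
        by (intro Cinf_sum o Cinf_mult Cinf_power Cinf_compose[OF \<alpha>(1)] Cinf_linear
            bounded_linear_fst bounded_linear_snd) auto
      show "z (\<theta> s) = (\<Sum>b<i. snd (s ^ i, s ^ j) ^ b * \<alpha> b (fst (s ^ i, s ^ j)))" if "s \<in> {-d<..<d}" for s
        using \<alpha>(2)[OF that] by (simp add: power_mult)
    qed
  qed
  from this[OF x supp(1)] this[OF y supp(2)] obtain P Q
    where PQ: "Cinf ({-(d^i)<..<d^i} \<times> UNIV) P" "Cinf ({-(d^i)<..<d^i} \<times> UNIV) Q"
      and eq: "\<forall>s\<in>{-d<..<d}. x (\<theta> s) = P (s ^ i, s ^ j)" "\<forall>s\<in>{-d<..<d}. y (\<theta> s) = Q (s ^ i, s ^ j)"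
    by blast
  have V: "(s ^ i, s ^ j) \<in> {-(d^i)<..<d^i} \<times> UNIV" if "s \<in> {-d<..<d}" for s
  proof -
    have "\<bar>s\<bar> ^ i < d ^ i" using that ij(1) by (intro power_strict_mono) auto
    then show ?thesis by (simp add: power_abs[symmetric] abs_less_iff minus_less_iff)
  qed
  have X: "taylor a x oo h = taylor 0 (\<lambda>s. P (s ^ i, s ^ j))"
  proof -
    have "taylor 0 (\<lambda>s. x (\<theta> s)) = taylor 0 (\<lambda>s. P (s ^ i, s ^ j))"
      by (rule taylor_cong[OF _ zero]) (use eq(1) in auto)
    then show ?thesis using taylor_compose[OF x \<theta>d dJ zero] by (simp add: \<theta>0 \<theta>(2))
  qed
  have Y: "taylor a y oo h = taylor 0 (\<lambda>s. Q (s ^ i, s ^ j))"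
  proof -
    have "taylor 0 (\<lambda>s. y (\<theta> s)) = taylor 0 (\<lambda>s. Q (s ^ i, s ^ j))"
      by (rule taylor_cong[OF _ zero]) (use eq(2) in auto)
    then show ?thesis using taylor_compose[OF y \<theta>d dJ zero] by (simp add: \<theta>0 \<theta>(2))
  qed
  have "jacobian P Q (0, 0) \<noteq> 0"
    using det taylor_monomial_curve_coeffs[OF PQ(1) _ zero V _ ij(2,3)]
        taylor_monomial_curve_coeffs[OF PQ(2) _ zero V _ ij(2,3)] ij(1)
    by (auto simp: jacobian_def X Y)
  then show "planar_cusp i j x y a"
    unfolding planar_cusp_def using \<theta>d zero \<theta>0 \<theta>1 PQ eq V by blast
qed

unbundle no fps_syntax
unbundle vec_syntax

section \<open>From the hyperbolic plane to the plane\<close>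

text \<open>By the chain rule the derivative of \<open>(P, Q)\<close> is injective. With zero
  Jacobian, \<open>(partial2 P, - partial1 P)\<close> and \<open>(partial2 Q, - partial1 Q)\<close>
  would lie in its kernel; so all partial derivatives would be zero, and \<open>(1, 0)\<close> would
  lie in the kernel as well.\<close>

lemma jacobian_nonzero_if_left_inverse:
  assumes P: "Cinf V P" and Q: "Cinf V Q" and z0: "z0 \<in> V"
    and L: "Cinf W L" "(P z0, Q z0) \<in> W" and LPQ: "\<And>z. z \<in> V \<Longrightarrow> L (P z, Q z) = z"
  shows "jacobian P Q z0 \<noteq> 0"
proof
  assume jac: "jacobian P Q z0 = 0"
  let ?DP = "frechet_derivative P (at z0)" and ?DQ = "frechet_derivative Q (at z0)"
  let ?DL = "frechet_derivative L (at (P z0, Q z0))"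
  have DL: "(L has_derivative ?DL) (at (P z0, Q z0))"
    by (rule Cinf_has_derivative[OF L])
  have "((\<lambda>z. (P z, Q z)) has_derivative (\<lambda>w. (?DP w, ?DQ w))) (at z0)"
    by (intro has_derivative_Pair Cinf_has_derivative[OF P z0] Cinf_has_derivative[OF Q z0])
  from has_derivative_compose[OF this DL]
  have "((\<lambda>z. L (P z, Q z)) has_derivative (\<lambda>w. ?DL (?DP w, ?DQ w))) (at z0)" .
  then have "((\<lambda>z. z) has_derivative (\<lambda>w. ?DL (?DP w, ?DQ w))) (at z0)"
    by (rule has_derivative_transform_within_open[OF _ Cinf_open[OF P] z0]) (rule LPQ)
  then have "(\<lambda>w. ?DL (?DP w, ?DQ w)) = (\<lambda>w. w)"
    by (rule has_derivative_unique) (rule has_derivative_ident)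
  then have id: "?DL (?DP w, ?DQ w) = w" for w by (rule fun_cong)
  have "?DL 0 = 0" by (rule linear_0[OF has_derivative_linear[OF DL]])
  then have inj: "w = 0" if "?DP w = 0" "?DQ w = 0" for w
    using id[of w] that by (simp add: zero_prod_def)
  have DP: "?DP (a, b) = a * partial1 P z0 + b * partial2 P z0" for a b
    by (rule frechet_derivative_plane[OF P z0])
  have DQ: "?DQ (a, b) = a * partial1 Q z0 + b * partial2 Q z0" for a b
    by (rule frechet_derivative_plane[OF Q z0])
  have "(partial2 P z0, - partial1 P z0) = 0"
    by (rule inj; subst DP DQ; use jac in \<open>simp add: jacobian_def algebra_simps\<close>)
  moreover have "(partial2 Q z0, - partial1 Q z0) = 0"
    by (rule inj; subst DP DQ; use jac in \<open>simp add: jacobian_def algebra_simps\<close>)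
  ultimately have "((1, 0) :: real \<times> real) = 0"
    by (intro inj) (simp_all add: zero_prod_def)
  then show False by (simp add: zero_prod_def)
qed

text \<open>The functions \<open>a * x powr b\<close> on the positive half-line are closed under
  differentiation.\<close>

lemma Cinf_sqrt: "Cinf {0<..} sqrt"
proof (rule Cinf_cong)
  show "Cinf {0<..} (\<lambda>x::real. 1 * x powr (1 / 2))"
  proof (rule Cinf_coinduct[where P="\<lambda>f. \<exists>a b. f = (\<lambda>x. a * x powr b)"])
    show "\<exists>a b. (\<lambda>x::real. 1 * x powr (1 / 2)) = (\<lambda>x. a * x powr b)" by blast
  next
    fix f :: "real \<Rightarrow> real" assume "\<exists>a b. f = (\<lambda>x. a * x powr b)"
    then obtain a b where f: "f = (\<lambda>x. a * x powr b)" by blast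
    have "(f has_real_derivative (a * b) * x powr (b - 1)) (at x)" if "x \<in> {0<..}" for x
      unfolding f mult.assoc by (intro DERIV_cmult has_real_derivative_powr) (use that in simp)
    then show "\<exists>f'. (\<exists>a b. f' = (\<lambda>x. a * x powr b)) \<and> (\<forall>x\<in>{0<..}. (f has_real_derivative f' x) (at x))"
      by (intro exI[of _ "\<lambda>x. (a * b) * x powr (b - 1)"]) blast
  qed auto
qed (simp add: powr_half_sqrt)

lemma Cinf_vec_nth:
  fixes f :: "'a::euclidean_space \<Rightarrow> real ^ 'n"
  shows "Cinf U f \<Longrightarrow> Cinf U (\<lambda>x. f x $ i)"
  by (rule Cinf_bounded_linear[OF bounded_linear_vec_nth])

lemma Cinf_vector_3:
  assumes "Cinf U f" "Cinf U g" "Cinf U h"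
  shows "Cinf U (\<lambda>x. vector [f x, g x, h x] :: real ^ 3)"
proof (rule Cinf_cong)
  show "Cinf U (\<lambda>x. f x *\<^sub>R axis 1 1 + g x *\<^sub>R axis 2 1 + h x *\<^sub>R axis 3 1 :: real ^ 3)"
    by (intro Cinf_add Cinf_scaleR Cinf_const assms Cinf_open[OF assms(1)])
qed (simp add: vec_eq_iff forall_3 axis_def)

section \<open>The two sheets of the hyperboloid as graphs\<close>

definition hyperbolic_chart :: "real ^ 3 \<Rightarrow> real \<times> real"
  where "hyperbolic_chart x = (x $ 2, x $ 3)"

text \<open>\<open>H2\<close> contains both sheets of the hyperboloid. The sign
  \<open>\<sigma>\<close> of the first coordinate selects the sheet on which
  \<open>hyperbolic_chart\<close> is inverted.\<close>

definition sheet :: "real \<Rightarrow> real \<times> real \<Rightarrow> real ^ 3"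
  where "sheet \<sigma> z = vector [\<sigma> * sqrt (1 + (fst z)\<^sup>2 + (snd z)\<^sup>2), fst z, snd z]"

lemma hyperbolic_chart_sheet [simp]: "hyperbolic_chart (sheet \<sigma> z) = z"
  by (simp add: hyperbolic_chart_def sheet_def)

lemma sheet_in_H2: "\<sigma> = 1 \<or> \<sigma> = -1 \<Longrightarrow> sheet \<sigma> z \<in> H2 \<and> \<sigma> * sheet \<sigma> z $ 1 > 0"
  by (auto simp: H2_def mink_def sheet_def power2_eq_square[symmetric] add_pos_nonneg
      power_mult_distrib)

lemma sheet_chart:
  assumes "x \<in> H2" "\<sigma> = 1 \<or> \<sigma> = -1" "\<sigma> * x $ 1 > 0"
  shows "sheet \<sigma> (hyperbolic_chart x) = x"
proof -
  have "1 + (x $ 2)\<^sup>2 + (x $ 3)\<^sup>2 = (\<sigma> * x $ 1)\<^sup>2"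
    using assms(1,2) by (auto simp: H2_def mink_def power2_eq_square)
  then have "sqrt (1 + (x $ 2)\<^sup>2 + (x $ 3)\<^sup>2) = \<sigma> * x $ 1"
    using assms(3) by simp
  then show ?thesis
    using assms(2) by (auto simp: vec_eq_iff forall_3 sheet_def hyperbolic_chart_def)
qed

lemma H2_sheet_sign:
  assumes "x \<in> H2"
  obtains \<sigma> :: real where "\<sigma> = 1 \<or> \<sigma> = -1" "\<sigma> * x $ 1 > 0"
proof -
  have "x $ 1 \<noteq> 0"
  proof
    assume "x $ 1 = 0"
    then have "x $ 2 * x $ 2 + x $ 3 * x $ 3 = -1" using assms by (simp add: H2_def mink_def)
    then show False using sum_squares_ge_zero[of "x $ 2" "x $ 3"] by simp
  qed
  then show ?thesis using that[of 1] that[of "-1"] by (cases "x $ 1 > 0") auto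
qed

lemma Cinf_sheet: "Cinf UNIV (sheet \<sigma>)"
proof -
  have q: "Cinf UNIV (\<lambda>z::real \<times> real. 1 + (fst z)\<^sup>2 + (snd z)\<^sup>2)"
    by (intro Cinf_add Cinf_const Cinf_power Cinf_linear bounded_linear_fst bounded_linear_snd) auto
  have r: "Cinf UNIV (\<lambda>z::real \<times> real. sqrt (1 + (fst z)\<^sup>2 + (snd z)\<^sup>2))"
    by (rule Cinf_compose[OF Cinf_sqrt q]) (auto simp: add_pos_nonneg)
  then show ?thesis
    unfolding sheet_def[abs_def]
    by (intro Cinf_vector_3 Cinf_mult[OF Cinf_const r] Cinf_linear[OF bounded_linear_fst]
        Cinf_linear[OF bounded_linear_snd] open_UNIV)
qed

lemma Cinf_hyperbolic_chart: "Cinf UNIV hyperbolic_chart"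
  unfolding hyperbolic_chart_def[abs_def]
  by (intro Cinf_Pair Cinf_linear bounded_linear_vec_nth open_UNIV)

text \<open>Smoothness of \<open>h\<close> on a piece of \<open>I\<close> and of \<open>k\<close> on
  a piece of \<open>H2\<close> only means local extendability, so their derivatives are accessible
  through extensions alone. Their inverses live on open sets and serve as \<open>\<theta>\<close>
  and, after the chart, as \<open>(P, Q)\<close>.\<close>

lemma is_cusp_imp_planar_cusp:
  assumes c: "c ` I \<subseteq> H2" and ij: "0 < i" "0 < j" and cusp: "is_cusp i j I c t0"
  shows "t0 \<in> interior I" "planar_cusp i j (\<lambda>t. c t $ 2) (\<lambda>t. c t $ 3) t0"
proof -
  obtain U U' V V' h k where U: "openin (top_of_set I) U" "t0 \<in> U" and U': "open U'" "0 \<in> U'"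
    and V: "openin (top_of_set H2) V" "c ` U \<subseteq> V" and V': "open V'" "\<And>s. s \<in> U' \<Longrightarrow> (s ^ i, s ^ j) \<in> V'"
    and h: "diffeo U U' h" "h t0 = (0::real)" and k: "diffeo V V' k"
    and eq: "\<And>t. t \<in> U \<Longrightarrow> k (c t) = (h t ^ i, h t ^ j)"
    using cusp unfolding is_cusp_def germs_A_equivalent_def
    by (auto simp: image_subset_iff)
  obtain g where g: "homeomorphism U U' h g" "smooth_on U h" "smooth_on U' g"
    using h(1) unfolding diffeo_def by blast
  obtain kk where kk: "homeomorphism V V' k kk" "smooth_on V k" "smooth_on V' kk"
    using k unfolding diffeo_def by blast
  have UI: "U \<subseteq> I" using U(1) openin_imp_subset by blast
  have VH: "V \<subseteq> H2" using V(1) openin_imp_subset by blast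
  have gC: "Cinf U' g" by (rule smooth_on_open_imp_Cinf[OF g(3) U'(1)]) simp
  have kkC: "Cinf V' kk" by (rule smooth_on_open_imp_Cinf[OF kk(3) V'(1)]) simp
  have gU: "g s \<in> U" "h (g s) = s" if "s \<in> U'" for s
    using g(1) that by (auto simp: homeomorphism_def)
  have kkV: "kk z \<in> V" "k (kk z) = z" if "z \<in> V'" for z
    using kk(1) that by (auto simp: homeomorphism_def)
  have kkk: "kk (k x) = x" if "x \<in> V" for x
    using kk(1) that by (auto simp: homeomorphism_def)
  have g0: "g 0 = t0" using g(1) U(2) h(2) by (auto simp: homeomorphism_def)
  \<comment> \<open>A local extension \<open>H\<close> of \<open>h\<close> satisfies
    \<open>H (g s) = s\<close> near \<open>0\<close>, so the product of the two derivatives is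
    1.\<close>
  have g'0: "deriv g 0 \<noteq> 0"
  proof -
    obtain W H where W: "t0 \<in> W" "Cinf W H" "\<And>y. y \<in> W \<inter> U \<Longrightarrow> H y = h y"
      using g(2) U(2) unfolding smooth_on_iff_Cinf by meson
    have "((\<lambda>s. H (g s)) has_real_derivative deriv H (g 0) * deriv g 0) (at 0)"
      by (rule DERIV_chain2[where f=H and g=g])
         (use Cinf_real_has_derivative(1)[OF W(2)] Cinf_real_has_derivative(1)[OF gC U'(2)] W(1) g0 in auto)
    moreover have "open {s \<in> U'. g s \<in> W}"
      by (rule Cinf_open_preimage[OF gC Cinf_open[OF W(2)]])
    ultimately have "((\<lambda>s. s) has_real_derivative deriv H (g 0) * deriv g 0) (at 0)"
      by (rule has_field_derivative_transform_within_open) (use W gU U'(2) g0 in auto)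
    then have "deriv H (g 0) * deriv g 0 = 1" using DERIV_ident DERIV_unique by blast
    then show ?thesis by auto
  qed
  \<comment> \<open>The image under \<open>g\<close> of a neighbourhood of \<open>0\<close> is open
    and contained in \<open>I\<close>; this places \<open>t0\<close> in the interior.\<close>
  obtain A B f where AB: "open A" "0 \<in> A" "A \<subseteq> U'" "homeomorphism A B g f" "Cinf B f"
    using local_inverse_real[OF gC U'(2) g'0] by blast
  have "B = g ` A" using AB(4) by (simp add: homeomorphism_def)
  then have "t0 \<in> B" "B \<subseteq> I" using AB g0 gU UI by auto
  then show "t0 \<in> interior I" using Cinf_open[OF AB(5)] by (auto simp: interior_def)
  have cg: "c (g s) = kk (s ^ i, s ^ j)" if "s \<in> U'" for s
    using eq[OF gU(1)[OF that]] kkk[of "c (g s)"] gU[OF that] V(2) by auto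
  define P where "P z = kk z $ 2" for z
  define Q where "Q z = kk z $ 3" for z
  have P: "Cinf V' P" and Q: "Cinf V' Q"
    unfolding P_def[abs_def] Q_def[abs_def] by (intro Cinf_vec_nth kkC)+
  have z0: "(0, 0) \<in> V'" using V'(2)[OF U'(2)] ij by (simp add: power_0_left)
  have chart: "hyperbolic_chart (kk z) = (P z, Q z)" for z
    by (simp add: hyperbolic_chart_def P_def Q_def)
  have "jacobian P Q (0, 0) \<noteq> 0"
  proof -
    have x0: "kk (0, 0) \<in> V" using kkV z0 by blast
    then obtain \<sigma> :: real where \<sigma>: "\<sigma> = 1 \<or> \<sigma> = -1" "\<sigma> * kk (0, 0) $ 1 > 0"
      using H2_sheet_sign VH by blast
    \<comment> \<open>An extension \<open>K\<close> of \<open>k\<close> to the ambient space,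
      preceded by the inverse chart of the sheet, is a smooth left inverse of \<open>(P, Q)\<close>
      near the origin.\<close>
    obtain W K where W: "kk (0, 0) \<in> W" "Cinf W K" "\<And>y. y \<in> W \<inter> V \<Longrightarrow> K y = k y"
      using kk(2) x0 unfolding smooth_on_iff_Cinf by meson
    define N where "N = {z \<in> V'. kk z \<in> W \<inter> {x. \<sigma> * x $ 1 > 0}}"
    have N: "open N"
      unfolding N_def
      by (rule Cinf_open_preimage[OF kkC]) (intro open_Int Cinf_open[OF W(2)] open_Collect_less continuous_intros)
    have sh: "sheet \<sigma> (P z, Q z) = kk z" if "z \<in> N" for z
      using sheet_chart[OF _ \<sigma>(1), of "kk z"] kkV(1)[of z] VH that by (auto simp: N_def chart[symmetric])
    have N0: "(0, 0) \<in> N" using z0 W(1) \<sigma>(2) by (simp add: N_def)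
    have S: "open {w. sheet \<sigma> w \<in> W}"
      using Cinf_open_preimage[OF Cinf_sheet Cinf_open[OF W(2)]] by simp
    show ?thesis
    proof (rule jacobian_nonzero_if_left_inverse[where V=N and W="{w. sheet \<sigma> w \<in> W}" and L="\<lambda>w. K (sheet \<sigma> w)"])
      show "Cinf N P" "Cinf N Q" using Cinf_subset[OF P _ N] Cinf_subset[OF Q _ N] by (auto simp: N_def)
      show "Cinf {w. sheet \<sigma> w \<in> W} (\<lambda>w. K (sheet \<sigma> w))"
        by (rule Cinf_compose[OF W(2) Cinf_subset[OF Cinf_sheet _ S]]) auto
      show "(P (0, 0), Q (0, 0)) \<in> {w. sheet \<sigma> w \<in> W}" using sh[OF N0] W(1) by simp
      show "K (sheet \<sigma> (P z, Q z)) = z" if "z \<in> N" for z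
        unfolding sh[OF that] using W(3)[of "kk z"] kkV[of z] that by (auto simp: N_def)
    qed (rule N0)
  qed
  then show "planar_cusp i j (\<lambda>t. c t $ 2) (\<lambda>t. c t $ 3) t0"
    unfolding planar_cusp_def using gC U'(2) g0 g'0 P Q V'(2)
    by (intro exI[of _ U'] exI[of _ g] exI[of _ V'] exI[of _ P] exI[of _ Q]) (auto simp: cg P_def Q_def)
qed

text \<open>The required diffeomorphisms are local inverses of \<open>\<theta>\<close> and
  \<open>(P, Q)\<close>, the latter transported to \<open>H2\<close> by the chart. All
  neighbourhoods are shrunk so that the curve stays on the sheet of \<open>c t0\<close>, where the
  chart is injective.\<close>

lemma planar_cusp_imp_is_cusp:
  assumes c: "c ` I \<subseteq> H2" "continuous_on I c" and t0: "t0 \<in> interior I" and ij: "0 < i" "0 < j"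
    and cusp: "planar_cusp i j (\<lambda>t. c t $ 2) (\<lambda>t. c t $ 3) t0"
  shows "is_cusp i j I c t0"
proof -
  obtain U \<theta> V P Q where \<theta>: "Cinf U \<theta>" "0 \<in> U" "\<theta> 0 = t0" "deriv \<theta> 0 \<noteq> 0"
    and PQ: "Cinf V P" "Cinf V Q" "jacobian P Q (0, 0) \<noteq> 0"
    and eq: "\<And>s. s \<in> U \<Longrightarrow> (s ^ i, s ^ j) \<in> V"
      "\<And>s. s \<in> U \<Longrightarrow> hyperbolic_chart (c (\<theta> s)) = (P (s ^ i, s ^ j), Q (s ^ i, s ^ j))"
    using cusp unfolding planar_cusp_def hyperbolic_chart_def by (auto 0 3)
  have z0: "(0, 0) \<in> V" using eq(1)[OF \<theta>(2)] ij by (simp add: power_0_left)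
  obtain A2 B2 g2 where 2: "open A2" "(0, 0) \<in> A2" "A2 \<subseteq> V"
    "homeomorphism A2 B2 (\<lambda>z. (P z, Q z)) g2" "Cinf B2 g2"
    using local_inverse_plane[OF PQ(1,2) z0 PQ(3)] by blast
  have ct0: "c t0 \<in> H2" using c(1) t0 interior_subset by blast
  then obtain \<sigma> :: real where \<sigma>: "\<sigma> = 1 \<or> \<sigma> = -1" "\<sigma> * c t0 $ 1 > 0"
    using H2_sheet_sign by blast
  define T where "T = {t \<in> interior I. c t \<in> {x. \<sigma> * x $ 1 > 0}}"
  have "open (interior I \<inter> c -` {x. \<sigma> * x $ 1 > 0})"
    by (rule continuous_open_preimage[OF continuous_on_subset[OF c(2) interior_subset] open_interior])
       (intro open_Collect_less continuous_intros)
  moreover have "interior I \<inter> c -` {x. \<sigma> * x $ 1 > 0} = T" by (auto simp: T_def)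
  ultimately have T: "open T" "t0 \<in> T" "T \<subseteq> I" "\<And>t. t \<in> T \<Longrightarrow> \<sigma> * c t $ 1 > 0"
    using t0 \<sigma>(2) interior_subset by (auto simp: T_def)
  define W where "W = {s \<in> {s \<in> U. \<theta> s \<in> T}. (s ^ i, s ^ j) \<in> A2}"
  have W1: "open {s \<in> U. \<theta> s \<in> T}" by (rule Cinf_open_preimage[OF \<theta>(1) T(1)])
  have W: "open W" unfolding W_def by (rule Cinf_open_preimage[OF Cinf_monomial_curve[OF W1] 2(1)])
  have W0: "0 \<in> W" using \<theta> T 2(2) ij by (simp add: W_def power_0_left)
  have "Cinf W \<theta>" by (rule Cinf_subset[OF \<theta>(1) _ W]) (auto simp: W_def)
  then obtain A B g where 1: "open A" "0 \<in> A" "A \<subseteq> W" "homeomorphism A B \<theta> g" "Cinf B g"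
    using local_inverse_real[OF _ W0 \<theta>(4)] by blast
  have B: "open B" "B \<subseteq> T" "t0 \<in> B" "B \<subseteq> I"
    using Cinf_open[OF 1(5)] 1 \<theta>(3) T(3) by (auto simp: homeomorphism_def W_def)
  have g: "g t \<in> A" "\<theta> (g t) = t" if "t \<in> B" for t
    using 1(4) that by (auto simp: homeomorphism_def)
  define VV where "VV = H2 \<inter> {x. \<sigma> * x $ 1 > 0 \<and> hyperbolic_chart x \<in> B2}"
  have CB2: "open {x. hyperbolic_chart x \<in> B2}"
    using Cinf_open_preimage[OF Cinf_hyperbolic_chart Cinf_open[OF 2(5)]] by simp
  have k: "Cinf {x. hyperbolic_chart x \<in> B2} (\<lambda>x. g2 (hyperbolic_chart x))"
    by (rule Cinf_compose[OF 2(5) Cinf_subset[OF Cinf_hyperbolic_chart _ CB2]]) auto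
  have PQA: "Cinf A2 (\<lambda>z. (P z, Q z))"
    by (intro Cinf_subset[OF Cinf_Pair[OF PQ(1,2)] 2(3,1)])
  have kk: "Cinf A2 (\<lambda>z. sheet \<sigma> (P z, Q z))"
    by (rule Cinf_compose[OF Cinf_sheet PQA]) simp
  have VVs: "VV \<subseteq> {x. hyperbolic_chart x \<in> B2}" by (auto simp: VV_def)
  have "homeomorphism VV A2 (\<lambda>x. g2 (hyperbolic_chart x)) (\<lambda>z. sheet \<sigma> (P z, Q z))"
  proof (rule homeomorphismI)
    show "continuous_on VV (\<lambda>x. g2 (hyperbolic_chart x))"
      by (rule continuous_on_subset[OF Cinf_continuous_on[OF k] VVs])
    show "continuous_on A2 (\<lambda>z. sheet \<sigma> (P z, Q z))" by (rule Cinf_continuous_on[OF kk])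
    show "(\<lambda>x. g2 (hyperbolic_chart x)) ` VV \<subseteq> A2"
      using 2(4) VVs by (auto simp: homeomorphism_def)
    show "(\<lambda>z. sheet \<sigma> (P z, Q z)) ` A2 \<subseteq> VV"
      using 2(4) sheet_in_H2[OF \<sigma>(1)] by (auto simp: VV_def homeomorphism_def)
    show "sheet \<sigma> (P (g2 (hyperbolic_chart x)), Q (g2 (hyperbolic_chart x))) = x" if "x \<in> VV" for x
    proof -
      have "(P (g2 (hyperbolic_chart x)), Q (g2 (hyperbolic_chart x))) = hyperbolic_chart x"
        using 2(4) that by (simp add: homeomorphism_def VV_def)
      then show ?thesis using sheet_chart[OF _ \<sigma>(1), of x] that by (simp add: VV_def)
    qed
    show "g2 (hyperbolic_chart (sheet \<sigma> (P z, Q z))) = z" if "z \<in> A2" for z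
      using 2(4) that by (simp add: homeomorphism_def)
  qed
  then have dk: "diffeo VV A2 (\<lambda>x. g2 (hyperbolic_chart x))"
    unfolding diffeo_def using Cinf_imp_smooth_on[OF k VVs] Cinf_imp_smooth_on[OF kk order_refl] by blast
  have dh: "diffeo B A g"
    unfolding diffeo_def using homeomorphism_symD[OF 1(4)] Cinf_imp_smooth_on[OF 1(5) order_refl]
      Cinf_imp_smooth_on[OF \<theta>(1), of A] 1(3) by (auto simp: W_def)
  have ev: "hyperbolic_chart (c t) = (P (g t ^ i, g t ^ j), Q (g t ^ i, g t ^ j))" if "t \<in> B" for t
    using eq(2)[of "g t"] g[OF that] 1(3) by (auto simp: W_def)
  have gA2: "(g t ^ i, g t ^ j) \<in> A2" if "t \<in> B" for t
    using g(1)[OF that] 1(3) by (auto simp: W_def)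
  have "openin (top_of_set H2) VV"
  proof -
    have "VV = H2 \<inter> ({x. \<sigma> * x $ 1 > 0} \<inter> {x. hyperbolic_chart x \<in> B2})" by (auto simp: VV_def)
    moreover have "open ({x :: real ^ 3. \<sigma> * x $ 1 > 0} \<inter> {x. hyperbolic_chart x \<in> B2})"
      by (intro open_Int CB2 open_Collect_less continuous_intros)
    ultimately show ?thesis by auto
  qed
  moreover have "openin (top_of_set I) B" using B by (simp add: open_subset)
  moreover have "c ` B \<subseteq> VV"
  proof
    fix x assume "x \<in> c ` B"
    then obtain t where t: "t \<in> B" "x = c t" by blast
    have "(P (g t ^ i, g t ^ j), Q (g t ^ i, g t ^ j)) \<in> B2"
      using 2(4) gA2[OF t(1)] by (auto simp: homeomorphism_def)
    moreover have "c t \<in> H2" using t(1) B(4) c(1) by blast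
    ultimately show "x \<in> VV" using ev[OF t(1)] t B(2) T(4) by (auto simp: VV_def)
  qed
  moreover have "(\<lambda>t. (t ^ i, t ^ j)) ` A \<subseteq> A2" using 1(3) by (auto simp: W_def)
  moreover have "g t0 = 0" using 1(2,4) \<theta>(3) by (auto simp: homeomorphism_def)
  moreover have "g2 (hyperbolic_chart (c t)) = (g t ^ i, g t ^ j)" if "t \<in> B" for t
    unfolding ev[OF that] using 2(4) gA2[OF that] by (simp add: homeomorphism_def)
  ultimately show ?thesis
    unfolding is_cusp_def germs_A_equivalent_def
    by (intro exI[of _ B] exI[of _ A] exI[of _ VV] exI[of _ A2] exI[of _ g] exI[of _ "\<lambda>x. g2 (hyperbolic_chart x)"])
       (use B 1 2 dk dh in auto)
qed

unbundle no vec_syntax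
unbundle fps_syntax

section \<open>Cusp criteria for formal curves\<close>

text \<open>For each cusp type the semigroup has finitely many gaps, so the support condition
  becomes finitely many equations; here 1 is the only gap.\<close>

lemma semigroup_supported_2_3: "semigroup_supported 2 3 A \<longleftrightarrow> A $ 1 = 0"
proof -
  have "(\<nexists>a b. n = 2 * a + 3 * b) \<longleftrightarrow> n = 1" for n :: nat by presburger
  then show ?thesis by (simp add: semigroup_supported_def)
qed

lemma semigroup_supported_2_5: "semigroup_supported 2 5 A \<longleftrightarrow> A $ 1 = 0 \<and> A $ 3 = 0"
proof -
  have "(\<nexists>a b. n = 2 * a + 5 * b) \<longleftrightarrow> n = 1 \<or> n = 3" for n :: nat by presburger
  then show ?thesis by (auto simp: semigroup_supported_def)
qed

lemma semigroup_supported_3_4: "semigroup_supported 3 4 A \<longleftrightarrow> A $ 1 = 0 \<and> A $ 2 = 0 \<and> A $ 5 = 0"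
proof -
  have "(\<nexists>a b. n = 3 * a + 4 * b) \<longleftrightarrow> n = 1 \<or> n = 2 \<or> n = 5" for n :: nat by presburger
  then show ?thesis by (auto simp: semigroup_supported_def)
qed

lemma semigroup_supported_3_5:
  "semigroup_supported 3 5 A \<longleftrightarrow> A $ 1 = 0 \<and> A $ 2 = 0 \<and> A $ 4 = 0 \<and> A $ 7 = 0"
proof -
  have "(\<nexists>a b. n = 3 * a + 5 * b) \<longleftrightarrow> n = 1 \<or> n = 2 \<or> n = 4 \<or> n = 7" for n :: nat by presburger
  then show ?thesis by (auto simp: semigroup_supported_def)
qed

section \<open>Coefficients after a formal change of parameter\<close>

lemma compose_X_times_nth:
  fixes A u :: "real fps"
  shows "(A oo fps_X * u) $ n = (\<Sum>i=0..n. A $ i * (u ^ i) $ (n - i))"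
  by (simp add: fps_compose_nth power_mult_distrib fps_X_power_mult_nth)

lemma compose_X_times_low:
  fixes A u :: "real fps"
  shows "(A oo fps_X * u) $ 1 = A $ 1 * u $ 0"
    and "A $ 1 = 0 \<Longrightarrow> (A oo fps_X * u) $ 2 = A $ 2 * (u $ 0)^2"
    and "A $ 1 = 0 \<Longrightarrow> (A oo fps_X * u) $ 3 = A $ 3 * (u $ 0)^3 + A $ 2 * (2 * u $ 0 * u $ 1)"
    and "A $ 1 = 0 \<Longrightarrow> A $ 2 = 0 \<Longrightarrow> (A oo fps_X * u) $ 4 = A $ 4 * (u $ 0)^4 + A $ 3 * (3 * (u $ 0)^2 * u $ 1)"
    and "A $ 1 = 0 \<Longrightarrow> (A oo fps_X * u) $ 5 = A $ 5 * (u $ 0)^5 + A $ 4 * (4 * (u $ 0)^3 * u $ 1)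
      + A $ 3 * (3 * (u $ 0)^2 * u $ 2 + 3 * u $ 0 * (u $ 1)^2) + A $ 2 * (2 * u $ 0 * u $ 3 + 2 * u $ 1 * u $ 2)"
  unfolding compose_X_times_nth
  by (simp_all add: eval_nat_numeral fps_mult_nth algebra_simps)

text \<open>Stated for the shape of the parameter change that is constructed for type (3,5):
  normalised linear term and no term of order 3 in \<open>u\<close>.\<close>

lemma compose_X_times_7:
  fixes A u :: "real fps"
  assumes "A $ 1 = 0" "A $ 2 = 0" "u $ 0 = 1" "u $ 3 = 0"
  shows "(A oo fps_X * u) $ 7 = A $ 7 + A $ 6 * (6 * u $ 1) + A $ 5 * (5 * u $ 2 + 10 * (u $ 1)^2)
      + A $ 4 * (12 * u $ 1 * u $ 2 + 4 * (u $ 1)^3)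
      + A $ 3 * (3 * u $ 4 + 3 * (u $ 2)^2 + 3 * (u $ 1)^2 * u $ 2)"
  unfolding compose_X_times_nth using assms
  by (simp add: eval_nat_numeral fps_mult_nth algebra_simps)

text \<open>A series with zero constant term and nonzero linear term is \<open>fps_X * u\<close>
  with \<open>u $ 0 \<noteq> 0\<close>. In this form the coefficients of a composite are explicit
  polynomials in those of \<open>u\<close>, which can be chosen to clear the gaps.\<close>

lemma fps_cusp_alt:
  "fps_cusp i j X Y \<longleftrightarrow> (\<exists>u. u $ 0 \<noteq> 0 \<and> semigroup_supported i j (X oo fps_X * u) \<and>
     semigroup_supported i j (Y oo fps_X * u) \<and>
     (X oo fps_X * u) $ i * (Y oo fps_X * u) $ j - (X oo fps_X * u) $ j * (Y oo fps_X * u) $ i \<noteq> 0)"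
proof
  assume "fps_cusp i j X Y"
  then obtain h where h: "h $ 0 = 0" "h $ 1 \<noteq> 0" "semigroup_supported i j (X oo h)"
    "semigroup_supported i j (Y oo h)" "(X oo h) $ i * (Y oo h) $ j - (X oo h) $ j * (Y oo h) $ i \<noteq> 0"
    unfolding fps_cusp_def by blast
  define u where "u = Abs_fps (\<lambda>n. h $ Suc n)"
  have "h = fps_X * u" by (rule fps_ext) (auto simp: u_def h(1))
  moreover have "u $ 0 \<noteq> 0" using h(2) by (simp add: u_def)
  ultimately show "\<exists>u. u $ 0 \<noteq> 0 \<and> semigroup_supported i j (X oo fps_X * u) \<and>
     semigroup_supported i j (Y oo fps_X * u) \<and>
     (X oo fps_X * u) $ i * (Y oo fps_X * u) $ j - (X oo fps_X * u) $ j * (Y oo fps_X * u) $ i \<noteq> 0"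
    using h by blast
next
  assume "\<exists>u. u $ 0 \<noteq> 0 \<and> semigroup_supported i j (X oo fps_X * u) \<and>
     semigroup_supported i j (Y oo fps_X * u) \<and>
     (X oo fps_X * u) $ i * (Y oo fps_X * u) $ j - (X oo fps_X * u) $ j * (Y oo fps_X * u) $ i \<noteq> 0"
  then obtain u where "u $ 0 \<noteq> 0" "semigroup_supported i j (X oo fps_X * u)"
     "semigroup_supported i j (Y oo fps_X * u)"
     "(X oo fps_X * u) $ i * (Y oo fps_X * u) $ j - (X oo fps_X * u) $ j * (Y oo fps_X * u) $ i \<noteq> 0"
    by blast
  moreover have "(fps_X * u) $ 0 = 0" "(fps_X * u) $ 1 = u $ 0" by simp_all
  ultimately show "fps_cusp i j X Y"
    unfolding fps_cusp_def by metis
qed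

definition det_coeffs :: "real fps \<Rightarrow> real fps \<Rightarrow> nat \<Rightarrow> nat \<Rightarrow> real"
  where "det_coeffs X Y i j = X $ i * Y $ j - X $ j * Y $ i"

text \<open>A change of parameter multiplies the determinant by \<open>(u $ 0) ^ 5\<close>. There is
  no further gap to clear, so \<open>u = 1\<close> is a witness.\<close>

lemma fps_cusp_2_3:
  "fps_cusp 2 3 X Y \<longleftrightarrow> X $ 1 = 0 \<and> Y $ 1 = 0 \<and> det_coeffs X Y 2 3 \<noteq> 0"
proof -
  have "(X oo fps_X * u) $ 2 * (Y oo fps_X * u) $ 3 - (X oo fps_X * u) $ 3 * (Y oo fps_X * u) $ 2
      = (u $ 0) ^ 5 * det_coeffs X Y 2 3" if "X $ 1 = 0" "Y $ 1 = 0" for u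
    by (simp only: compose_X_times_low(2,3)[OF that(1)] compose_X_times_low(2,3)[OF that(2)] det_coeffs_def)
       (simp add: algebra_simps eval_nat_numeral)
  then show ?thesis
    unfolding fps_cusp_alt semigroup_supported_2_3 compose_X_times_low(1)
    by (auto simp: det_coeffs_def intro!: exI[of _ 1])
qed

text \<open>Clearing the gap 3 prescribes \<open>2 * u $ 1 = - (k * (u $ 0)^2)\<close>, which works
  for both coordinates only if their coefficients of order 3 are the same multiple \<open>k\<close>
  of those of order 2. The same \<open>u $ 1\<close> mixes order 4 into order 5; this is the origin
  of the correction \<open>2 * k * det_coeffs X Y 2 4\<close>.\<close>

lemma fps_cusp_2_5:
  "fps_cusp 2 5 X Y \<longleftrightarrow> X $ 1 = 0 \<and> Y $ 1 = 0 \<and>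
     (\<exists>k. X $ 3 = k * X $ 2 \<and> Y $ 3 = k * Y $ 2 \<and> det_coeffs X Y 2 5 - 2 * k * det_coeffs X Y 2 4 \<noteq> 0)"
  (is "_ \<longleftrightarrow> ?R")
proof -
  have three: "(A oo fps_X * u) $ 3 = (u $ 0)^3 * (A $ 3 - k * A $ 2)"
    if "A $ 1 = 0" "2 * u $ 1 = - (k * (u $ 0)^2)" for A u :: "real fps" and k
  proof -
    have "A $ 2 * (2 * u $ 0 * u $ 1) = A $ 2 * u $ 0 * (2 * u $ 1)" by simp
    then show ?thesis unfolding compose_X_times_low(3)[OF that(1)] that(2)
      by (simp add: algebra_simps eval_nat_numeral)
  qed
  have det: "(X oo fps_X * u) $ 2 * (Y oo fps_X * u) $ 5 - (X oo fps_X * u) $ 5 * (Y oo fps_X * u) $ 2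
      = (u $ 0) ^ 7 * (det_coeffs X Y 2 5 - 2 * k * det_coeffs X Y 2 4)"
    if "X $ 1 = 0" "Y $ 1 = 0" "2 * u $ 1 = - (k * (u $ 0)^2)" "X $ 3 = k * X $ 2" "Y $ 3 = k * Y $ 2" for u k
  proof -
    \<comment> \<open>\<open>T\<close> collects what multiplies \<open>A $ 2\<close> in order 5; it
      drops out of the determinant with the coefficients of order 2.\<close>
    define T where "T = k * (3 * (u $ 0)^2 * u $ 2 + 3 * u $ 0 * (u $ 1)^2) + 2 * u $ 0 * u $ 3 + 2 * u $ 1 * u $ 2"
    have five: "(A oo fps_X * u) $ 5 = (u $ 0)^5 * (A $ 5 - 2 * k * A $ 4) + A $ 2 * T"
      if "A $ 1 = 0" "A $ 3 = k * A $ 2" for A :: "real fps"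
    proof -
      have "A $ 4 * (4 * (u $ 0)^3 * u $ 1) = A $ 4 * 2 * (u $ 0)^3 * (2 * u $ 1)" by simp
      also have "\<dots> = - ((u $ 0)^5 * (2 * k * A $ 4))"
        unfolding \<open>2 * u $ 1 = - (k * (u $ 0)^2)\<close> by (simp add: eval_nat_numeral)
      finally show ?thesis
        unfolding compose_X_times_low(5)[OF that(1)] that(2) T_def by (simp add: algebra_simps)
    qed
    show ?thesis
      unfolding five[OF that(1,4)] five[OF that(2,5)] compose_X_times_low(2)[OF that(1)]
        compose_X_times_low(2)[OF that(2)] det_coeffs_def
      by (simp add: algebra_simps eval_nat_numeral)
  qed
  show ?thesis
  proof
    assume "fps_cusp 2 5 X Y"
    then obtain u where u: "u $ 0 \<noteq> 0" "X $ 1 = 0" "Y $ 1 = 0"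
      "(X oo fps_X * u) $ 3 = 0" "(Y oo fps_X * u) $ 3 = 0"
      "(X oo fps_X * u) $ 2 * (Y oo fps_X * u) $ 5 - (X oo fps_X * u) $ 5 * (Y oo fps_X * u) $ 2 \<noteq> 0"
      unfolding fps_cusp_alt semigroup_supported_2_5 compose_X_times_low(1) by auto
    define k where "k = - 2 * u $ 1 / (u $ 0)^2"
    have k: "2 * u $ 1 = - (k * (u $ 0)^2)" using u(1) by (simp add: k_def)
    have 3: "X $ 3 = k * X $ 2" "Y $ 3 = k * Y $ 2"
      using u(1,4,5) three[OF u(2) k] three[OF u(3) k] by simp_all
    then show ?R using det[OF u(2,3) k 3] u by auto
  next
    assume ?R
    then obtain k where k: "X $ 1 = 0" "Y $ 1 = 0" "X $ 3 = k * X $ 2" "Y $ 3 = k * Y $ 2"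
      "det_coeffs X Y 2 5 - 2 * k * det_coeffs X Y 2 4 \<noteq> 0" by blast
    define u where "u = 1 - fps_const (k / 2) * fps_X"
    have u: "u $ 0 = 1" "2 * u $ 1 = - (k * (u $ 0)^2)" by (simp_all add: u_def)
    show "fps_cusp 2 5 X Y"
      unfolding fps_cusp_alt semigroup_supported_2_5 compose_X_times_low(1)
      using three[OF k(1) u(2)] three[OF k(2) u(2)] det[OF k(1,2) u(2) k(3,4)] k u(1)
      by (intro exI[of _ u]) simp
  qed
qed

lemma plane_coordinates:
  fixes a1 a2 b1 b2 c1 c2 :: real
  assumes "a1 * b2 - b1 * a2 \<noteq> 0"
  obtains \<alpha> \<beta> where "c1 = \<alpha> * a1 + \<beta> * b1" "c2 = \<alpha> * a2 + \<beta> * b2"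
  using cramer2[of a1 b2 b1 a2 _ c1 c2, OF refl assms] by (metis)

text \<open>The gap 5 imposes no condition: once the coefficient vectors of order 3 and 4 form a
  basis of the plane, the vector of order 5 is removed by the choice of \<open>u $ 1\<close> and
  \<open>u $ 2\<close>.\<close>

lemma fps_cusp_3_4:
  "fps_cusp 3 4 X Y \<longleftrightarrow> X $ 1 = 0 \<and> Y $ 1 = 0 \<and> X $ 2 = 0 \<and> Y $ 2 = 0 \<and> det_coeffs X Y 3 4 \<noteq> 0"
  (is "_ \<longleftrightarrow> ?R")
proof -
  have det: "(X oo fps_X * u) $ 3 * (Y oo fps_X * u) $ 4 - (X oo fps_X * u) $ 4 * (Y oo fps_X * u) $ 3
      = (u $ 0) ^ 7 * det_coeffs X Y 3 4"
    if "X $ 1 = 0" "Y $ 1 = 0" "X $ 2 = 0" "Y $ 2 = 0" for u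
    by (simp only: compose_X_times_low(3)[OF that(1)] compose_X_times_low(3)[OF that(2)]
        compose_X_times_low(4)[OF that(1,3)] compose_X_times_low(4)[OF that(2,4)] det_coeffs_def that)
       (simp add: algebra_simps eval_nat_numeral)
  show ?thesis
  proof
    assume "fps_cusp 3 4 X Y"
    then obtain u where u: "u $ 0 \<noteq> 0" "X $ 1 = 0" "Y $ 1 = 0"
      "(X oo fps_X * u) $ 2 = 0" "(Y oo fps_X * u) $ 2 = 0"
      "(X oo fps_X * u) $ 3 * (Y oo fps_X * u) $ 4 - (X oo fps_X * u) $ 4 * (Y oo fps_X * u) $ 3 \<noteq> 0"
      unfolding fps_cusp_alt semigroup_supported_3_4 compose_X_times_low(1) by auto
    have "X $ 2 = 0" "Y $ 2 = 0"
      using u compose_X_times_low(2)[OF u(2)] compose_X_times_low(2)[OF u(3)] by simp_all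
    then show ?R using det u by auto
  next
    assume R: ?R
    then obtain \<alpha> \<beta> where ab: "X $ 5 = \<alpha> * X $ 3 + \<beta> * X $ 4" "Y $ 5 = \<alpha> * Y $ 3 + \<beta> * Y $ 4"
      using plane_coordinates[of "X $ 3" "Y $ 4" "X $ 4" "Y $ 3" "X $ 5" "Y $ 5"]
      unfolding det_coeffs_def by metis
    \<comment> \<open>The values of \<open>u $ 1\<close> and \<open>u $ 2\<close> solve
      \<open>\<beta> + 4 * b = 0\<close> and \<open>\<alpha> + 3 * c + 3 * b\<^sup>2 = 0\<close>,
      the components of order 5 along the vectors of order 4 and 3.\<close>
    define b where "b = - \<beta> / 4"
    define c where "c = - \<alpha> / 3 - b\<^sup>2"
    define u where "u = 1 + fps_const b * fps_X + fps_const c * fps_X ^ 2"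
    have u: "u $ 0 = 1" "u $ 1 = b" "u $ 2 = c" by (simp_all add: u_def fps_X_power_nth)
    have five: "(A oo fps_X * u) $ 5 = 0"
      if "A $ 1 = 0" "A $ 2 = 0" "A $ 5 = \<alpha> * A $ 3 + \<beta> * A $ 4" for A :: "real fps"
    proof -
      have \<beta>: "\<beta> = - (4 * b)" by (simp add: b_def)
      have \<alpha>: "\<alpha> = - (3 * c + 3 * b\<^sup>2)" by (simp add: c_def)
      show ?thesis
        unfolding compose_X_times_low(5)[OF that(1)] that(2,3) u unfolding \<alpha> \<beta>
        by (simp add: algebra_simps)
    qed
    show "fps_cusp 3 4 X Y"
      unfolding fps_cusp_alt semigroup_supported_3_4 compose_X_times_low(1)
      using R five[OF _ _ ab(1)] five[OF _ _ ab(2)] det[of u] u(1)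
        compose_X_times_low(2)[of X u] compose_X_times_low(2)[of Y u]
      by (intro exI[of _ u]) simp
  qed
qed

text \<open>Clearing the gap 4 fixes \<open>u $ 1\<close> and makes the vector of order 4 a multiple
  of that of order 3. This also keeps the mixing of order 4 into order 5 out of the determinant. The
  gap 7 imposes no condition, as the vectors of order 3 and 5 span the plane.\<close>

lemma fps_cusp_3_5:
  "fps_cusp 3 5 X Y \<longleftrightarrow> X $ 1 = 0 \<and> Y $ 1 = 0 \<and> X $ 2 = 0 \<and> Y $ 2 = 0 \<and>
     (\<exists>k. X $ 4 = k * X $ 3 \<and> Y $ 4 = k * Y $ 3) \<and> det_coeffs X Y 3 5 \<noteq> 0"
  (is "_ \<longleftrightarrow> ?R")
proof -
  have four: "(A oo fps_X * u) $ 4 = (u $ 0)^4 * (A $ 4 - k * A $ 3)"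
    if "A $ 1 = 0" "A $ 2 = 0" "3 * u $ 1 = - (k * (u $ 0)^2)" for A u :: "real fps" and k
  proof -
    have "A $ 3 * (3 * (u $ 0)^2 * u $ 1) = A $ 3 * (u $ 0)^2 * (3 * u $ 1)" by simp
    then show ?thesis unfolding compose_X_times_low(4)[OF that(1,2)] that(3)
      by (simp add: algebra_simps eval_nat_numeral)
  qed
  have det: "(X oo fps_X * u) $ 3 * (Y oo fps_X * u) $ 5 - (X oo fps_X * u) $ 5 * (Y oo fps_X * u) $ 3
      = (u $ 0) ^ 8 * det_coeffs X Y 3 5"
    if "X $ 1 = 0" "Y $ 1 = 0" "X $ 2 = 0" "Y $ 2 = 0" "X $ 4 = k * X $ 3" "Y $ 4 = k * Y $ 3" for u k
    by (simp only: compose_X_times_low(3,5)[OF that(1)] compose_X_times_low(3,5)[OF that(2)] det_coeffs_def that)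
       (simp add: algebra_simps eval_nat_numeral)
  show ?thesis
  proof
    assume "fps_cusp 3 5 X Y"
    then obtain u where u: "u $ 0 \<noteq> 0" "X $ 1 = 0" "Y $ 1 = 0"
      "(X oo fps_X * u) $ 2 = 0" "(Y oo fps_X * u) $ 2 = 0"
      "(X oo fps_X * u) $ 4 = 0" "(Y oo fps_X * u) $ 4 = 0"
      "(X oo fps_X * u) $ 3 * (Y oo fps_X * u) $ 5 - (X oo fps_X * u) $ 5 * (Y oo fps_X * u) $ 3 \<noteq> 0"
      unfolding fps_cusp_alt semigroup_supported_3_5 compose_X_times_low(1) by auto
    have 2: "X $ 2 = 0" "Y $ 2 = 0"
      using u compose_X_times_low(2)[OF u(2)] compose_X_times_low(2)[OF u(3)] by simp_all
    define k where "k = - 3 * u $ 1 / (u $ 0)^2"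
    have k: "3 * u $ 1 = - (k * (u $ 0)^2)" using u(1) by (simp add: k_def)
    have 4: "X $ 4 = k * X $ 3" "Y $ 4 = k * Y $ 3"
      using u(1,6,7) four[OF u(2) 2(1) k] four[OF u(3) 2(2) k] by simp_all
    then show ?R using det[OF u(2,3) 2 4] u 2 by auto
  next
    assume ?R
    then obtain k where R: "X $ 1 = 0" "Y $ 1 = 0" "X $ 2 = 0" "Y $ 2 = 0"
      "X $ 4 = k * X $ 3" "Y $ 4 = k * Y $ 3" "det_coeffs X Y 3 5 \<noteq> 0" by blast
    \<comment> \<open>\<open>b\<close> removes the coefficients of order 4; \<open>c\<close> and \<open>e\<close> remove the components of those of order 7
      along the coefficients of order 5 and 3.\<close>
    define b where "b = - k / 3"
    obtain \<alpha> \<beta> where ab: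
      "X $ 7 + X $ 6 * (6 * b) + X $ 5 * (10 * b\<^sup>2) = \<alpha> * X $ 3 + \<beta> * X $ 5"
      "Y $ 7 + Y $ 6 * (6 * b) + Y $ 5 * (10 * b\<^sup>2) = \<alpha> * Y $ 3 + \<beta> * Y $ 5"
      using plane_coordinates[of "X $ 3" "Y $ 5" "X $ 5" "Y $ 3"] R(7) unfolding det_coeffs_def by metis
    define c where "c = - \<beta> / 5"
    define e where "e = - (\<alpha> + 3 * c\<^sup>2 + 3 * b\<^sup>2 * c + k * (12 * b * c + 4 * b ^ 3)) / 3"
    define u where "u = 1 + fps_const b * fps_X + fps_const c * fps_X ^ 2 + fps_const e * fps_X ^ 4"
    have u: "u $ 0 = 1" "u $ 1 = b" "u $ 2 = c" "u $ 3 = 0" "u $ 4 = e"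
      by (simp_all add: u_def fps_X_power_nth)
    have seven: "(A oo fps_X * u) $ 7 = 0"
      if A: "A $ 1 = 0" "A $ 2 = 0" "A $ 4 = k * A $ 3"
        "A $ 7 + A $ 6 * (6 * b) + A $ 5 * (10 * b\<^sup>2) = \<alpha> * A $ 3 + \<beta> * A $ 5" for A :: "real fps"
    proof -
      have \<beta>: "\<beta> = - (5 * c)" by (simp add: c_def)
      have "3 * e = - (\<alpha> + 3 * c\<^sup>2 + 3 * b\<^sup>2 * c + k * (12 * b * c + 4 * b ^ 3))"
        unfolding e_def by simp
      then have \<alpha>: "\<alpha> = - (3 * e + 3 * c\<^sup>2 + 3 * b\<^sup>2 * c + k * (12 * b * c + 4 * b ^ 3))"
        by linarith
      have "(A oo fps_X * u) $ 7 = (A $ 7 + A $ 6 * (6 * b) + A $ 5 * (10 * b\<^sup>2)) + A $ 5 * (5 * c)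
          + A $ 3 * (3 * e + 3 * c\<^sup>2 + 3 * b\<^sup>2 * c + k * (12 * b * c + 4 * b ^ 3))"
        unfolding compose_X_times_7[OF A(1,2) u(1,4)] A(3) u by (simp add: algebra_simps)
      then show ?thesis unfolding A(4) unfolding \<alpha> \<beta> by (simp add: algebra_simps)
    qed
    have k: "3 * u $ 1 = - (k * (u $ 0)^2)" unfolding u by (simp add: b_def)
    show "fps_cusp 3 5 X Y"
      unfolding fps_cusp_alt semigroup_supported_3_5 compose_X_times_low(1)
      using R seven[OF R(1,3,5) ab(1)] seven[OF R(2,4,6) ab(2)] det[OF R(1-6), of u] u(1)
        compose_X_times_low(2)[OF R(1), of u] compose_X_times_low(2)[OF R(2), of u]
        four[OF R(1,3) k] four[OF R(2,4) k]
      by (intro exI[of _ u]) simp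
  qed
qed

section \<open>Formal frontals\<close>

lemma frontal_coeffs:
  fixes X A W U N Z :: "real fps"
  assumes "fps_deriv X = A * W" "fps_deriv W = A * U + N * Z"
  shows "X $ 1 = A $ 0 * W $ 0"
    "2 * X $ 2 = A $ 0 * W $ 1 + A $ 1 * W $ 0"
    "3 * X $ 3 = A $ 0 * W $ 2 + A $ 1 * W $ 1 + A $ 2 * W $ 0"
    "4 * X $ 4 = A $ 0 * W $ 3 + A $ 1 * W $ 2 + A $ 2 * W $ 1 + A $ 3 * W $ 0"
    "5 * X $ 5 = A $ 0 * W $ 4 + A $ 1 * W $ 3 + A $ 2 * W $ 2 + A $ 3 * W $ 1 + A $ 4 * W $ 0"
    "W $ 1 = A $ 0 * U $ 0 + N $ 0 * Z $ 0"
    "2 * W $ 2 = A $ 0 * U $ 1 + A $ 1 * U $ 0 + N $ 0 * Z $ 1 + N $ 1 * Z $ 0"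
    "3 * W $ 3 = A $ 0 * U $ 2 + A $ 1 * U $ 1 + A $ 2 * U $ 0 + N $ 0 * Z $ 2 + N $ 1 * Z $ 1 + N $ 2 * Z $ 0"
proof -
  have X: "of_nat (Suc k) * X $ Suc k = (A * W) $ k" for k
    using arg_cong[OF assms(1), of "\<lambda>F. F $ k"] by simp
  have W: "of_nat (Suc k) * W $ Suc k = (A * U + N * Z) $ k" for k
    using arg_cong[OF assms(2), of "\<lambda>F. F $ k"] by simp
  show "X $ 1 = A $ 0 * W $ 0"
    "2 * X $ 2 = A $ 0 * W $ 1 + A $ 1 * W $ 0"
    "3 * X $ 3 = A $ 0 * W $ 2 + A $ 1 * W $ 1 + A $ 2 * W $ 0"
    "4 * X $ 4 = A $ 0 * W $ 3 + A $ 1 * W $ 2 + A $ 2 * W $ 1 + A $ 3 * W $ 0"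
    "5 * X $ 5 = A $ 0 * W $ 4 + A $ 1 * W $ 3 + A $ 2 * W $ 2 + A $ 3 * W $ 1 + A $ 4 * W $ 0"
    using X[of 0] X[of 1] X[of 2] X[of 3] X[of 4] by (simp_all add: fps_mult_nth eval_nat_numeral)
  show "W $ 1 = A $ 0 * U $ 0 + N $ 0 * Z $ 0"
    "2 * W $ 2 = A $ 0 * U $ 1 + A $ 1 * U $ 0 + N $ 0 * Z $ 1 + N $ 1 * Z $ 0"
    "3 * W $ 3 = A $ 0 * U $ 2 + A $ 1 * U $ 1 + A $ 2 * U $ 0 + N $ 0 * Z $ 2 + N $ 1 * Z $ 1 + N $ 2 * Z $ 0"
    using W[of 0] W[of 1] W[of 2] by (simp_all add: fps_mult_nth eval_nat_numeral)
qed

text \<open>\<open>A\<close> is the scalar factor of the velocity and \<open>(W1, W2)\<close> its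
  direction. \<open>frame\<close> makes \<open>(W1, W2)\<close> and \<open>(Z1, Z2)\<close> a basis
  at the point. \<open>stationary\<close> expresses that the moving frame has zero derivative where
  both scalars vanish; it removes the first-order terms of \<open>U\<close> and \<open>Z\<close>
  from the third-order coefficients of the direction in type (2,5).\<close>

locale planar_frontal =
  fixes X Y A N W1 W2 U1 U2 Z1 Z2 :: "real fps"
  assumes dX: "fps_deriv X = A * W1" and dY: "fps_deriv Y = A * W2"
    and dW1: "fps_deriv W1 = A * U1 + N * Z1" and dW2: "fps_deriv W2 = A * U2 + N * Z2"
    and frame: "W1 $ 0 * Z2 $ 0 - W2 $ 0 * Z1 $ 0 \<noteq> 0"
    and stationary: "A $ 0 = 0 \<Longrightarrow> N $ 0 = 0 \<Longrightarrow> U1 $ 1 = 0 \<and> U2 $ 1 = 0 \<and> Z1 $ 1 = 0 \<and> Z2 $ 1 = 0"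
begin

abbreviation (input) "D \<equiv> W1 $ 0 * Z2 $ 0 - W2 $ 0 * Z1 $ 0"

lemmas x = frontal_coeffs[OF dX dW1]
lemmas y = frontal_coeffs[OF dY dW2]

lemma proportional: "c * W1 $ 0 = 0 \<and> c * W2 $ 0 = 0 \<longleftrightarrow> c = 0"
  using frame by auto

lemma first_order: "X $ 1 = 0 \<and> Y $ 1 = 0 \<longleftrightarrow> A $ 0 = 0"
  using proportional[of "A $ 0"] x(1) y(1) by simp

lemma second_order:
  assumes "A $ 0 = 0"
  shows "X $ 2 = 0 \<and> Y $ 2 = 0 \<longleftrightarrow> A $ 1 = 0"
proof -
  have "X $ 2 = 0 \<longleftrightarrow> A $ 1 * W1 $ 0 = 0" "Y $ 2 = 0 \<longleftrightarrow> A $ 1 * W2 $ 0 = 0"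
    using x(2) y(2) assms by auto
  then show ?thesis using proportional[of "A $ 1"] by simp
qed

lemma cusp_2_3: "fps_cusp 2 3 X Y \<longleftrightarrow> A $ 0 = 0 \<and> A $ 1 \<noteq> 0 \<and> N $ 0 \<noteq> 0"
proof -
  \<comment> \<open>The factor 6 clears denominators. Up to multiples of the direction, three times
    the coefficient of order 3 is \<open>A $ 1 * N $ 0\<close> times the \<open>Z\<close>-vector,
    whence the factor \<open>D\<close>.\<close>
  have "6 * det_coeffs X Y 2 3 = (A $ 1)\<^sup>2 * N $ 0 * D" if "A $ 0 = 0"
  proof -
    have "6 * det_coeffs X Y 2 3 = (2 * X $ 2) * (3 * Y $ 3) - (3 * X $ 3) * (2 * Y $ 2)"
      by (simp add: det_coeffs_def algebra_simps)
    also have "\<dots> = (A $ 1)\<^sup>2 * N $ 0 * D"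
      unfolding x(2,3) y(2,3) x(6) y(6) that by (simp add: algebra_simps power2_eq_square)
    finally show ?thesis .
  qed
  then have "A $ 0 = 0 \<Longrightarrow> det_coeffs X Y 2 3 \<noteq> 0 \<longleftrightarrow> A $ 1 \<noteq> 0 \<and> N $ 0 \<noteq> 0"
    using frame by (metis mult_eq_0_iff power2_eq_square zero_neq_numeral)
  then show ?thesis unfolding fps_cusp_2_3 using first_order by auto
qed

lemma cusp_3_4: "fps_cusp 3 4 X Y \<longleftrightarrow> A $ 0 = 0 \<and> A $ 1 = 0 \<and> A $ 2 \<noteq> 0 \<and> N $ 0 \<noteq> 0"
proof -
  have "12 * det_coeffs X Y 3 4 = (A $ 2)\<^sup>2 * N $ 0 * D" if "A $ 0 = 0" "A $ 1 = 0"
  proof -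
    have "12 * det_coeffs X Y 3 4 = (3 * X $ 3) * (4 * Y $ 4) - (4 * X $ 4) * (3 * Y $ 3)"
      by (simp add: det_coeffs_def algebra_simps)
    also have "\<dots> = (A $ 2)\<^sup>2 * N $ 0 * D"
      unfolding x(3,4) y(3,4) x(6) y(6) that by (simp add: algebra_simps power2_eq_square)
    finally show ?thesis .
  qed
  then have "A $ 0 = 0 \<Longrightarrow> A $ 1 = 0 \<Longrightarrow> det_coeffs X Y 3 4 \<noteq> 0 \<longleftrightarrow> A $ 2 \<noteq> 0 \<and> N $ 0 \<noteq> 0"
    using frame by (metis mult_eq_0_iff power2_eq_square zero_neq_numeral)
  then show ?thesis unfolding fps_cusp_3_4 using first_order second_order by auto
qed

text \<open>The last condition says that the quotient \<open>N / A\<close>, regular because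
  \<open>A $ 1 \<noteq> 0\<close> and \<open>N $ 0 = 0\<close>, has nonzero derivative at the point:
  its linear coefficient is
  \<open>(A $ 1 * N $ 2 - A $ 2 * N $ 1) / (A $ 1)\<^sup>2\<close>.\<close>

lemma cusp_2_5:
  "fps_cusp 2 5 X Y \<longleftrightarrow> A $ 0 = 0 \<and> A $ 1 \<noteq> 0 \<and> N $ 0 = 0 \<and> A $ 1 * N $ 2 - A $ 2 * N $ 1 \<noteq> 0"
  (is "_ \<longleftrightarrow> ?R")
proof -
  have det: "30 * (det_coeffs X Y 2 5 - 2 * k * det_coeffs X Y 2 4) = A $ 1 * (A $ 1 * N $ 2 - A $ 2 * N $ 1) * D"
    if 0: "A $ 0 = 0" "N $ 0 = 0" "3 * k * A $ 1 = 2 * A $ 2" for k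
  proof -
    have W: "W1 $ 1 = 0" "W2 $ 1 = 0" using x(6) y(6) 0 by simp_all
    note s = stationary[OF 0(1,2)]
    have w2: "2 * W1 $ 2 = A $ 1 * U1 $ 0 + N $ 1 * Z1 $ 0" "2 * W2 $ 2 = A $ 1 * U2 $ 0 + N $ 1 * Z2 $ 0"
      using x(7) y(7) 0 by simp_all
    have w3: "3 * W1 $ 3 = A $ 2 * U1 $ 0 + N $ 2 * Z1 $ 0" "3 * W2 $ 3 = A $ 2 * U2 $ 0 + N $ 2 * Z2 $ 0"
      using x(8) y(8) 0 s by simp_all
    have x2: "2 * X $ 2 = A $ 1 * W1 $ 0" "2 * Y $ 2 = A $ 1 * W2 $ 0" using x(2) y(2) 0 by simp_all
    \<comment> \<open>One relation for both coordinates. The terms in \<open>u0\<close> cancel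
      through \<open>3 * k * A $ 1 = 2 * A $ 2\<close>, with weights
      \<open>1 + 3 / 2 - 5 / 2 = 0\<close>.\<close>
    have q: "15 * (V5 - 2 * k * V4) = (3 * A $ 4 - 15 / 2 * k * A $ 3) * w0 + (A $ 1 * N $ 2 - A $ 2 * N $ 1) * z0"
      if "5 * V5 = A $ 1 * w3 + A $ 2 * w2 + A $ 4 * w0" "4 * V4 = A $ 1 * w2 + A $ 3 * w0"
        "2 * w2 = A $ 1 * u0 + N $ 1 * z0" "3 * w3 = A $ 2 * u0 + N $ 2 * z0" for V4 V5 w0 w2 w3 u0 z0
    proof -
      have "15 * (V5 - 2 * k * V4) = 3 * (5 * V5) - 15 / 2 * k * (4 * V4)" by (simp add: algebra_simps)
      also have "\<dots> = A $ 1 * (3 * w3) + 3 / 2 * A $ 2 * (2 * w2) + 3 * A $ 4 * w0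
          - (5 / 4) * (3 * k * A $ 1) * (2 * w2) - 15 / 2 * k * A $ 3 * w0"
        unfolding that(1,2) by (simp add: algebra_simps)
      also have "\<dots> = (3 * A $ 4 - 15 / 2 * k * A $ 3) * w0 + (A $ 1 * N $ 2 - A $ 2 * N $ 1) * z0"
        unfolding that(3,4) 0(3) by (simp add: algebra_simps)
      finally show ?thesis .
    qed
    have qx: "15 * (X $ 5 - 2 * k * X $ 4) = (3 * A $ 4 - 15 / 2 * k * A $ 3) * W1 $ 0 + (A $ 1 * N $ 2 - A $ 2 * N $ 1) * Z1 $ 0"
      by (rule q[OF _ _ w2(1) w3(1)]) (use x(4,5) 0 W in simp_all)
    have qy: "15 * (Y $ 5 - 2 * k * Y $ 4) = (3 * A $ 4 - 15 / 2 * k * A $ 3) * W2 $ 0 + (A $ 1 * N $ 2 - A $ 2 * N $ 1) * Z2 $ 0"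
      by (rule q[OF _ _ w2(2) w3(2)]) (use y(4,5) 0 W in simp_all)
    have "30 * (det_coeffs X Y 2 5 - 2 * k * det_coeffs X Y 2 4)
        = (2 * X $ 2) * (15 * (Y $ 5 - 2 * k * Y $ 4)) - (2 * Y $ 2) * (15 * (X $ 5 - 2 * k * X $ 4))"
      by (simp add: det_coeffs_def algebra_simps)
    also have "\<dots> = A $ 1 * (A $ 1 * N $ 2 - A $ 2 * N $ 1) * D"
      unfolding x2 qx qy by (simp add: algebra_simps)
    finally show ?thesis .
  qed
  show ?thesis
  proof
    assume "fps_cusp 2 5 X Y"
    then obtain k where k: "X $ 1 = 0" "Y $ 1 = 0" "X $ 3 = k * X $ 2" "Y $ 3 = k * Y $ 2"
      "det_coeffs X Y 2 5 - 2 * k * det_coeffs X Y 2 4 \<noteq> 0"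
      unfolding fps_cusp_2_5 by blast
    have a0: "A $ 0 = 0" using first_order k by simp
    have a1: "A $ 1 \<noteq> 0"
    proof
      assume "A $ 1 = 0"
      then have "X $ 2 = 0" "Y $ 2 = 0" using second_order[OF a0] by simp_all
      then show False using k(5) by (simp add: det_coeffs_def)
    qed
    \<comment> \<open>The proportionality of orders 3 and 2 written in terms of \<open>W\<close> and
      \<open>Z\<close>. Eliminating \<open>W\<close> between the two coordinates leaves
      \<open>A $ 1 * N $ 0 * D = 0\<close>.\<close>
    have c3: "2 * (A $ 1 * (N $ 0 * Z1 $ 0) + A $ 2 * W1 $ 0) = 3 * k * (A $ 1 * W1 $ 0)"
      "2 * (A $ 1 * (N $ 0 * Z2 $ 0) + A $ 2 * W2 $ 0) = 3 * k * (A $ 1 * W2 $ 0)"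
    proof -
      have e: "2 * (3 * X $ 3) = 3 * k * (2 * X $ 2)" "2 * (3 * Y $ 3) = 3 * k * (2 * Y $ 2)"
        using k(3,4) by simp_all
      show "2 * (A $ 1 * (N $ 0 * Z1 $ 0) + A $ 2 * W1 $ 0) = 3 * k * (A $ 1 * W1 $ 0)"
        using e(1)[unfolded x(2,3) x(6) a0] by simp
      show "2 * (A $ 1 * (N $ 0 * Z2 $ 0) + A $ 2 * W2 $ 0) = 3 * k * (A $ 1 * W2 $ 0)"
        using e(2)[unfolded y(2,3) y(6) a0] by simp
    qed
    then have "2 * (A $ 1 * N $ 0 * D) = 0"
      by algebra
    then have n0: "N $ 0 = 0" using a1 frame by simp
    have "(3 * k * A $ 1 - 2 * A $ 2) * W1 $ 0 = 0" "(3 * k * A $ 1 - 2 * A $ 2) * W2 $ 0 = 0"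
      using c3 n0 by (auto simp: algebra_simps)
    then have "3 * k * A $ 1 = 2 * A $ 2"
      using proportional[of "3 * k * A $ 1 - 2 * A $ 2"] by simp
    from det[OF a0 n0 this] k(5) a0 a1 n0 show ?R by auto
  next
    assume R: ?R
    \<comment> \<open>When \<open>N $ 0 = 0\<close>, the vectors of order 2 and 3 are
      \<open>A $ 1 / 2\<close> and \<open>A $ 2 / 3\<close> times the same direction;
      \<open>k\<close> is the ratio.\<close>
    define k where "k = 2 * A $ 2 / (3 * A $ 1)"
    have k: "3 * k * A $ 1 = 2 * A $ 2" using R by (simp add: k_def)
    have "3 * (2 * X $ 3) = 3 * (2 * (k * X $ 2))" "3 * (2 * Y $ 3) = 3 * (2 * (k * Y $ 2))"
    proof -
      have "3 * (2 * X $ 3) = 2 * A $ 2 * W1 $ 0" "3 * (2 * Y $ 3) = 2 * A $ 2 * W2 $ 0"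
        using x(3,6) y(3,6) R by simp_all
      moreover have "3 * (2 * (k * X $ 2)) = 3 * k * A $ 1 * W1 $ 0" "3 * (2 * (k * Y $ 2)) = 3 * k * A $ 1 * W2 $ 0"
        using x(2) y(2) R by simp_all
      ultimately show "3 * (2 * X $ 3) = 3 * (2 * (k * X $ 2))" "3 * (2 * Y $ 3) = 3 * (2 * (k * Y $ 2))"
        unfolding k by simp_all
    qed
    then have "X $ 3 = k * X $ 2" "Y $ 3 = k * Y $ 2" by simp_all
    moreover have "det_coeffs X Y 2 5 - 2 * k * det_coeffs X Y 2 4 \<noteq> 0"
      using det[OF _ _ k] R frame by auto
    ultimately show "fps_cusp 2 5 X Y"
      unfolding fps_cusp_2_5 using first_order R by blast
  qed
qed

text \<open>With \<open>A $ 0 = A $ 1 = N $ 0 = 0\<close> the direction is constant to first order.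
  Its second-order term, \<open>N $ 1 / 2\<close> times the \<open>Z\<close>-vector, is the first to
  leave the line of the direction, and enters the curve in order 5 with the factor
  \<open>A $ 2\<close>.\<close>

lemma cusp_3_5:
  "fps_cusp 3 5 X Y \<longleftrightarrow> A $ 0 = 0 \<and> A $ 1 = 0 \<and> A $ 2 \<noteq> 0 \<and> N $ 0 = 0 \<and> N $ 1 \<noteq> 0"
  (is "_ \<longleftrightarrow> ?R")
proof -
  have det: "30 * det_coeffs X Y 3 5 = (A $ 2)\<^sup>2 * N $ 1 * D" if 0: "A $ 0 = 0" "A $ 1 = 0" "N $ 0 = 0"
  proof -
    have W: "W1 $ 1 = 0" "W2 $ 1 = 0" using x(6) y(6) 0 by simp_all
    have w2: "2 * W1 $ 2 = N $ 1 * Z1 $ 0" "2 * W2 $ 2 = N $ 1 * Z2 $ 0"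
      using x(7) y(7) 0 by simp_all
    have "30 * det_coeffs X Y 3 5 = 2 * ((3 * X $ 3) * (5 * Y $ 5) - (5 * X $ 5) * (3 * Y $ 3))"
      by (simp add: det_coeffs_def algebra_simps)
    also have "\<dots> = (A $ 2)\<^sup>2 * (W1 $ 0 * (2 * W2 $ 2) - W2 $ 0 * (2 * W1 $ 2))"
      unfolding x(3,5) y(3,5) W 0 by (simp add: algebra_simps power2_eq_square)
    also have "\<dots> = (A $ 2)\<^sup>2 * N $ 1 * D"
      unfolding w2 by (simp add: algebra_simps)
    finally show ?thesis .
  qed
  show ?thesis
  proof
    assume "fps_cusp 3 5 X Y"
    then obtain k where k: "X $ 1 = 0" "Y $ 1 = 0" "X $ 2 = 0" "Y $ 2 = 0"
      "X $ 4 = k * X $ 3" "Y $ 4 = k * Y $ 3" "det_coeffs X Y 3 5 \<noteq> 0"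
      unfolding fps_cusp_3_5 by blast
    have a: "A $ 0 = 0" "A $ 1 = 0" using first_order second_order k by simp_all
    have a2: "A $ 2 \<noteq> 0"
    proof
      assume "A $ 2 = 0"
      then have "X $ 3 = 0" "Y $ 3 = 0" using x(3) y(3) a by simp_all
      then show False using k(7) by (simp add: det_coeffs_def)
    qed
    have e: "3 * (4 * X $ 4) = 4 * k * (3 * X $ 3)" "3 * (4 * Y $ 4) = 4 * k * (3 * Y $ 3)"
      using k(5,6) by simp_all
    have "3 * (A $ 2 * (N $ 0 * Z1 $ 0) + A $ 3 * W1 $ 0) = 4 * k * (A $ 2 * W1 $ 0)"
      using e(1)[unfolded x(3,4) x(6) a] by simp
    moreover have "3 * (A $ 2 * (N $ 0 * Z2 $ 0) + A $ 3 * W2 $ 0) = 4 * k * (A $ 2 * W2 $ 0)"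
      using e(2)[unfolded y(3,4) y(6) a] by simp
    ultimately have "3 * (A $ 2 * N $ 0 * D) = 0"
      by algebra
    then have "N $ 0 = 0" using a2 frame by simp
    with det[OF a] k(7) a a2 show ?R by auto
  next
    assume R: ?R
    define k where "k = 3 * A $ 3 / (4 * A $ 2)"
    have k: "4 * k * A $ 2 = 3 * A $ 3" using R by (simp add: k_def)
    have "12 * X $ 4 = 3 * A $ 3 * W1 $ 0" "12 * Y $ 4 = 3 * A $ 3 * W2 $ 0"
      using x(4,6) y(4,6) R by simp_all
    moreover have "12 * (k * X $ 3) = 4 * k * A $ 2 * W1 $ 0" "12 * (k * Y $ 3) = 4 * k * A $ 2 * W2 $ 0"
      using x(3,6) y(3,6) R by simp_all
    ultimately have "X $ 4 = k * X $ 3" "Y $ 4 = k * Y $ 3" unfolding k by simp_all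
    moreover have "X $ 1 = 0" "Y $ 1 = 0" "X $ 2 = 0" "Y $ 2 = 0"
      using first_order second_order R by simp_all
    moreover have "det_coeffs X Y 3 5 \<noteq> 0" using det R frame by auto
    ultimately show "fps_cusp 3 5 X Y"
      unfolding fps_cusp_3_5 by blast
  qed
qed

end

text \<open>\<open>\<Phi>\<close> is the factor of the hyperbolic evolute and
  \<open>B = (1 - F\<^sup>2) \<Phi> - \<epsilon> K N\<close>, with \<open>K = F\<^sup>2 / 2\<close>,
  that of the horocyclic one. As \<open>1 - F\<^sup>2\<close> has nonzero constant term, only
  \<open>K N\<close> can disturb the comparison. If \<open>N $ 0 \<noteq> 0\<close>, then
  \<open>F $ 0 * N $ 0 = 0\<close> gives \<open>F $ 0 = K $ 0 = 0\<close>; if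
  \<open>N $ 0 = 0\<close>, the linear coefficient of \<open>F * N\<close> gives
  \<open>K $ 0 * N $ 1 = 0\<close>.\<close>

lemma factor_coeffs:
  fixes F \<Phi> K N B :: "real fps"
  assumes F: "fps_deriv F = (1 - F * F) * \<Phi>" and K: "fps_deriv K = F * fps_deriv F" "2 * K $ 0 = (F $ 0)\<^sup>2"
    and B: "B = fps_deriv F - fps_const \<epsilon> * (K * N)" and \<kappa>: "(F $ 0)\<^sup>2 < 1"
  shows "F $ 0 * N $ 0 = 0 \<Longrightarrow> B $ 0 = 0 \<longleftrightarrow> \<Phi> $ 0 = 0"
    and "F $ 0 * N $ 0 = 0 \<Longrightarrow> N $ 0 \<noteq> 0 \<Longrightarrow> \<Phi> $ 0 = 0 \<Longrightarrow> B $ 1 = 0 \<longleftrightarrow> \<Phi> $ 1 = 0"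
    and "F $ 0 * N $ 0 = 0 \<Longrightarrow> N $ 0 \<noteq> 0 \<Longrightarrow> \<Phi> $ 0 = 0 \<Longrightarrow> \<Phi> $ 1 = 0 \<Longrightarrow> B $ 2 = 0 \<longleftrightarrow> \<Phi> $ 2 = 0"
    and "(F * N) $ 1 = 0 \<Longrightarrow> N $ 0 = 0 \<Longrightarrow> \<Phi> $ 0 = 0 \<Longrightarrow> B $ 1 = 0 \<longleftrightarrow> \<Phi> $ 1 = 0"
    and "(F * N) $ 1 = 0 \<Longrightarrow> N $ 0 = 0 \<Longrightarrow> \<Phi> $ 0 = 0 \<Longrightarrow>
      B $ 1 * N $ 2 - B $ 2 * N $ 1 = 0 \<longleftrightarrow> \<Phi> $ 1 * N $ 2 - \<Phi> $ 2 * N $ 1 = 0"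
    and "(F * N) $ 1 = 0 \<Longrightarrow> N $ 0 = 0 \<Longrightarrow> N $ 1 \<noteq> 0 \<Longrightarrow> \<Phi> $ 0 = 0 \<Longrightarrow> \<Phi> $ 1 = 0 \<Longrightarrow> B $ 2 = 0 \<longleftrightarrow> \<Phi> $ 2 = 0"
proof -
  define k where "k = 1 - (F $ 0)\<^sup>2"
  have k: "k \<noteq> 0" using \<kappa> by (simp add: k_def)
  have f1: "F $ 1 = k * \<Phi> $ 0"
    using arg_cong[OF F, of "\<lambda>G. G $ 0"] by (simp add: k_def power2_eq_square)
  have f2: "2 * F $ 2 = k * \<Phi> $ 1 - 2 * F $ 0 * F $ 1 * \<Phi> $ 0"
    using arg_cong[OF F, of "\<lambda>G. G $ 1"] by (simp add: k_def power2_eq_square eval_nat_numeral algebra_simps)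
  have k1: "K $ 1 = F $ 0 * F $ 1"
    using arg_cong[OF K(1), of "\<lambda>G. G $ 0"] by simp
  have k2: "2 * K $ 2 = 2 * F $ 0 * F $ 2 + (F $ 1)\<^sup>2"
    using arg_cong[OF K(1), of "\<lambda>G. G $ 1"] by (simp add: power2_eq_square eval_nat_numeral)
  have b0: "B $ 0 = k * \<Phi> $ 0 - \<epsilon> * (K $ 0 * N $ 0)"
    unfolding B F by (simp add: k_def power2_eq_square)
  have b1: "B $ 1 = k * \<Phi> $ 1 - 2 * F $ 0 * F $ 1 * \<Phi> $ 0 - \<epsilon> * (K $ 0 * N $ 1 + K $ 1 * N $ 0)"
    unfolding B F by (simp add: k_def power2_eq_square algebra_simps)
  have b2: "B $ 2 = k * \<Phi> $ 2 - 2 * F $ 0 * F $ 1 * \<Phi> $ 1 - (2 * F $ 0 * F $ 2 + (F $ 1)\<^sup>2) * \<Phi> $ 0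
      - \<epsilon> * (K $ 0 * N $ 2 + K $ 1 * N $ 1 + K $ 2 * N $ 0)"
    unfolding B F by (simp add: k_def power2_eq_square algebra_simps eval_nat_numeral fps_mult_nth)
  have kn: "K $ 0 * c = 0" if "F $ 0 * c = 0" for c
  proof -
    have "2 * (K $ 0 * c) = (2 * K $ 0) * c" by simp
    also have "\<dots> = 0" unfolding K(2) using that by (simp add: power2_eq_square)
    finally show ?thesis by simp
  qed
  show "B $ 0 = 0 \<longleftrightarrow> \<Phi> $ 0 = 0" if "F $ 0 * N $ 0 = 0"
    using b0 kn[OF that] k by simp
  show "B $ 1 = 0 \<longleftrightarrow> \<Phi> $ 1 = 0" if "F $ 0 * N $ 0 = 0" "N $ 0 \<noteq> 0" "\<Phi> $ 0 = 0"
  proof -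
    have "F $ 0 = 0" "K $ 0 = 0" using that kn[of 1] by simp_all
    then show ?thesis using b1 k1 f1 that k by simp
  qed
  show "B $ 2 = 0 \<longleftrightarrow> \<Phi> $ 2 = 0" if "F $ 0 * N $ 0 = 0" "N $ 0 \<noteq> 0" "\<Phi> $ 0 = 0" "\<Phi> $ 1 = 0"
  proof -
    have "F $ 0 = 0" "K $ 0 = 0" using that kn[of 1] by simp_all
    moreover have "F $ 1 = 0" using f1 that by simp
    moreover have "K $ 2 = 0" using k2 calculation by simp
    ultimately show ?thesis using b2 k1 that k by simp
  qed
  have stat: "F $ 1 = 0" "K $ 1 = 0" "F $ 0 * N $ 1 = 0" "K $ 0 * N $ 1 = 0" "B $ 1 = k * \<Phi> $ 1"
    "B $ 2 = k * \<Phi> $ 2 - \<epsilon> * (K $ 0 * N $ 2)"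
    if "(F * N) $ 1 = 0" "N $ 0 = 0" "\<Phi> $ 0 = 0"
  proof -
    show f1': "F $ 1 = 0" using f1 that by simp
    show k1': "K $ 1 = 0" using k1 f1' by simp
    show fn: "F $ 0 * N $ 1 = 0" using that f1' by simp
    show kn': "K $ 0 * N $ 1 = 0" by (rule kn[OF fn])
    show "B $ 1 = k * \<Phi> $ 1" using b1 that f1' k1' kn' by simp
    show "B $ 2 = k * \<Phi> $ 2 - \<epsilon> * (K $ 0 * N $ 2)" using b2 that f1' k1' by simp
  qed
  show "B $ 1 = 0 \<longleftrightarrow> \<Phi> $ 1 = 0" if "(F * N) $ 1 = 0" "N $ 0 = 0" "\<Phi> $ 0 = 0"
    using stat(5)[OF that] k by simp
  show "B $ 1 * N $ 2 - B $ 2 * N $ 1 = 0 \<longleftrightarrow> \<Phi> $ 1 * N $ 2 - \<Phi> $ 2 * N $ 1 = 0"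
    if "(F * N) $ 1 = 0" "N $ 0 = 0" "\<Phi> $ 0 = 0"
  proof -
    \<comment> \<open>The term \<open>K $ 0 * N $ 2\<close> that survives in \<open>B $ 2\<close>
      appears here multiplied by \<open>N $ 1\<close>, and \<open>K $ 0 * N $ 1 = 0\<close>.\<close>
    have "B $ 1 * N $ 2 - B $ 2 * N $ 1 = k * (\<Phi> $ 1 * N $ 2 - \<Phi> $ 2 * N $ 1) + \<epsilon> * N $ 2 * (K $ 0 * N $ 1)"
      unfolding stat(5,6)[OF that] by (simp add: algebra_simps)
    then show ?thesis unfolding stat(4)[OF that] using k by simp
  qed
  show "B $ 2 = 0 \<longleftrightarrow> \<Phi> $ 2 = 0"
    if "(F * N) $ 1 = 0" "N $ 0 = 0" "N $ 1 \<noteq> 0" "\<Phi> $ 0 = 0" "\<Phi> $ 1 = 0"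
    using stat(4,6)[OF that(1,2,4)] that(3) k by simp
qed

unbundle no fps_syntax
unbundle vec_syntax

section \<open>The evolutes\<close>

lemma Cinf_cosh: "Cinf UNIV (cosh :: real \<Rightarrow> real)" and Cinf_sinh: "Cinf UNIV (sinh :: real \<Rightarrow> real)"
proof -
  have "Cinf UNIV f" if "f = cosh \<or> f = sinh" for f :: "real \<Rightarrow> real"
  proof (rule Cinf_coinduct[where P="\<lambda>f. f = cosh \<or> f = sinh", OF open_UNIV that])
    have "(cosh has_real_derivative sinh x) (at x)" "(sinh has_real_derivative cosh x) (at x)" for x :: real
      using has_field_derivative_cosh[OF DERIV_ident, of x] has_field_derivative_sinh[OF DERIV_ident, of x] by auto
    then show "\<exists>f'. (f' = cosh \<or> f' = sinh) \<and> (\<forall>x\<in>UNIV. (f has_real_derivative f' x) (at x))"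
      if "f = cosh \<or> f = sinh" for f :: "real \<Rightarrow> real"
      using that by blast
  qed
  then show "Cinf UNIV (cosh :: real \<Rightarrow> real)" "Cinf UNIV (sinh :: real \<Rightarrow> real)" by simp_all
qed

text \<open>The alternative \<open>at x within S = bot\<close> is that of an isolated point of
  \<open>S\<close>, where \<open>vector_derivative\<close> is not determined by the
  function.\<close>

lemma smooth_on_has_real_derivative:
  fixes g :: "real \<Rightarrow> real"
  assumes "smooth_on S g" "x \<in> S"
  shows "(g has_real_derivative vector_derivative g (at x within S)) (at x within S) \<or> at x within S = bot"
proof (cases "at x within S = bot")
  case False
  obtain U F where U: "x \<in> U" "Cinf U F" "\<And>y. y \<in> U \<inter> S \<Longrightarrow> F y = g y"
    using assms unfolding smooth_on_iff_Cinf by meson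
  have "(F has_real_derivative deriv F x) (at x within S)"
    by (rule has_field_derivative_at_within[OF Cinf_real_has_derivative(1)[OF U(2,1)]])
  moreover have "eventually (\<lambda>y. F y = g y) (at x within S)"
    using eventually_at_topological Cinf_open[OF U(2)] U(1,3) by blast
  moreover have "F x = g x" using U assms(2) by blast
  ultimately have "(g has_real_derivative deriv F x) (at x within S)"
    using has_field_derivative_cong_eventually by blast
  then show ?thesis
    using vector_derivative_within[OF False] has_real_derivative_iff_has_vector_derivative by metis
qed simp

section \<open>Lorentzian algebra of the frame\<close>

lemma mink_simps:
  "mink (x + y) z = mink x z + mink y z" "mink z (x + y) = mink z x + mink z y"
  "mink (a *\<^sub>R x) z = a * mink x z" "mink z (a *\<^sub>R x) = a * mink z x"
  by (simp_all add: mink_def algebra_simps)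

lemma mink_commute: "mink x y = mink y x"
  by (simp add: mink_def algebra_simps)

lemma wedge_nth:
  "wedge x y $ 1 = - (x$2 * y$3 - x$3 * y$2)" "wedge x y $ 2 = x$3 * y$1 - x$1 * y$3"
  "wedge x y $ 3 = x$1 * y$2 - x$2 * y$1"
  by (simp_all add: wedge_def)

lemma mink_wedge_wedge: "mink (wedge x y) (wedge x y) = (mink x y)\<^sup>2 - mink x x * mink y y"
  by (simp add: mink_def wedge_nth power2_eq_square algebra_simps)

lemma mink_wedge [simp]: "mink x (wedge x y) = 0" "mink y (wedge x y) = 0"
  "mink (wedge x y) x = 0" "mink (wedge x y) y = 0"
  by (simp_all add: mink_def wedge_nth algebra_simps)

text \<open>In the chart the minors of a pseudo-orthonormal frame are first coordinates of frame
  vectors. Independence of two tangent vectors in the chart thereby reduces to a nonzero first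
  coordinate of the base point, which holds throughout \<open>H2\<close>.\<close>

lemma wedge_frame:
  assumes "mink x x = -1" "mink y y = 1" "mink x y = 0"
  shows "x $ 2 * wedge x y $ 3 - x $ 3 * wedge x y $ 2 = y $ 1"
    and "y $ 2 * wedge x y $ 3 - y $ 3 * wedge x y $ 2 = x $ 1"
proof -
  have 1: "x$2 * x$2 + x$3 * x$3 = x$1 * x$1 - 1" "y$2 * y$2 + y$3 * y$3 = 1 + y$1 * y$1"
    "x$2 * y$2 + x$3 * y$3 = x$1 * y$1"
    using assms by (simp_all add: mink_def)
  have "x $ 2 * wedge x y $ 3 - x $ 3 * wedge x y $ 2
      = x$1 * (x$2 * y$2 + x$3 * y$3) - y$1 * (x$2 * x$2 + x$3 * x$3)"
    by (simp add: wedge_nth algebra_simps)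
  also have "\<dots> = y $ 1" unfolding 1 by (simp add: algebra_simps)
  finally show "x $ 2 * wedge x y $ 3 - x $ 3 * wedge x y $ 2 = y $ 1" .
  have "y $ 2 * wedge x y $ 3 - y $ 3 * wedge x y $ 2
      = x$1 * (y$2 * y$2 + y$3 * y$3) - y$1 * (x$2 * y$2 + x$3 * y$3)"
    by (simp add: wedge_nth algebra_simps)
  also have "\<dots> = x $ 1" unfolding 1 by (simp add: algebra_simps)
  finally show "y $ 2 * wedge x y $ 3 - y $ 3 * wedge x y $ 2 = x $ 1" .
qed

lemma H2_nth_1_nonzero: "x \<in> H2 \<Longrightarrow> x $ 1 \<noteq> 0"
  by (rule H2_sheet_sign) auto

lemma is_cusp_iff_fps_cusp:
  assumes "c ` I \<subseteq> H2" "continuous_on I c"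
    and "Cinf (interior I) (\<lambda>t. c t $ 2)" "Cinf (interior I) (\<lambda>t. c t $ 3)"
    and ij: "i = 2 \<or> i = 3" "i < j" "coprime i j"
  shows "is_cusp i j I c t0 \<longleftrightarrow>
    t0 \<in> interior I \<and> fps_cusp i j (taylor t0 (\<lambda>t. c t $ 2)) (taylor t0 (\<lambda>t. c t $ 3))"
proof -
  have pos: "0 < i" "0 < j" using ij by auto
  show ?thesis
    using is_cusp_imp_planar_cusp[OF assms(1) pos] planar_cusp_imp_is_cusp[OF assms(1,2) _ pos]
      planar_cusp_iff_fps_cusp[OF assms(3,4) _ ij] by blast
qed

section \<open>Evolutes along a nondegenerate interval\<close>

locale legendre_evolutes =
  fixes I :: "real set" and \<gamma> \<gamma>d :: "real \<Rightarrow> real^3" and m n f \<phi> :: "real \<Rightarrow> real"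
  assumes interval: "is_interval I" "interior I \<noteq> {}"
    and legendre: "spacelike_legendre_curve I \<gamma> \<gamma>d"
    and curvature: "is_curvature I \<gamma> \<gamma>d m n"
    and dense: "I \<subseteq> closure {t \<in> I. n t \<noteq> 0}"
    and f_smooth: "smooth_on I f"
    and \<phi>_smooth: "smooth_on I \<phi>"
    and f_eq: "\<And>t. t \<in> I \<Longrightarrow> m t + f t * n t = 0"
    and \<phi>_eq: "\<And>t. t \<in> I \<Longrightarrow> m t * cosh (\<phi> t) + n t * sinh (\<phi> t) = 0"
begin

abbreviation s where "s \<equiv> gamma_s \<gamma> \<gamma>d"
abbreviation HE where "HE \<equiv> hyperbolic_evolute \<gamma> \<gamma>d \<phi>"
abbreviation HEpm where "HEpm \<epsilon> \<equiv> horocyclic_evolute \<epsilon> \<gamma> \<gamma>d f"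

lemma frame:
  assumes "t \<in> I"
  shows "mink (\<gamma> t) (\<gamma> t) = -1" "mink (\<gamma>d t) (\<gamma>d t) = 1" "mink (s t) (s t) = 1"
    "mink (\<gamma> t) (\<gamma>d t) = 0" "mink (\<gamma>d t) (\<gamma> t) = 0" "mink (\<gamma> t) (s t) = 0" "mink (s t) (\<gamma> t) = 0"
    "mink (\<gamma>d t) (s t) = 0" "mink (s t) (\<gamma>d t) = 0"
proof -
  show *: "mink (\<gamma> t) (\<gamma> t) = -1" "mink (\<gamma>d t) (\<gamma>d t) = 1" "mink (\<gamma> t) (\<gamma>d t) = 0"
    using legendre assms by (auto simp: spacelike_legendre_curve_def Delta1_def H2_def S21_def)
  show "mink (s t) (s t) = 1" using * by (simp add: gamma_s_def mink_wedge_wedge)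
  show "mink (\<gamma>d t) (\<gamma> t) = 0" using * by (simp add: mink_commute)
qed (simp_all add: gamma_s_def)

lemma continuous_f: "continuous_on I f" and continuous_\<phi>: "continuous_on I \<phi>"
proof -
  have "continuous_on I g" if "smooth_on I g" for g :: "real \<Rightarrow> real"
    unfolding continuous_on_eq_continuous_within
  proof
    fix x assume "x \<in> I"
    then show "continuous (at x within I) g"
      using smooth_on_has_real_derivative[OF that \<open>x \<in> I\<close>] DERIV_continuous by (auto simp: continuous_def)
  qed
  then show "continuous_on I f" "continuous_on I \<phi>" using f_smooth \<phi>_smooth by auto
qed

text \<open>At a zero of \<open>n\<close> also \<open>m\<close> vanishes and the two equations say
  nothing about \<open>f\<close> and \<open>\<phi>\<close>. The identity is derived where
  \<open>n \<noteq> 0\<close> and extended by continuity and density.\<close>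

lemma f_tanh:
  assumes "t \<in> I"
  shows "f t = tanh (\<phi> t)"
proof -
  let ?g = "\<lambda>t. f t * cosh (\<phi> t) - sinh (\<phi> t)"
  have "continuous_on I ?g"
    by (intro continuous_intros continuous_f continuous_\<phi>)
  then have "closedin (top_of_set I) {t \<in> I. ?g t = 0}"
    by (rule continuous_closedin_preimage_constant)
  then obtain C where C: "closed C" "{t \<in> I. ?g t = 0} = I \<inter> C"
    by (auto simp: closedin_closed)
  have "{t \<in> I. n t \<noteq> 0} \<subseteq> {t \<in> I. ?g t = 0}"
  proof clarify
    fix t assume t: "t \<in> I" "n t \<noteq> 0"
    have "m t = - (f t * n t)" using f_eq[OF t(1)] by simp
    then have "n t * ?g t = 0" using \<phi>_eq[OF t(1)] by (auto simp: algebra_simps)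
    then show "?g t = 0" using t(2) by simp
  qed
  then have "closure {t \<in> I. n t \<noteq> 0} \<subseteq> C"
    using C by (intro closure_minimal) auto
  then have "?g t = 0" using dense assms C by blast
  then show ?thesis by (simp add: tanh_def field_simps)
qed

lemma f_square_less_1: "t \<in> I \<Longrightarrow> (f t)\<^sup>2 < 1"
  using tanh_real_lt_1[of "\<phi> t"] tanh_real_gt_neg1[of "\<phi> t"] by (simp add: f_tanh abs_square_less_1)

text \<open>A nondegenerate interval has no isolated point, so derivatives within \<open>I\<close>
  are unique, at endpoints too.\<close>

lemma nontrivial: "t \<in> I \<Longrightarrow> at t within I \<noteq> bot"
proof -
  assume "t \<in> I"
  moreover have "\<nexists>x. I = {x}"
  proof
    assume "\<exists>x. I = {x}"
    then show False using interval(2) by auto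
  qed
  moreover have "connected I" using interval(1) is_interval_connected by blast
  ultimately have "t islimpt I" using connected_imp_perfect by blast
  then show ?thesis by (simp add: trivial_limit_within)
qed

definition \<phi>' where "\<phi>' t = vector_derivative \<phi> (at t within I)"

lemma \<phi>_derivative: "t \<in> I \<Longrightarrow> (\<phi> has_real_derivative \<phi>' t) (at t within I)"
  unfolding \<phi>'_def using smooth_on_has_real_derivative[OF \<phi>_smooth] nontrivial by blast

lemma f_derivative:
  assumes t: "t \<in> I"
  shows "(f has_real_derivative (1 - (f t)\<^sup>2) * \<phi>' t) (at t within I)"
proof -
  have "((\<lambda>t. tanh (\<phi> t)) has_real_derivative (1 - (tanh (\<phi> t))\<^sup>2) * \<phi>' t) (at t within I)"
    using has_field_derivative_tanh[OF _ \<phi>_derivative[OF t]] by simp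
  then have "((\<lambda>t. tanh (\<phi> t)) has_real_derivative (1 - (f t)\<^sup>2) * \<phi>' t) (at t within I)"
    by (simp add: f_tanh[OF t])
  then show ?thesis
    by (rule has_field_derivative_transform_within[OF _ zero_less_one t]) (simp add: f_tanh)
qed

lemma frame_derivatives:
  assumes "t \<in> I"
  shows "(\<gamma> has_vector_derivative m t *\<^sub>R s t) (at t within I)"
    "(\<gamma>d has_vector_derivative n t *\<^sub>R s t) (at t within I)"
    "(s has_vector_derivative m t *\<^sub>R \<gamma> t - n t *\<^sub>R \<gamma>d t) (at t within I)"
  using curvature assms by (auto simp: is_curvature_def)

lemma m_eq: "t \<in> I \<Longrightarrow> m t = - (f t * n t)"
  using f_eq by fastforce

definition he_direction where "he_direction t = sinh (\<phi> t) *\<^sub>R \<gamma> t + cosh (\<phi> t) *\<^sub>R \<gamma>d t"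

definition hpm_direction where "hpm_direction \<epsilon> t = \<gamma>d t + f t *\<^sub>R (\<gamma> t + \<epsilon> *\<^sub>R s t)"

text \<open>The defining equation of \<open>\<phi>\<close> is the vanishing of the component along
  \<open>s\<close>.\<close>

lemma HE_derivative:
  assumes t: "t \<in> I"
  shows "(HE has_vector_derivative \<phi>' t *\<^sub>R he_direction t) (at t within I)"
proof -
  have c: "((\<lambda>t. cosh (\<phi> t)) has_real_derivative sinh (\<phi> t) * \<phi>' t) (at t within I)"
    and h: "((\<lambda>t. sinh (\<phi> t)) has_real_derivative cosh (\<phi> t) * \<phi>' t) (at t within I)"
    by (auto intro!: derivative_eq_intros \<phi>_derivative[OF t])
  have z: "(m t * cosh (\<phi> t) + n t * sinh (\<phi> t)) * s t $ i = 0" for i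
    using \<phi>_eq[OF t] by simp
  show ?thesis
    unfolding hyperbolic_evolute_def
    by (rule has_vector_derivative_eq_rhs[OF has_vector_derivative_add[OF
          has_vector_derivative_scaleR[OF c frame_derivatives(1)[OF t]]
          has_vector_derivative_scaleR[OF h frame_derivatives(2)[OF t]]]])
       (use z in \<open>auto simp: vec_eq_iff he_direction_def algebra_simps\<close>)
qed

text \<open>With \<open>m = - f n\<close> the terms \<open>m s + f n s\<close> cancel. What remains
  is \<open>f'\<close> times the direction and, because \<open>\<epsilon>\<^sup>2 = 1\<close>,
  \<open>- \<epsilon> f\<^sup>2 n / 2\<close> times the same direction.\<close>

lemma HEpm_derivative:
  assumes t: "t \<in> I" and \<epsilon>: "\<epsilon> = 1 \<or> \<epsilon> = -1"
  shows "(HEpm \<epsilon> has_vector_derivative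
    ((1 - (f t)\<^sup>2) * \<phi>' t - \<epsilon> * ((f t)\<^sup>2 / 2 * n t)) *\<^sub>R hpm_direction \<epsilon> t) (at t within I)"
proof -
  let ?f' = "(1 - (f t)\<^sup>2) * \<phi>' t"
  note f' = f_derivative[OF t]
  have q: "((\<lambda>t. (f t)\<^sup>2 / 2) has_real_derivative f t * ?f') (at t within I)"
    by (auto intro!: derivative_eq_intros f')
  have eps: "\<epsilon> * (\<epsilon> * c) = c" for c :: real using \<epsilon> by auto
  have "((\<lambda>t. \<gamma> t + f t *\<^sub>R \<gamma>d t + ((f t)\<^sup>2 / 2) *\<^sub>R (\<gamma> t + \<epsilon> *\<^sub>R s t)) has_vector_derivative
     m t *\<^sub>R s t + (f t *\<^sub>R n t *\<^sub>R s t + ?f' *\<^sub>R \<gamma>d t) +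
     (((f t)\<^sup>2 / 2) *\<^sub>R (m t *\<^sub>R s t + \<epsilon> *\<^sub>R (m t *\<^sub>R \<gamma> t - n t *\<^sub>R \<gamma>d t)) + (f t * ?f') *\<^sub>R (\<gamma> t + \<epsilon> *\<^sub>R s t))) (at t within I)"
    by (intro has_vector_derivative_add has_vector_derivative_scaleR[OF f'] has_vector_derivative_scaleR[OF q]
        frame_derivatives[OF t] bounded_linear.has_vector_derivative[OF bounded_linear_scaleR_right])
  moreover have "m t *\<^sub>R s t + (f t *\<^sub>R n t *\<^sub>R s t + F' *\<^sub>R \<gamma>d t) +
     (K *\<^sub>R (m t *\<^sub>R s t + \<epsilon> *\<^sub>R (m t *\<^sub>R \<gamma> t - n t *\<^sub>R \<gamma>d t)) + (f t * F') *\<^sub>R (\<gamma> t + \<epsilon> *\<^sub>R s t))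
     = (F' - \<epsilon> * (K * n t)) *\<^sub>R hpm_direction \<epsilon> t" for F' K
    unfolding m_eq[OF t] hpm_direction_def
    by (simp add: vec_eq_iff algebra_simps eps)
  ultimately show ?thesis
    unfolding horocyclic_evolute_def by simp
qed

lemma he_direction_nonzero: "t \<in> I \<Longrightarrow> he_direction t \<noteq> 0"
proof
  assume t: "t \<in> I" and "he_direction t = 0"
  then have "mink (he_direction t) (he_direction t) = 0" by (simp add: mink_def)
  moreover have "mink (he_direction t) (he_direction t) = (cosh (\<phi> t))\<^sup>2 - (sinh (\<phi> t))\<^sup>2"
    by (simp add: he_direction_def mink_simps frame[OF t] power2_eq_square)
  ultimately show False by (simp add: cosh_square_eq)
qed

lemma hpm_direction_nonzero: "t \<in> I \<Longrightarrow> \<epsilon> = 1 \<or> \<epsilon> = -1 \<Longrightarrow> hpm_direction \<epsilon> t \<noteq> 0"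
proof
  assume t: "t \<in> I" and \<epsilon>: "\<epsilon> = 1 \<or> \<epsilon> = -1" and "hpm_direction \<epsilon> t = 0"
  then have "mink (hpm_direction \<epsilon> t) (hpm_direction \<epsilon> t) = 0" by (simp add: mink_def)
  moreover have "mink (hpm_direction \<epsilon> t) (hpm_direction \<epsilon> t) = 1"
    using \<epsilon> by (auto simp: hpm_direction_def mink_simps frame[OF t])
  ultimately show False by simp
qed

lemma singular_HE: "t \<in> I \<Longrightarrow> singular_point I HE t \<longleftrightarrow> \<phi>' t = 0"
  unfolding singular_point_def
  using vector_derivative_within[OF nontrivial HE_derivative] he_direction_nonzero by simp

lemma singular_HEpm:
  "t \<in> I \<Longrightarrow> \<epsilon> = 1 \<or> \<epsilon> = -1 \<Longrightarrow>
    singular_point I (HEpm \<epsilon>) t \<longleftrightarrow> (1 - (f t)\<^sup>2) * \<phi>' t - \<epsilon> * ((f t)\<^sup>2 / 2 * n t) = 0"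
  unfolding singular_point_def
  using vector_derivative_within[OF nontrivial HEpm_derivative] hpm_direction_nonzero by simp

lemma HE_in_H2: "HE ` I \<subseteq> H2"
proof
  fix x assume "x \<in> HE ` I"
  then obtain t where t: "t \<in> I" "x = HE t" by blast
  have "mink (HE t) (HE t) = (sinh (\<phi> t))\<^sup>2 - (cosh (\<phi> t))\<^sup>2"
    by (simp add: hyperbolic_evolute_def mink_simps frame[OF t(1)] power2_eq_square)
  then show "x \<in> H2" by (simp add: H2_def t(2) cosh_square_eq)
qed

lemma HEpm_in_H2:
  assumes \<epsilon>: "\<epsilon> = 1 \<or> \<epsilon> = -1"
  shows "HEpm \<epsilon> ` I \<subseteq> H2"
proof
  fix x assume "x \<in> HEpm \<epsilon> ` I"
  then obtain t where t: "t \<in> I" "x = HEpm \<epsilon> t" by blast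
  have "mink (HEpm \<epsilon> t) (HEpm \<epsilon> t) = -1"
    using \<epsilon> by (auto simp: horocyclic_evolute_def mink_simps frame[OF t(1)] power2_eq_square algebra_simps)
  then show "x \<in> H2" by (simp add: H2_def t(2))
qed

lemma continuous_HE: "continuous_on I HE"
  unfolding continuous_on_eq_continuous_within
  using HE_derivative has_vector_derivative_continuous by blast

lemma continuous_HEpm: "\<epsilon> = 1 \<or> \<epsilon> = -1 \<Longrightarrow> continuous_on I (HEpm \<epsilon>)"
  unfolding continuous_on_eq_continuous_within
  using HEpm_derivative has_vector_derivative_continuous by blast

abbreviation J where "J \<equiv> interior I"

lemma J: "open J" "J \<subseteq> I"
  by (simp_all add: interior_subset)

lemma Cinf_basic: "Cinf J (\<lambda>t. \<gamma> t $ k)" "Cinf J (\<lambda>t. \<gamma>d t $ k)" "Cinf J f" "Cinf J \<phi>"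
proof -
  have "smooth_on I \<gamma>" "smooth_on I \<gamma>d" using legendre by (auto simp: spacelike_legendre_curve_def)
  then show "Cinf J (\<lambda>t. \<gamma> t $ k)" "Cinf J (\<lambda>t. \<gamma>d t $ k)"
    using smooth_on_open_imp_Cinf[OF _ J] Cinf_vec_nth by blast+
  show "Cinf J f" "Cinf J \<phi>" using smooth_on_open_imp_Cinf[OF _ J] f_smooth \<phi>_smooth by blast+
qed

lemma Cinf_s: "Cinf J (\<lambda>t. s t $ k)"
proof -
  have "Cinf J (\<lambda>t. s t $ 1)" "Cinf J (\<lambda>t. s t $ 2)" "Cinf J (\<lambda>t. s t $ 3)"
    unfolding gamma_s_def wedge_nth by (intro Cinf_diff Cinf_mult Cinf_minus Cinf_basic)+
  then show ?thesis using exhaust_3[of k] by auto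
qed

lemma component_derivative:
  fixes c :: "real \<Rightarrow> real^3"
  assumes "(c has_vector_derivative v) (at t within I)" "t \<in> J"
  shows "deriv (\<lambda>t. c t $ k) t = v $ k"
proof -
  have "((\<lambda>t. c t $ k) has_vector_derivative v $ k) (at t within I)"
    by (rule bounded_linear.has_vector_derivative[OF bounded_linear_vec_nth assms(1)])
  then show ?thesis
    using assms(2) by (intro DERIV_imp_deriv)
      (simp add: has_real_derivative_iff_has_vector_derivative at_within_interior[OF assms(2)])
qed

text \<open>\<open>is_curvature\<close> only asserts pointwise derivatives. Pairing the velocities
  with the unit vector \<open>s\<close> recovers \<open>m\<close> and \<open>n\<close> from smooth
  data.\<close>

lemma Cinf_curvature: "Cinf J m" "Cinf J n"
proof -
  let ?p = "\<lambda>c t. - (deriv (\<lambda>t. c t $ 1) t * s t $ 1) + deriv (\<lambda>t. c t $ 2) t * s t $ 2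
    + deriv (\<lambda>t. c t $ 3) t * s t $ 3"
  have C: "Cinf J (?p c)" if "\<And>k. Cinf J (\<lambda>t. c t $ k)" for c :: "real \<Rightarrow> real^3"
    by (intro Cinf_add Cinf_minus Cinf_mult Cinf_deriv Cinf_s that)
  have e: "?p c t = a" if "(c has_vector_derivative a *\<^sub>R s t) (at t within I)" "t \<in> J" for c a t
  proof -
    have "?p c t = a * mink (s t) (s t)"
      by (simp only: component_derivative[OF that] vector_scaleR_component mink_def) (simp add: algebra_simps)
    then show ?thesis using frame(3)[of t] that(2) J(2) by auto
  qed
  show "Cinf J m"
    by (rule Cinf_cong[OF C[OF Cinf_basic(1)]], rule e[OF frame_derivatives(1)]) (use J(2) in auto)
  show "Cinf J n"
    by (rule Cinf_cong[OF C[OF Cinf_basic(2)]], rule e[OF frame_derivatives(2)]) (use J(2) in auto)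
qed

end

section \<open>Taylor expansion of the evolutes at an interior point\<close>

locale legendre_evolutes_at = legendre_evolutes +
  fixes t0 assumes t0: "t0 \<in> interior I"
begin

definition "G k = taylor t0 (\<lambda>t. \<gamma> t $ k)"
definition "D k = taylor t0 (\<lambda>t. \<gamma>d t $ k)"
definition "S k = taylor t0 (\<lambda>t. s t $ k)"
definition "M = taylor t0 m"
definition "N = taylor t0 n"
definition "F = taylor t0 f"
definition "P = taylor t0 (deriv \<phi>)"
definition "C = taylor t0 (\<lambda>t. cosh (\<phi> t))"
definition "R = taylor t0 (\<lambda>t. sinh (\<phi> t))"
definition "K = fps_const (1 / 2) * (F * F)"

lemma t0_I: "t0 \<in> I" using t0 interior_subset by blast

lemma taylor_deriv_eq:
  assumes "\<And>t. t \<in> J \<Longrightarrow> deriv g t = h t"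
  shows "fps_deriv (taylor t0 g) = taylor t0 h"
  unfolding fps_deriv_taylor by (rule taylor_cong[OF J(1) t0 assms])

lemma Cinf_hyp: "Cinf J (\<lambda>t. cosh (\<phi> t))" "Cinf J (\<lambda>t. sinh (\<phi> t))"
  by (intro Cinf_compose[OF Cinf_cosh] Cinf_compose[OF Cinf_sinh] Cinf_basic; simp)+

lemma fps_derivs:
  "fps_deriv (G k) = M * S k" "fps_deriv (D k) = N * S k" "fps_deriv (S k) = M * G k - N * D k"
  "fps_deriv C = R * P" "fps_deriv R = C * P" "fps_deriv F = (1 - F * F) * P"
proof -
  have "fps_deriv (G k) = taylor t0 (\<lambda>t. m t * s t $ k)"
    unfolding G_def by (rule taylor_deriv_eq) (use component_derivative frame_derivatives(1) J in fastforce)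
  then show "fps_deriv (G k) = M * S k"
    by (simp add: M_def S_def taylor_mult[OF Cinf_curvature(1) Cinf_s t0])
  have "fps_deriv (D k) = taylor t0 (\<lambda>t. n t * s t $ k)"
    unfolding D_def by (rule taylor_deriv_eq) (use component_derivative frame_derivatives(2) J in fastforce)
  then show "fps_deriv (D k) = N * S k"
    by (simp add: N_def S_def taylor_mult[OF Cinf_curvature(2) Cinf_s t0])
  have "fps_deriv (S k) = taylor t0 (\<lambda>t. m t * \<gamma> t $ k - n t * \<gamma>d t $ k)"
    unfolding S_def by (rule taylor_deriv_eq) (use component_derivative frame_derivatives(3) J in fastforce)
  then show "fps_deriv (S k) = M * G k - N * D k"
    by (simp add: M_def N_def G_def D_def taylor_mult[OF Cinf_curvature(1) Cinf_basic(1) t0]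
        taylor_mult[OF Cinf_curvature(2) Cinf_basic(2) t0]
        taylor_diff[OF Cinf_mult[OF Cinf_curvature(1) Cinf_basic(1)] Cinf_mult[OF Cinf_curvature(2) Cinf_basic(2)] t0])
  note D\<phi> = Cinf_real_has_derivative(1)[OF Cinf_basic(4)]
  have "fps_deriv C = taylor t0 (\<lambda>t. sinh (\<phi> t) * deriv \<phi> t)"
    unfolding C_def by (rule taylor_deriv_eq) (intro DERIV_imp_deriv has_field_derivative_cosh D\<phi>)
  then show "fps_deriv C = R * P"
    by (simp add: R_def P_def taylor_mult[OF Cinf_hyp(2) Cinf_deriv[OF Cinf_basic(4)] t0])
  have "fps_deriv R = taylor t0 (\<lambda>t. cosh (\<phi> t) * deriv \<phi> t)"
    unfolding R_def by (rule taylor_deriv_eq) (intro DERIV_imp_deriv has_field_derivative_sinh D\<phi>)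
  then show "fps_deriv R = C * P"
    by (simp add: C_def P_def taylor_mult[OF Cinf_hyp(1) Cinf_deriv[OF Cinf_basic(4)] t0])
  have "fps_deriv F = taylor t0 (\<lambda>t. (1 - f t * f t) * deriv \<phi> t)"
    unfolding F_def
  proof (rule taylor_deriv_eq)
    fix t assume t: "t \<in> J"
    then have "t \<in> I" using J by blast
    have "(\<phi> has_real_derivative \<phi>' t) (at t)"
      using \<phi>_derivative[OF \<open>t \<in> I\<close>] by (simp add: at_within_interior[OF t])
    then have "deriv \<phi> t = \<phi>' t" by (rule DERIV_imp_deriv)
    moreover have "(f has_real_derivative (1 - (f t)\<^sup>2) * \<phi>' t) (at t)"
      using f_derivative[OF \<open>t \<in> I\<close>] by (simp add: at_within_interior[OF t])
    then have "deriv f t = (1 - (f t)\<^sup>2) * \<phi>' t" by (rule DERIV_imp_deriv)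
    ultimately show "deriv f t = (1 - f t * f t) * deriv \<phi> t" by (simp add: power2_eq_square)
  qed
  also have "\<dots> = taylor t0 (\<lambda>t. 1 - f t * f t) * P"
    unfolding P_def by (intro taylor_mult[OF _ _ t0] Cinf_diff Cinf_const J Cinf_mult Cinf_basic Cinf_deriv)
  also have "taylor t0 (\<lambda>t. 1 - f t * f t) = 1 - F * F"
    using taylor_diff[OF Cinf_const[OF J(1)] Cinf_mult[OF Cinf_basic(3,3)] t0, of 1]
    by (simp add: F_def taylor_mult[OF Cinf_basic(3,3) t0])
  finally show "fps_deriv F = (1 - F * F) * P" .
qed

lemma M_eq: "M = - (F * N)"
proof -
  have "M = taylor t0 (\<lambda>t. - (f t * n t))"
    unfolding M_def by (rule taylor_cong[OF J(1) t0]) (use m_eq J in blast)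
  then show ?thesis
    by (simp add: F_def N_def taylor_minus[OF Cinf_mult[OF Cinf_basic(3) Cinf_curvature(2)] t0]
        taylor_mult[OF Cinf_basic(3) Cinf_curvature(2) t0])
qed

lemma R_eq: "R = F * C"
proof -
  have "R = taylor t0 (\<lambda>t. f t * cosh (\<phi> t))"
    unfolding R_def by (rule taylor_cong[OF J(1) t0]) (use f_tanh J in \<open>auto simp: tanh_def\<close>)
  then show ?thesis by (simp add: F_def C_def taylor_mult[OF Cinf_basic(3) Cinf_hyp(1) t0])
qed

lemma K_deriv: "fps_deriv K = F * fps_deriv F" and K_0: "2 * fps_nth K 0 = (fps_nth F 0)\<^sup>2"
proof -
  have h: "fps_const (1 / 2) * 2 = (1 :: real fps)" by (simp add: numeral_fps_const)
  have "fps_deriv K = (fps_const (1 / 2) * 2) * (F * fps_deriv F)"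
    by (simp add: K_def algebra_simps)
  then show "fps_deriv K = F * fps_deriv F" unfolding h by simp
  show "2 * fps_nth K 0 = (fps_nth F 0)\<^sup>2" by (simp add: K_def power2_eq_square)
qed

lemma Cinf_HE: "Cinf J (\<lambda>t. HE t $ k)"
  unfolding hyperbolic_evolute_def vector_add_component vector_scaleR_component real_scaleR_def
  by (intro Cinf_add Cinf_mult Cinf_hyp Cinf_basic)

lemma taylor_HE: "taylor t0 (\<lambda>t. HE t $ k) = C * G k + R * D k"
  unfolding hyperbolic_evolute_def vector_add_component vector_scaleR_component real_scaleR_def
  by (simp add: taylor_add[OF Cinf_mult[OF Cinf_hyp(1) Cinf_basic(1)] Cinf_mult[OF Cinf_hyp(2) Cinf_basic(2)] t0]
      taylor_mult[OF Cinf_hyp(1) Cinf_basic(1) t0] taylor_mult[OF Cinf_hyp(2) Cinf_basic(2) t0]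
      C_def R_def G_def D_def)

lemma Cinf_HEpm: "Cinf J (\<lambda>t. HEpm \<epsilon> t $ k)"
  unfolding horocyclic_evolute_def vector_add_component vector_scaleR_component real_scaleR_def divide_inverse
  by (intro Cinf_add Cinf_mult Cinf_const Cinf_power Cinf_basic Cinf_s J)

lemma taylor_HEpm: "taylor t0 (\<lambda>t. HEpm \<epsilon> t $ k) = G k + F * D k + K * (G k + fps_const \<epsilon> * S k)"
proof -
  have eq: "HEpm \<epsilon> t $ k = (\<gamma> t $ k + f t * \<gamma>d t $ k) + (1 / 2 * (f t * f t)) * (\<gamma> t $ k + \<epsilon> * s t $ k)" for t
    by (simp add: horocyclic_evolute_def power2_eq_square)
  note 1 = Cinf_mult[OF Cinf_basic(3) Cinf_basic(2)[of k]]
    and 2 = Cinf_mult[OF Cinf_const[OF J(1), of "1 / 2 :: real"] Cinf_mult[OF Cinf_basic(3,3)]]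
    and 3 = Cinf_mult[OF Cinf_const[OF J(1), of \<epsilon>] Cinf_s[of k]]
  show ?thesis
    unfolding eq
    by (simp only: taylor_add[OF Cinf_add[OF Cinf_basic(1) 1] Cinf_mult[OF 2 Cinf_add[OF Cinf_basic(1) 3]] t0]
        taylor_add[OF Cinf_basic(1) 1 t0] taylor_add[OF Cinf_basic(1) 3 t0]
        taylor_mult[OF 2 Cinf_add[OF Cinf_basic(1) 3] t0] taylor_mult[OF Cinf_basic(3) Cinf_basic(2) t0]
        taylor_cmult[OF Cinf_mult[OF Cinf_basic(3,3)] t0] taylor_mult[OF Cinf_basic(3,3) t0]
        taylor_cmult[OF Cinf_s t0] G_def D_def S_def F_def K_def)
qed

lemma nth_0:
  "fps_nth (G k) 0 = \<gamma> t0 $ k" "fps_nth (D k) 0 = \<gamma>d t0 $ k" "fps_nth (S k) 0 = s t0 $ k"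
  "fps_nth C 0 = cosh (\<phi> t0)" "fps_nth R 0 = sinh (\<phi> t0)" "fps_nth F 0 = f t0" "fps_nth N 0 = n t0"
  "fps_nth M 0 = m t0"
  by (simp_all add: G_def D_def S_def C_def R_def F_def N_def M_def)

lemma nth_1: "fps_nth A 1 = fps_nth (fps_deriv A) 0" for A :: "real fps"
  by simp

lemma chart_minors:
  "\<gamma> t0 $ 2 * s t0 $ 3 - \<gamma> t0 $ 3 * s t0 $ 2 = \<gamma>d t0 $ 1"
  "\<gamma>d t0 $ 2 * s t0 $ 3 - \<gamma>d t0 $ 3 * s t0 $ 2 = \<gamma> t0 $ 1"
  "\<gamma> t0 $ 2 * \<gamma>d t0 $ 3 - \<gamma> t0 $ 3 * \<gamma>d t0 $ 2 = - s t0 $ 1"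
  unfolding gamma_s_def
  by (rule wedge_frame[OF frame(1,2,4)[OF t0_I]])+ (simp add: wedge_nth)

text \<open>The derivative of the direction has \<open>s\<close>-component
  \<open>R * M + C * N = N * (C - R * F)\<close>. The factor \<open>C - R * F\<close> is the series
  of \<open>cosh \<phi> - sinh \<phi> tanh \<phi> = 1 / cosh \<phi>\<close>, and the frame
  determinant is its value times the first coordinate of the evolute.\<close>

lemma HE_frontal:
  "planar_frontal (taylor t0 (\<lambda>t. HE t $ 2)) (taylor t0 (\<lambda>t. HE t $ 3)) P N
    (R * G 2 + C * D 2) (R * G 3 + C * D 3) (C * G 2 + R * D 2) (C * G 3 + R * D 3)
    ((C - R * F) * S 2) ((C - R * F) * S 3)"
proof
  have d: "fps_deriv (C * G k + R * D k) = P * (R * G k + C * D k)" for k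
    unfolding fps_deriv_add fps_deriv_mult fps_derivs M_eq R_eq by (simp add: algebra_simps)
  show "fps_deriv (taylor t0 (\<lambda>t. HE t $ 2)) = P * (R * G 2 + C * D 2)"
    "fps_deriv (taylor t0 (\<lambda>t. HE t $ 3)) = P * (R * G 3 + C * D 3)"
    unfolding taylor_HE by (rule d)+
  have "fps_deriv (R * G k + C * D k) = P * (C * G k + R * D k) + N * ((C - R * F) * S k)" for k
    unfolding fps_deriv_add fps_deriv_mult fps_derivs M_eq by (simp add: algebra_simps)
  then show "fps_deriv (R * G 2 + C * D 2) = P * (C * G 2 + R * D 2) + N * ((C - R * F) * S 2)"
    "fps_deriv (R * G 3 + C * D 3) = P * (C * G 3 + R * D 3) + N * ((C - R * F) * S 3)" by blast+
  have "HE t0 $ 1 \<noteq> 0" using H2_nth_1_nonzero HE_in_H2 t0_I by blast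
  moreover have "cosh (\<phi> t0) * (cosh (\<phi> t0) - sinh (\<phi> t0) * f t0) = 1"
    using cosh_square_eq[of "\<phi> t0"] f_tanh[OF t0_I] by (simp add: tanh_def field_simps power2_eq_square)
  then have "cosh (\<phi> t0) - sinh (\<phi> t0) * f t0 \<noteq> 0" by auto
  moreover have "(sinh (\<phi> t0) * \<gamma> t0 $ 2 + cosh (\<phi> t0) * \<gamma>d t0 $ 2) * (c * s t0 $ 3)
      - (sinh (\<phi> t0) * \<gamma> t0 $ 3 + cosh (\<phi> t0) * \<gamma>d t0 $ 3) * (c * s t0 $ 2) = c * HE t0 $ 1" for c
  proof -
    have "(sinh (\<phi> t0) * \<gamma> t0 $ 2 + cosh (\<phi> t0) * \<gamma>d t0 $ 2) * (c * s t0 $ 3)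
      - (sinh (\<phi> t0) * \<gamma> t0 $ 3 + cosh (\<phi> t0) * \<gamma>d t0 $ 3) * (c * s t0 $ 2)
      = c * (sinh (\<phi> t0) * (\<gamma> t0 $ 2 * s t0 $ 3 - \<gamma> t0 $ 3 * s t0 $ 2)
        + cosh (\<phi> t0) * (\<gamma>d t0 $ 2 * s t0 $ 3 - \<gamma>d t0 $ 3 * s t0 $ 2))"
      by (simp add: algebra_simps)
    also have "\<dots> = c * HE t0 $ 1"
      unfolding chart_minors by (simp add: hyperbolic_evolute_def algebra_simps)
    finally show ?thesis .
  qed
  ultimately show "fps_nth (R * G 2 + C * D 2) 0 * fps_nth ((C - R * F) * S 3) 0 -
    fps_nth (R * G 3 + C * D 3) 0 * fps_nth ((C - R * F) * S 2) 0 \<noteq> 0"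
    by (simp add: nth_0)
  assume 0: "fps_nth P 0 = 0" "fps_nth N 0 = 0"
  \<comment> \<open>By \<open>M = - F N\<close> and \<open>F' = (1 - F\<^sup>2) P\<close>, the
    derivatives of all series involved carry a factor \<open>P\<close> or \<open>N\<close>.\<close>
  have *: "fps_nth (fps_deriv (C * G k + R * D k)) 0 = 0 \<and>
      fps_nth (fps_deriv ((C - R * F) * S k)) 0 = 0" for k
    unfolding fps_deriv_add fps_deriv_mult fps_deriv_sub fps_derivs M_eq by (simp add: 0)
  show "fps_nth (C * G 2 + R * D 2) 1 = 0 \<and> fps_nth (C * G 3 + R * D 3) 1 = 0 \<and>
    fps_nth ((C - R * F) * S 2) 1 = 0 \<and> fps_nth ((C - R * F) * S 3) 1 = 0"
    unfolding nth_1 using * by blast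
qed

text \<open>In the derivative of \<open>W\<close> the term \<open>F'\<close> is rewritten as the
  velocity factor plus \<open>E * (K * N)\<close>; this surplus becomes the summand
  \<open>K * (E * G k + S k)\<close> of \<open>Z\<close>. At \<open>t0\<close> the vector
  \<open>Z\<close> is a unit vector orthogonal to \<open>W\<close> and to the evolute.\<close>

lemma HEpm_frontal:
  assumes \<epsilon>: "\<epsilon> = 1 \<or> \<epsilon> = -1"
  defines "E \<equiv> fps_const \<epsilon>"
  defines "W \<equiv> \<lambda>k. D k + F * (G k + E * S k)"
  defines "Z \<equiv> \<lambda>k. S k + K * (E * G k + S k) - F * F * (S k + E * G k) - E * (F * D k)"
  shows "planar_frontal (taylor t0 (\<lambda>t. HEpm \<epsilon> t $ 2)) (taylor t0 (\<lambda>t. HEpm \<epsilon> t $ 3))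
    (fps_deriv F - E * (K * N)) N (W 2) (W 3) (G 2 + E * S 2) (G 3 + E * S 3) (Z 2) (Z 3)"
proof
  have EE: "E = 1 \<or> E = -1" using \<epsilon> by (auto simp: E_def fps_const_neg[symmetric] simp del: fps_const_neg)
  have E': "fps_deriv E = 0" by (simp add: E_def)
  have d: "fps_deriv (G k + F * D k + K * (G k + E * S k)) = (fps_deriv F - E * (K * N)) * W k" for k
    unfolding fps_deriv_add fps_deriv_mult K_deriv fps_derivs(1-3) E' W_def M_eq
    using EE by (auto simp: algebra_simps)
  show "fps_deriv (taylor t0 (\<lambda>t. HEpm \<epsilon> t $ 2)) = (fps_deriv F - E * (K * N)) * W 2"
    "fps_deriv (taylor t0 (\<lambda>t. HEpm \<epsilon> t $ 3)) = (fps_deriv F - E * (K * N)) * W 3"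
    unfolding taylor_HEpm E_def[symmetric] by (rule d)+
  have "fps_deriv (W k) = (fps_deriv F - E * (K * N)) * (G k + E * S k) + N * Z k" for k
    unfolding W_def Z_def fps_deriv_add fps_deriv_mult fps_derivs(1-3) E' M_eq
    using EE by (auto simp: algebra_simps)
  then show "fps_deriv (W 2) = (fps_deriv F - E * (K * N)) * (G 2 + E * S 2) + N * Z 2"
    "fps_deriv (W 3) = (fps_deriv F - E * (K * N)) * (G 3 + E * S 3) + N * Z 3" by blast+
  define c where "c = f t0"
  have K0: "fps_nth K 0 = c\<^sup>2 / 2" using K_0 by (simp add: nth_0 c_def)
  have "HEpm \<epsilon> t0 $ 1 \<noteq> 0" using H2_nth_1_nonzero HEpm_in_H2[OF \<epsilon>] t0_I by blast
  moreover have "fps_nth (W 2) 0 * fps_nth (Z 3) 0 - fps_nth (W 3) 0 * fps_nth (Z 2) 0 = HEpm \<epsilon> t0 $ 1"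
  proof -
    define W' where "W' k = \<gamma>d t0 $ k + c * (\<gamma> t0 $ k + \<epsilon> * s t0 $ k)" for k
    define Z' where "Z' k = (1 - c\<^sup>2 / 2) * s t0 $ k - \<epsilon> * c\<^sup>2 / 2 * \<gamma> t0 $ k - \<epsilon> * c * \<gamma>d t0 $ k" for k
    have W0: "fps_nth (W k) 0 = W' k" and Z0: "fps_nth (Z k) 0 = Z' k" for k
      by (simp_all add: W_def Z_def E_def W'_def Z'_def nth_0 K0 c_def[symmetric] power2_eq_square field_simps)
    \<comment> \<open>Expansion into the three minors of the frame. With
      \<open>\<epsilon>\<^sup>2 = 1\<close> their coefficients reduce to
      \<open>1 + c\<^sup>2 / 2\<close>, \<open>c\<close> and, up to sign,
      \<open>\<epsilon> c\<^sup>2 / 2\<close>, those of the horocyclic evolute.\<close>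
    have "W' 2 * Z' 3 - W' 3 * Z' 2 =
        ((1 - c\<^sup>2 / 2) + \<epsilon> * \<epsilon> * c\<^sup>2) * (\<gamma>d t0 $ 2 * s t0 $ 3 - \<gamma>d t0 $ 3 * s t0 $ 2)
        + (c * (1 - c\<^sup>2 / 2) + \<epsilon> * \<epsilon> * c ^ 3 / 2) * (\<gamma> t0 $ 2 * s t0 $ 3 - \<gamma> t0 $ 3 * s t0 $ 2)
        - (\<epsilon> * c\<^sup>2 / 2) * (\<gamma> t0 $ 2 * \<gamma>d t0 $ 3 - \<gamma> t0 $ 3 * \<gamma>d t0 $ 2)"
      by (simp add: W'_def Z'_def field_simps power2_eq_square power3_eq_cube)
    also have "\<dots> = HEpm \<epsilon> t0 $ 1"
      unfolding chart_minors using \<epsilon>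
      by (auto simp: horocyclic_evolute_def c_def[symmetric] field_simps power2_eq_square power3_eq_cube)
    finally show ?thesis unfolding W0 Z0 .
  qed
  ultimately show "fps_nth (W 2) 0 * fps_nth (Z 3) 0 - fps_nth (W 3) 0 * fps_nth (Z 2) 0 \<noteq> 0" by simp
  assume 0: "fps_nth (fps_deriv F - E * (K * N)) 0 = 0" "fps_nth N 0 = 0"
  \<comment> \<open>Since \<open>K N\<close> vanishes with \<open>N\<close>, the vanishing factor
    leaves \<open>F' = 0\<close> at the point, so every derivative in the frame is zero
    there.\<close>
  have F0: "fps_nth (fps_deriv F) 0 = 0" using 0 by (simp add: fps_sub_nth del: fps_deriv_nth)
  have *: "fps_nth (fps_deriv (G k + E * S k)) 0 = 0 \<and> fps_nth (fps_deriv (Z k)) 0 = 0" for k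
    unfolding Z_def fps_deriv_add fps_deriv_mult fps_deriv_sub K_deriv fps_derivs(1-3) E' M_eq
    by (simp add: 0(2) F0 del: fps_deriv_nth)
  show "fps_nth (G 2 + E * S 2) 1 = 0 \<and> fps_nth (G 3 + E * S 3) 1 = 0 \<and> fps_nth (Z 2) 1 = 0 \<and> fps_nth (Z 3) 1 = 0"
    unfolding nth_1 using * by blast
qed

end

section \<open>Comparison of the two evolutes\<close>

context legendre_evolutes
begin

lemma cusp_HE_iff_HEpm:
  assumes \<epsilon>: "\<epsilon> = 1 \<or> \<epsilon> = -1"
  shows "m t0 = 0 \<Longrightarrow> is_cusp 2 3 I (HEpm \<epsilon>) t0 \<longleftrightarrow> is_cusp 2 3 I HE t0"
    and "m t0 = 0 \<Longrightarrow> is_cusp 3 4 I (HEpm \<epsilon>) t0 \<longleftrightarrow> is_cusp 3 4 I HE t0"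
    and "vector_derivative m (at t0 within I) = 0 \<Longrightarrow> is_cusp 2 5 I (HEpm \<epsilon>) t0 \<longleftrightarrow> is_cusp 2 5 I HE t0"
    and "vector_derivative m (at t0 within I) = 0 \<Longrightarrow> is_cusp 3 5 I (HEpm \<epsilon>) t0 \<longleftrightarrow> is_cusp 3 5 I HE t0"
proof -
  let ?X = "taylor t0 (\<lambda>t. HE t $ 2)" and ?Y = "taylor t0 (\<lambda>t. HE t $ 3)"
  let ?Xp = "taylor t0 (\<lambda>t. HEpm \<epsilon> t $ 2)" and ?Yp = "taylor t0 (\<lambda>t. HEpm \<epsilon> t $ 3)"
  have *: "is_cusp i j I (HEpm \<epsilon>) t0 \<longleftrightarrow> is_cusp i j I HE t0"
    if "i = 2 \<or> i = 3" "i < j" "coprime i j"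
      "t0 \<in> J \<Longrightarrow> fps_cusp i j ?Xp ?Yp \<longleftrightarrow> fps_cusp i j ?X ?Y" for i j
  proof (cases "t0 \<in> J")
    case True
    then interpret legendre_evolutes_at I \<gamma> \<gamma>d m n f \<phi> t0 by unfold_locales
    show ?thesis
      unfolding is_cusp_iff_fps_cusp[OF HE_in_H2 continuous_HE Cinf_HE Cinf_HE that(1-3)]
        is_cusp_iff_fps_cusp[OF HEpm_in_H2[OF \<epsilon>] continuous_HEpm[OF \<epsilon>] Cinf_HEpm Cinf_HEpm that(1-3)]
      using that(4)[OF True] by simp
  next
    case False
    \<comment> \<open>Away from the interior of \<open>I\<close> neither evolute has a cusp.\<close>
    have "0 < i" "0 < j" using that by auto
    then show ?thesis
      using is_cusp_imp_planar_cusp(1)[OF HE_in_H2] is_cusp_imp_planar_cusp(1)[OF HEpm_in_H2[OF \<epsilon>]] False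
      by blast
  qed
  have "(m t0 = 0 \<longrightarrow> fps_cusp 2 3 ?Xp ?Yp = fps_cusp 2 3 ?X ?Y \<and> fps_cusp 3 4 ?Xp ?Yp = fps_cusp 3 4 ?X ?Y) \<and>
     (vector_derivative m (at t0 within I) = 0 \<longrightarrow>
        fps_cusp 2 5 ?Xp ?Yp = fps_cusp 2 5 ?X ?Y \<and> fps_cusp 3 5 ?Xp ?Yp = fps_cusp 3 5 ?X ?Y)"
    if "t0 \<in> J"
  proof -
    interpret legendre_evolutes_at I \<gamma> \<gamma>d m n f \<phi> t0 using that by unfold_locales
    let ?B = "fps_deriv F - fps_const \<epsilon> * (K * N)"
    note he = planar_frontal.cusp_2_3[OF HE_frontal] planar_frontal.cusp_3_4[OF HE_frontal]
      planar_frontal.cusp_2_5[OF HE_frontal] planar_frontal.cusp_3_5[OF HE_frontal]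
    note hpm = planar_frontal.cusp_2_3[OF HEpm_frontal[OF \<epsilon>]] planar_frontal.cusp_3_4[OF HEpm_frontal[OF \<epsilon>]]
      planar_frontal.cusp_2_5[OF HEpm_frontal[OF \<epsilon>]] planar_frontal.cusp_3_5[OF HEpm_frontal[OF \<epsilon>]]
    have "(fps_nth F 0)\<^sup>2 < 1" using f_square_less_1[OF t0_I] by (simp add: nth_0)
    note fc = factor_coeffs[OF fps_derivs(6) K_deriv K_0 refl[of ?B] this]
    show ?thesis
    proof (intro conjI impI)
      assume "m t0 = 0"
      then have z: "fps_nth F 0 * fps_nth N 0 = 0" using m_eq[OF t0_I] by (simp add: nth_0)
      show "fps_cusp 2 3 ?Xp ?Yp = fps_cusp 2 3 ?X ?Y" "fps_cusp 3 4 ?Xp ?Yp = fps_cusp 3 4 ?X ?Y"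
        unfolding he hpm using fc(1-3)[OF z] by blast+
    next
      assume "vector_derivative m (at t0 within I) = 0"
      moreover have "(m has_vector_derivative deriv m t0) (at t0)"
        using Cinf_real_has_derivative(1)[OF Cinf_curvature(1) t0]
        by (simp add: has_real_derivative_iff_has_vector_derivative)
      then have "vector_derivative m (at t0) = deriv m t0" by (rule vector_derivative_at)
      ultimately have "deriv m t0 = 0" by (simp add: at_within_interior[OF t0])
      then have "fps_nth M 1 = 0" by (simp add: M_def taylor_nth_Suc)
      then have z: "fps_nth (F * N) 1 = 0" by (simp add: M_eq)
      \<comment> \<open>The criteria for (2,5) and (3,5) contain \<open>N $ 0 = 0\<close>, which
        supplies the hypothesis for comparing the constant terms of the factors.\<close>
      have z0: "fps_nth F 0 * fps_nth N 0 = 0" if "fps_nth N 0 = 0" using that by simp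
      show "fps_cusp 2 5 ?Xp ?Yp = fps_cusp 2 5 ?X ?Y" "fps_cusp 3 5 ?Xp ?Yp = fps_cusp 3 5 ?X ?Y"
        unfolding he hpm using fc(1)[OF z0] fc(4-6)[OF z] by blast+
    qed
  qed
  note fps = this
  have coprime: "coprime 2 (3::nat)" "coprime 3 (4::nat)" "coprime 2 (5::nat)" "coprime 3 (5::nat)"
    by (simp_all add: coprime_iff_gcd_eq_1 gcd_non_0_nat)
  show "m t0 = 0 \<Longrightarrow> is_cusp 2 3 I (HEpm \<epsilon>) t0 \<longleftrightarrow> is_cusp 2 3 I HE t0"
    by (rule *[OF _ _ coprime(1)]) (use fps in auto)
  show "m t0 = 0 \<Longrightarrow> is_cusp 3 4 I (HEpm \<epsilon>) t0 \<longleftrightarrow> is_cusp 3 4 I HE t0"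
    by (rule *[OF _ _ coprime(2)]) (use fps in auto)
  show "vector_derivative m (at t0 within I) = 0 \<Longrightarrow> is_cusp 2 5 I (HEpm \<epsilon>) t0 \<longleftrightarrow> is_cusp 2 5 I HE t0"
    by (rule *[OF _ _ coprime(3)]) (use fps in auto)
  show "vector_derivative m (at t0 within I) = 0 \<Longrightarrow> is_cusp 3 5 I (HEpm \<epsilon>) t0 \<longleftrightarrow> is_cusp 3 5 I HE t0"
    by (rule *[OF _ _ coprime(4)]) (use fps in auto)
qed

text \<open>If \<open>m = 0\<close>, then \<open>f n = 0\<close>, the extra term vanishes and
  \<open>1 - f\<^sup>2 > 0\<close> decides. If both factors vanish, then
  \<open>f\<^sup>2 n = 0\<close>, hence \<open>m = - f n = 0\<close>.\<close>

lemma singular_HE_iff_HEpm: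
  assumes "t0 \<in> I" "\<epsilon> = 1 \<or> \<epsilon> = -1"
  shows "m t0 = 0 \<Longrightarrow> singular_point I (HEpm \<epsilon>) t0 \<longleftrightarrow> singular_point I HE t0"
    and "m t0 \<noteq> 0 \<Longrightarrow> \<not> (singular_point I (HEpm \<epsilon>) t0 \<and> singular_point I HE t0)"
  using f_square_less_1[OF assms(1)] m_eq[OF assms(1)] assms(2)
  unfolding singular_HE[OF assms(1)] singular_HEpm[OF assms] by auto

end

theorem corollary3p12:
  fixes I :: "real set"
    and \<gamma> \<gamma>d :: "real \<Rightarrow> real^3"
    and m n f \<phi> :: "real \<Rightarrow> real"
  assumes interval: "is_interval I" "interior I \<noteq> {}"
    and legendre: "spacelike_legendre_curve I \<gamma> \<gamma>d"
    and curvature: "is_curvature I \<gamma> \<gamma>d m n"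
    and dense: "I \<subseteq> closure {t \<in> I. n t \<noteq> 0}"
    and f_smooth: "smooth_on I f"
    and \<phi>_smooth: "smooth_on I \<phi>"
    and f_eq: "\<forall>t\<in>I. m t + f t * n t = 0"
    and \<phi>_eq: "\<forall>t\<in>I. m t * cosh (\<phi> t) + n t * sinh (\<phi> t) = 0"
  shows "(\<forall>t\<in>I. f t = tanh (\<phi> t)) \<and>
    (\<forall>t0\<in>I. \<forall>\<epsilon>\<in>{1, -1}.
       let HEpm = horocyclic_evolute \<epsilon> \<gamma> \<gamma>d f; HE = hyperbolic_evolute \<gamma> \<gamma>d \<phi> in
         (m t0 = 0 \<longrightarrow>
            (singular_point I HEpm t0 \<longleftrightarrow> singular_point I HE t0) \<and>
            (is_cusp 2 3 I HEpm t0 \<longleftrightarrow> is_cusp 2 3 I HE t0) \<and>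
            (is_cusp 3 4 I HEpm t0 \<longleftrightarrow> is_cusp 3 4 I HE t0)) \<and>
         (m t0 \<noteq> 0 \<longrightarrow>
            (singular_point I HEpm t0 \<longrightarrow> regular_point I HE t0) \<and>
            (singular_point I HE t0 \<longrightarrow> regular_point I HEpm t0)) \<and>
         (vector_derivative m (at t0 within I) = 0 \<longrightarrow>
            (is_cusp 2 5 I HEpm t0 \<longleftrightarrow> is_cusp 2 5 I HE t0) \<and>
            (is_cusp 3 5 I HEpm t0 \<longleftrightarrow> is_cusp 3 5 I HE t0)))"
proof -
  interpret legendre_evolutes I \<gamma> \<gamma>d m n f \<phi>
    by unfold_locales (use assms in auto)
  have sing: "(m t0 = 0 \<longrightarrow> singular_point I (HEpm \<epsilon>) t0 = singular_point I HE t0) \<and>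
      (m t0 \<noteq> 0 \<longrightarrow> (singular_point I (HEpm \<epsilon>) t0 \<longrightarrow> regular_point I HE t0) \<and>
        (singular_point I HE t0 \<longrightarrow> regular_point I (HEpm \<epsilon>) t0))"
    if "t0 \<in> I" "\<epsilon> = 1 \<or> \<epsilon> = -1" for t0 \<epsilon>
    using singular_HE_iff_HEpm[OF that] unfolding singular_point_def regular_point_def by blast
  show ?thesis
    unfolding Let_def
  proof (intro conjI ballI)
    show "f t = tanh (\<phi> t)" if "t \<in> I" for t
      by (rule f_tanh[OF that])
    fix t0 \<epsilon> :: real
    assume t0: "t0 \<in> I" and "\<epsilon> \<in> {1, -1}"
    then have \<epsilon>: "\<epsilon> = 1 \<or> \<epsilon> = -1" by simp
    show "m t0 = 0 \<longrightarrow> singular_point I (HEpm \<epsilon>) t0 = singular_point I HE t0 \<and>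
        is_cusp 2 3 I (HEpm \<epsilon>) t0 = is_cusp 2 3 I HE t0 \<and>
        is_cusp 3 4 I (HEpm \<epsilon>) t0 = is_cusp 3 4 I HE t0"
      using sing[OF t0 \<epsilon>] cusp_HE_iff_HEpm(1,2)[OF \<epsilon>] by blast
    show "m t0 \<noteq> 0 \<longrightarrow> (singular_point I (HEpm \<epsilon>) t0 \<longrightarrow> regular_point I HE t0) \<and>
        (singular_point I HE t0 \<longrightarrow> regular_point I (HEpm \<epsilon>) t0)"
      using sing[OF t0 \<epsilon>] by blast
    show "vector_derivative m (at t0 within I) = 0 \<longrightarrow>
        is_cusp 2 5 I (HEpm \<epsilon>) t0 = is_cusp 2 5 I HE t0 \<and>
        is_cusp 3 5 I (HEpm \<epsilon>) t0 = is_cusp 3 5 I HE t0"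
      using cusp_HE_iff_HEpm(3,4)[OF \<epsilon>] by blast
  qed
qed

end
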